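(* Let $L\supseteq\mathsf{K4.3}$ be finitely axiomatisable, given as $L=\mathsf{K4.3}\oplus\{\alpha(\mathfrak G_j,\mathfrak D_j,\bot)\mid j\in J_L\}$ with $J_L$ finite. Then $L$ has the quasi-polysize bisimilar model property with bound $(3\boldsymbol k(\varphi_1,\varphi_2)-1)\cdot\max(\boldsymbol c_L+2,\boldsymbol p_L(\varphi_1,\varphi_2))$: for any formulas $\varphi_1,\varphi_2$ without a Craig interpolant in $L$, with $\delta=\mathit{sig}(\varphi_1)\cup\mathit{sig}(\varphi_2)$ and $\sigma=\mathit{sig}(\varphi_1)\cap\mathit{sig}(\varphi_2)$, there exist rooted $\delta$-models $\mathfrak N_1,x_1$ and $\mathfrak N_2,x_2$, each the ordered sum of finitely many simple $\delta$-models based on atomic frames, such that $\mathfrak N_1,x_1\models\varphi_1$, $\mathfrak N_2,x_2\models\neg\varphi_2$, both $\mathfrak N_i$ are based on frames for $L$, $\mathfrak N_1,x_1\sim_\sigma\mathfrak N_2,x_2$, and $\|\mathfrak N_i\|\le(3\boldsymbol k(\varphi_1,\varphi_2)-1)\cdot\max(\boldsymbol c_L+2,\boldsymbol p_L(\varphi_1,\varphi_2))$ for $i=1,2$.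
   Context: Modal formulas over $p_0,p_1,\dots$ with $\top,\bot,\neg,\wedge,\Diamond$, $\Box=\neg\Diamond\neg$, $\Box^+\varphi=\varphi\wedge\Box\varphi$; $\mathit{sig}(\varphi)$ = variables of $\varphi$; $|\varphi|$ = number of subformulas of $\varphi$ and their negations. $\mathsf{K4.3}=\mathsf{K}\oplus(\Box p_0\to\Box\Box p_0)\oplus(\Box(\Box^+p_0\to p_1)\vee\Box(\Box^+p_1\to p_0))$. Craig interpolant of $\varphi_1,\varphi_2$ in $L$: $\iota$ with $\mathit{sig}(\iota)\subseteq\mathit{sig}(\varphi_1)\cap\mathit{sig}(\varphi_2)$ and $\varphi_1\to\iota,\iota\to\varphi_2\in L$. $\alpha(\mathfrak G,\mathfrak D,\bot)$ denotes Zakharyaschev's canonical formula for a finite rooted Kripke frame $\mathfrak G=(V,S)$ for $\mathsf{K4.3}$ and a set $\mathfrak D\subseteq V$ of irreflexive non-root points; every finitely axiomatisable $L\supseteq\mathsf{K4.3}$ has such a representation with finite $J_L$. Put $\boldsymbol c_L=\max_j|V_j|$ (for $\mathfrak G_j=(V_j,S_j)$), $\boldsymbol k(\varphi_1,\varphi_2)=3+3\max(|\varphi_1|,|\varphi_2|)$, $\boldsymbol p_L(\varphi_1,\varphi_2)=2(\boldsymbol k-1)\max(\boldsymbol c_L+2,\boldsymbol k)+\boldsymbol k$. General frames $(W,R,\mathcal P)$, $\delta$-models (valuation $\delta\to\mathcal P$), frames for $L$ (validating every formula of $L$), rooted ($xRy$ for all $y\ne x$), $\sigma$-bisimulation (relation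 preserving the truth of variables in $\sigma$ and satisfying back-and-forth for $R$), $\sim_\sigma$ as usual. Ordered sum $\lhd$: disjoint union where points of earlier summands see all points of later ones; internal sets are unions of internal sets of the summands; valuations are unions. $\mathfrak C(k,\bullet)$ ($0<k<\omega$): points $a_0,\dots,a_{k-1},b_0,b_1,\dots$, $xRy$ iff $x=a_i$ or ($x=b_n,y=b_m,m<n$), internal sets generated by $X_i=\{a_i\}\cup\{b_n\mid n\equiv i\pmod k\}$ and all $\{b_n\}$; $\mathfrak C(k,\circ)$: same with all $b_n$ reflexive. Simple $\delta$-model: based on a finite Kripke frame, or on $\mathfrak C(k,\ast)$ with each $\mathfrak v(p)$ a union of some $X_i$. Atomic frames: $m^<$ (chain of $m$ irreflexive points), $\circ\lhd m^<$, reflexive $k$-point cluster, $\mathfrak C(k,\bullet)$, $\mathfrak C(k,\circ)$ ($0<m<\omega$, $0<k\le2^{|\delta|}$), with size $\|m^<\|=m$, $\|\circ\lhd m^<\|=m+1$, and size $k$ for the other three. If $\mathfrak N=\mathfrak N_0\lhd\dots\lhd\mathfrak N_{n-1}$ with $\mathfrak N_j$ simple on atomic frames $\mathfrak F_j$, then $\|\mathfrak N\|=\sum_j\|\mathfrak F_j\|$. *)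

theory Defs
  imports Main
begin

section \<open>Modal formulas and normal modal logics\<close>

datatype fm = Var nat | Top | Bot | Neg fm | And fm fm | Dia fm

abbreviation Or :: "fm \<Rightarrow> fm \<Rightarrow> fm" where
  "Or \<phi> \<psi> \<equiv> Neg (And (Neg \<phi>) (Neg \<psi>))"

abbreviation Imp :: "fm \<Rightarrow> fm \<Rightarrow> fm" where
  "Imp \<phi> \<psi> \<equiv> Neg (And \<phi> (Neg \<psi>))"

abbreviation Iff :: "fm \<Rightarrow> fm \<Rightarrow> fm" where
  "Iff \<phi> \<psi> \<equiv> And (Imp \<phi> \<psi>) (Imp \<psi> \<phi>)"

abbreviation Box :: "fm \<Rightarrow> fm" where
  "Box \<phi> \<equiv> Neg (Dia (Neg \<phi>))"

abbreviation Boxp :: "fm \<Rightarrow> fm" where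
  "Boxp \<phi> \<equiv> And \<phi> (Box \<phi>)"

fun Conj :: "fm list \<Rightarrow> fm" where
  "Conj [] = Top"
| "Conj (\<phi> # \<phi>s) = And \<phi> (Conj \<phi>s)"

fun sig :: "fm \<Rightarrow> nat set" where
  "sig (Var p) = {p}"
| "sig Top = {}"
| "sig Bot = {}"
| "sig (Neg \<phi>) = sig \<phi>"
| "sig (And \<phi> \<psi>) = sig \<phi> \<union> sig \<psi>"
| "sig (Dia \<phi>) = sig \<phi>"

fun subfms :: "fm \<Rightarrow> fm set" where
  "subfms (Var p) = {Var p}"
| "subfms Top = {Top}"
| "subfms Bot = {Bot}"
| "subfms (Neg \<phi>) = insert (Neg \<phi>) (subfms \<phi>)"
| "subfms (And \<phi> \<psi>) = insert (And \<phi> \<psi>) (subfms \<phi> \<union> subfms \<psi>)"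
| "subfms (Dia \<phi>) = insert (Dia \<phi>) (subfms \<phi>)"

definition fm_size :: "fm \<Rightarrow> nat" where
  "fm_size \<phi> = card (subfms \<phi> \<union> Neg ` subfms \<phi>)"

fun subst :: "(nat \<Rightarrow> fm) \<Rightarrow> fm \<Rightarrow> fm" where
  "subst s (Var p) = s p"
| "subst s Top = Top"
| "subst s Bot = Bot"
| "subst s (Neg \<phi>) = Neg (subst s \<phi>)"
| "subst s (And \<phi> \<psi>) = And (subst s \<phi>) (subst s \<psi>)"
| "subst s (Dia \<phi>) = Dia (subst s \<phi>)"

text \<open>Propositional evaluation: variables and formulas starting with a diamond count as atoms.\<close>

fun prop_eval :: "(fm \<Rightarrow> bool) \<Rightarrow> fm \<Rightarrow> bool" where
  "prop_eval h (Var p) = h (Var p)"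
| "prop_eval h Top = True"
| "prop_eval h Bot = False"
| "prop_eval h (Neg \<phi>) = (\<not> prop_eval h \<phi>)"
| "prop_eval h (And \<phi> \<psi>) = (prop_eval h \<phi> \<and> prop_eval h \<psi>)"
| "prop_eval h (Dia \<phi>) = h (Dia \<phi>)"

definition tautology :: "fm \<Rightarrow> bool" where
  "tautology \<phi> \<longleftrightarrow> (\<forall>h. prop_eval h \<phi>)"

text \<open>The least normal modal logic containing a set of formulas. As the diamond is primitive,
  the duality axiom has to be added to the usual axioms in terms of the box.\<close>

inductive_set nml :: "fm set \<Rightarrow> fm set" for \<Gamma> :: "fm set" where
  ax: "\<phi> \<in> \<Gamma> \<Longrightarrow> \<phi> \<in> nml \<Gamma>"
| taut: "tautology \<phi> \<Longrightarrow> \<phi> \<in> nml \<Gamma>"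
| K: "Imp (Box (Imp \<phi> \<psi>)) (Imp (Box \<phi>) (Box \<psi>)) \<in> nml \<Gamma>"
| dual: "Iff (Dia \<phi>) (Neg (Box (Neg \<phi>))) \<in> nml \<Gamma>"
| mp: "Imp \<phi> \<psi> \<in> nml \<Gamma> \<Longrightarrow> \<phi> \<in> nml \<Gamma> \<Longrightarrow> \<psi> \<in> nml \<Gamma>"
| nec: "\<phi> \<in> nml \<Gamma> \<Longrightarrow> Box \<phi> \<in> nml \<Gamma>"
| sub: "\<phi> \<in> nml \<Gamma> \<Longrightarrow> subst s \<phi> \<in> nml \<Gamma>"

definition oplus :: "fm set \<Rightarrow> fm set \<Rightarrow> fm set" where
  "oplus L \<Gamma> = nml (L \<union> \<Gamma>)"

definition logic_K :: "fm set" where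
  "logic_K = nml {}"

definition K43 :: "fm set" where
  "K43 = oplus
     (oplus logic_K {Imp (Box (Var 0)) (Box (Box (Var 0)))})
     {Or (Box (Imp (Boxp (Var 0)) (Var 1))) (Box (Imp (Boxp (Var 1)) (Var 0)))}"

definition craig_interpolant :: "fm set \<Rightarrow> fm \<Rightarrow> fm \<Rightarrow> fm \<Rightarrow> bool" where
  "craig_interpolant L \<phi>\<^sub>1 \<phi>\<^sub>2 \<iota> \<longleftrightarrow>
     sig \<iota> \<subseteq> sig \<phi>\<^sub>1 \<inter> sig \<phi>\<^sub>2 \<and> Imp \<phi>\<^sub>1 \<iota> \<in> L \<and> Imp \<iota> \<phi>\<^sub>2 \<in> L"


section \<open>General frames and models\<close>

text \<open>Relations are only ever consulted on the carrier, so their values outside it are irrelevant.\<close>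

record 'w gframe =
  worlds :: "'w set"
  acc :: "'w \<Rightarrow> 'w \<Rightarrow> bool"
  internal :: "'w set set"

definition dia_set :: "'w set \<Rightarrow> ('w \<Rightarrow> 'w \<Rightarrow> bool) \<Rightarrow> 'w set \<Rightarrow> 'w set" where
  "dia_set W R X = {x \<in> W. \<exists>y\<in>X. R x y}"

definition general_frame :: "'w gframe \<Rightarrow> bool" where
  "general_frame F \<longleftrightarrow>
     worlds F \<noteq> {} \<and> internal F \<subseteq> Pow (worlds F) \<and> worlds F \<in> internal F \<and>
     (\<forall>X\<in>internal F. \<forall>Y\<in>internal F. X \<inter> Y \<in> internal F) \<and>
     (\<forall>X\<in>internal F. worlds F - X \<in> internal F) \<and>
     (\<forall>X\<in>internal F. dia_set (worlds F) (acc F) X \<in> internal F)"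

definition kripke :: "'w set \<Rightarrow> ('w \<Rightarrow> 'w \<Rightarrow> bool) \<Rightarrow> 'w gframe" where
  "kripke W R = \<lparr>worlds = W, acc = R, internal = Pow W\<rparr>"

definition is_root :: "'w gframe \<Rightarrow> 'w \<Rightarrow> bool" where
  "is_root F x \<longleftrightarrow> x \<in> worlds F \<and> (\<forall>y\<in>worlds F. y \<noteq> x \<longrightarrow> acc F x y)"

fun holds :: "'w gframe \<Rightarrow> (nat \<Rightarrow> 'w set) \<Rightarrow> 'w \<Rightarrow> fm \<Rightarrow> bool" where
  "holds F v x (Var p) \<longleftrightarrow> x \<in> v p"
| "holds F v x Top \<longleftrightarrow> True"
| "holds F v x Bot \<longleftrightarrow> False"
| "holds F v x (Neg \<phi>) \<longleftrightarrow> \<not> holds F v x \<phi>"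
| "holds F v x (And \<phi> \<psi>) \<longleftrightarrow> holds F v x \<phi> \<and> holds F v x \<psi>"
| "holds F v x (Dia \<phi>) \<longleftrightarrow> (\<exists>y\<in>worlds F. acc F x y \<and> holds F v y \<phi>)"

definition valid :: "'w gframe \<Rightarrow> fm \<Rightarrow> bool" where
  "valid F \<phi> \<longleftrightarrow> (\<forall>v. (\<forall>p. v p \<in> internal F) \<longrightarrow> (\<forall>x\<in>worlds F. holds F v x \<phi>))"

definition frame_for :: "fm set \<Rightarrow> 'w gframe \<Rightarrow> bool" where
  "frame_for L F \<longleftrightarrow> general_frame F \<and> (\<forall>\<phi>\<in>L. valid F \<phi>)"

text \<open>A model is a frame with a total valuation; being a model over a signature only constrains
  the valuation on that signature.\<close>

type_synonym 'w gmodel = "'w gframe \<times> (nat \<Rightarrow> 'w set)"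

definition is_model :: "nat set \<Rightarrow> 'w gmodel \<Rightarrow> bool" where
  "is_model \<delta> M \<longleftrightarrow> general_frame (fst M) \<and> (\<forall>p\<in>\<delta>. snd M p \<in> internal (fst M))"

definition bisimulation ::
  "nat set \<Rightarrow> 'a gmodel \<Rightarrow> 'b gmodel \<Rightarrow> ('a \<times> 'b) set \<Rightarrow> bool" where
  "bisimulation \<sigma> M N Z \<longleftrightarrow>
     Z \<subseteq> worlds (fst M) \<times> worlds (fst N) \<and>
     (\<forall>(x, y)\<in>Z.
        (\<forall>p\<in>\<sigma>. x \<in> snd M p \<longleftrightarrow> y \<in> snd N p) \<and>
        (\<forall>x'\<in>worlds (fst M). acc (fst M) x x' \<longrightarrow>
           (\<exists>y'\<in>worlds (fst N). acc (fst N) y y' \<and> (x', y') \<in> Z)) \<and>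
        (\<forall>y'\<in>worlds (fst N). acc (fst N) y y' \<longrightarrow>
           (\<exists>x'\<in>worlds (fst M). acc (fst M) x x' \<and> (x', y') \<in> Z)))"

definition bisimilar ::
  "nat set \<Rightarrow> 'a gmodel \<Rightarrow> 'a \<Rightarrow> 'b gmodel \<Rightarrow> 'b \<Rightarrow> bool" where
  "bisimilar \<sigma> M x N y \<longleftrightarrow> (\<exists>Z. bisimulation \<sigma> M N Z \<and> (x, y) \<in> Z)"


section \<open>Ordered sums\<close>

text \<open>The disjoint union of the summands is formed by tagging points with summand numbers.\<close>

definition osum_frame :: "'w gframe list \<Rightarrow> (nat \<times> 'w) gframe" where
  "osum_frame Fs =
     \<lparr>worlds = (SIGMA j:{..<length Fs}. worlds (Fs ! j)),
      acc = (\<lambda>(i, x) (j, y). i < j \<or> i = j \<and> acc (Fs ! i) x y),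
      internal = {(SIGMA j:{..<length Fs}. X j) | X.
                    \<forall>j<length Fs. X j \<in> internal (Fs ! j)}\<rparr>"

definition osum :: "'w gmodel list \<Rightarrow> (nat \<times> 'w) gmodel" where
  "osum Ms =
     (osum_frame (map fst Ms), \<lambda>p. SIGMA j:{..<length Ms}. snd (Ms ! j) p)"


section \<open>Atomic frames and simple models\<close>

text \<open>\<open>PA i\<close> and \<open>PB n\<close> are the points $a_i$ and $b_n$; the finite atomic frames live on the
  points \<open>PA i\<close> of the same type.\<close>

datatype point = PA nat | PB nat

inductive_set generated_internal ::
  "'w set \<Rightarrow> ('w \<Rightarrow> 'w \<Rightarrow> bool) \<Rightarrow> 'w set set \<Rightarrow> 'w set set"
  for W :: "'w set" and R :: "'w \<Rightarrow> 'w \<Rightarrow> bool" and \<X> :: "'w set set" where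
  gen: "X \<in> \<X> \<Longrightarrow> X \<in> generated_internal W R \<X>"
| top: "W \<in> generated_internal W R \<X>"
| int: "X \<in> generated_internal W R \<X> \<Longrightarrow> Y \<in> generated_internal W R \<X> \<Longrightarrow>
        X \<inter> Y \<in> generated_internal W R \<X>"
| compl: "X \<in> generated_internal W R \<X> \<Longrightarrow> W - X \<in> generated_internal W R \<X>"
| dia: "X \<in> generated_internal W R \<X> \<Longrightarrow> dia_set W R X \<in> generated_internal W R \<X>"

definition CX :: "nat \<Rightarrow> nat \<Rightarrow> point set" where
  "CX k i = insert (PA i) {PB n | n. n mod k = i mod k}"

definition C_worlds :: "nat \<Rightarrow> point set" where
  "C_worlds k = PA ` {..<k} \<union> range PB"

definition C_acc :: "bool \<Rightarrow> point \<Rightarrow> point \<Rightarrow> bool" where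
  "C_acc rf x y \<longleftrightarrow>
     (\<exists>i. x = PA i) \<or> (\<exists>n m. x = PB n \<and> y = PB m \<and> (m < n \<or> rf \<and> m = n))"

text \<open>\<open>C_frame False k\<close> is the frame $\mathfrak C(k,\bullet)$ and \<open>C_frame True k\<close> is
  $\mathfrak C(k,\circ)$.\<close>

definition C_frame :: "bool \<Rightarrow> nat \<Rightarrow> point gframe" where
  "C_frame rf k =
     \<lparr>worlds = C_worlds k, acc = C_acc rf,
      internal = generated_internal (C_worlds k) (C_acc rf)
                   (CX k ` {..<k} \<union> {{PB n} | n. True})\<rparr>"

definition simple_model :: "nat set \<Rightarrow> point gmodel \<Rightarrow> bool" where
  "simple_model \<delta> M \<longleftrightarrow> is_model \<delta> M \<and>
     ((\<exists>W R. finite W \<and> fst M = kripke W R) \<or>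
      (\<exists>k>0. \<exists>rf. fst M = C_frame rf k \<and>
         (\<forall>p\<in>\<delta>. \<exists>I\<subseteq>{..<k}. snd M p = (\<Union>i\<in>I. CX k i))))"

text \<open>\<open>IrrChain m\<close> is a chain of \<open>m\<close> irreflexive points; \<open>ReflIrrChain m\<close> is a reflexive point
  followed by such a chain; \<open>Cluster k\<close> is the reflexive cluster with \<open>k\<close> points.\<close>

datatype atomic =
  IrrChain nat | ReflIrrChain nat | Cluster nat | CIrr nat | CRefl nat

fun atomic_frame :: "atomic \<Rightarrow> point gframe" where
  "atomic_frame (IrrChain m) =
     kripke (PA ` {..<m}) (\<lambda>x y. \<exists>i j. x = PA i \<and> y = PA j \<and> i < j)"
| "atomic_frame (ReflIrrChain m) =
     kripke (PA ` {..m}) (\<lambda>x y. \<exists>i j. x = PA i \<and> y = PA j \<and> (i < j \<or> i = 0 \<and> j = 0))"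
| "atomic_frame (Cluster k) = kripke (PA ` {..<k}) (\<lambda>x y. True)"
| "atomic_frame (CIrr k) = C_frame False k"
| "atomic_frame (CRefl k) = C_frame True k"

fun atomic_for :: "nat set \<Rightarrow> atomic \<Rightarrow> bool" where
  "atomic_for \<delta> (IrrChain m) \<longleftrightarrow> 0 < m"
| "atomic_for \<delta> (ReflIrrChain m) \<longleftrightarrow> 0 < m"
| "atomic_for \<delta> (Cluster k) \<longleftrightarrow> 0 < k \<and> k \<le> 2 ^ card \<delta>"
| "atomic_for \<delta> (CIrr k) \<longleftrightarrow> 0 < k \<and> k \<le> 2 ^ card \<delta>"
| "atomic_for \<delta> (CRefl k) \<longleftrightarrow> 0 < k \<and> k \<le> 2 ^ card \<delta>"

fun atomic_size :: "atomic \<Rightarrow> nat" where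
  "atomic_size (IrrChain m) = m"
| "atomic_size (ReflIrrChain m) = m + 1"
| "atomic_size (Cluster k) = k"
| "atomic_size (CIrr k) = k"
| "atomic_size (CRefl k) = k"

text \<open>A finite sequence of simple models based on atomic frames, given as a list of atomic frames
  with valuations; its size is that of the ordered sum relative to this decomposition.\<close>

type_synonym atomic_seq = "(atomic \<times> (nat \<Rightarrow> point set)) list"

definition seq_models :: "atomic_seq \<Rightarrow> point gmodel list" where
  "seq_models As = map (\<lambda>(a, v). (atomic_frame a, v)) As"

definition simple_atomic_seq :: "nat set \<Rightarrow> atomic_seq \<Rightarrow> bool" where
  "simple_atomic_seq \<delta> As \<longleftrightarrow>
     (\<forall>a\<in>fst ` set As. atomic_for \<delta> a) \<and> (\<forall>M\<in>set (seq_models As). simple_model \<delta> M)"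

definition seq_size :: "atomic_seq \<Rightarrow> nat" where
  "seq_size As = (\<Sum>(a, v)\<leftarrow>As. atomic_size a)"

definition quasi_polysize_bmp :: "fm set \<Rightarrow> (fm \<Rightarrow> fm \<Rightarrow> nat) \<Rightarrow> bool" where
  "quasi_polysize_bmp L bound \<longleftrightarrow>
     (\<forall>\<phi>\<^sub>1 \<phi>\<^sub>2. (\<nexists>\<iota>. craig_interpolant L \<phi>\<^sub>1 \<phi>\<^sub>2 \<iota>) \<longrightarrow>
       (let \<delta> = sig \<phi>\<^sub>1 \<union> sig \<phi>\<^sub>2; \<sigma> = sig \<phi>\<^sub>1 \<inter> sig \<phi>\<^sub>2 in
        \<exists>As\<^sub>1 As\<^sub>2 N\<^sub>1 N\<^sub>2 x\<^sub>1 x\<^sub>2.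
          simple_atomic_seq \<delta> As\<^sub>1 \<and> N\<^sub>1 = osum (seq_models As\<^sub>1) \<and>
          simple_atomic_seq \<delta> As\<^sub>2 \<and> N\<^sub>2 = osum (seq_models As\<^sub>2) \<and>
          is_model \<delta> N\<^sub>1 \<and> is_root (fst N\<^sub>1) x\<^sub>1 \<and>
          is_model \<delta> N\<^sub>2 \<and> is_root (fst N\<^sub>2) x\<^sub>2 \<and>
          holds (fst N\<^sub>1) (snd N\<^sub>1) x\<^sub>1 \<phi>\<^sub>1 \<and>
          holds (fst N\<^sub>2) (snd N\<^sub>2) x\<^sub>2 (Neg \<phi>\<^sub>2) \<and>
          frame_for L (fst N\<^sub>1) \<and> frame_for L (fst N\<^sub>2) \<and>
          bisimilar \<sigma> N\<^sub>1 x\<^sub>1 N\<^sub>2 x\<^sub>2 \<and>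
          seq_size As\<^sub>1 \<le> bound \<phi>\<^sub>1 \<phi>\<^sub>2 \<and> seq_size As\<^sub>2 \<le> bound \<phi>\<^sub>1 \<phi>\<^sub>2))"


section \<open>Canonical formulas\<close>

text \<open>The points of the frame are enumerated without repetition by a list whose head $a_0$ is
  the root; variable \<open>i\<close> belongs to the point $a_i$.\<close>

definition canonical_data ::
  "'v set \<Rightarrow> ('v \<Rightarrow> 'v \<Rightarrow> bool) \<Rightarrow> 'v list \<Rightarrow> 'v set \<Rightarrow> bool" where
  "canonical_data V S as D \<longleftrightarrow>
     finite V \<and> frame_for K43 (kripke V S) \<and>
     distinct as \<and> set as = V \<and> is_root (kripke V S) (hd as) \<and>
     D \<subseteq> {d \<in> V. \<not> S d d \<and> \<not> is_root (kripke V S) d}"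

text \<open>Zakharyaschev's canonical formula
  $$\bigwedge_{a_i S a_j}\varphi_{ij}\wedge\bigwedge_i\varphi_i\wedge
    \bigwedge_{\mathfrak d}\varphi_{\mathfrak d}\wedge\varphi_\bot\to p_0$$ where
  \<^item> $\varphi_{ij}=\Box^+(\Box p_j\to p_i)$,
  \<^item> $\varphi_i=\Box^+((\bigwedge_{\neg a_iSa_k}\Box p_k\wedge\bigwedge_{j\ne i}p_j\to p_i)\to p_i)$,
  \<^item> $\varphi_{\mathfrak d}=\Box^+(\bigwedge_{a_i\notin\mathfrak d\cup\mathfrak d\uparrow}\Box p_i
      \wedge\bigwedge_i p_i\to\bigvee_{a_j\in\mathfrak d}\Box p_j)$,
  \<^item> $\varphi_\bot=\Box^+(\bigwedge_i\Box^+p_i\to\bot)$.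

  In general closed domains are antichains; in rooted frames for K4.3 these are singletons
  $\mathfrak d=\{d\}$, and \<open>D\<close> is the set of these points \<open>d\<close>.\<close>

definition canonical_fm :: "('v \<Rightarrow> 'v \<Rightarrow> bool) \<Rightarrow> 'v list \<Rightarrow> 'v set \<Rightarrow> fm" where
  "canonical_fm S as D =
     (let I = [0..<length as] in
      Imp (Conj
        ([Boxp (Imp (Box (Var j)) (Var i)). i \<leftarrow> I, j \<leftarrow> I, S (as ! i) (as ! j)] @
         [Boxp (Imp (Imp (And (Conj [Box (Var k). k \<leftarrow> I, \<not> S (as ! i) (as ! k)])
                              (Conj [Var j. j \<leftarrow> I, j \<noteq> i]))
                         (Var i))
                    (Var i)). i \<leftarrow> I] @
         [Boxp (Imp (And (Conj [Box (Var i). i \<leftarrow> I, i \<noteq> d \<and> \<not> S (as ! d) (as ! i)])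
                         (Conj [Var i. i \<leftarrow> I]))
                    (Box (Var d))). d \<leftarrow> I, as ! d \<in> D] @
         [Boxp (Imp (Conj [Boxp (Var i). i \<leftarrow> I]) Bot)]))
        (Var 0))"


section \<open>Bounds\<close>

text \<open>For the empty axiomatisation (the logic K4.3 itself) the maximum is taken to be 0.\<close>

definition c_bound :: "'j set \<Rightarrow> ('j \<Rightarrow> 'v set) \<Rightarrow> nat" where
  "c_bound J V = Max (insert 0 ((\<lambda>j. card (V j)) ` J))"

definition k_bound :: "fm \<Rightarrow> fm \<Rightarrow> nat" where
  "k_bound \<phi>\<^sub>1 \<phi>\<^sub>2 = 3 + 3 * max (fm_size \<phi>\<^sub>1) (fm_size \<phi>\<^sub>2)"

definition p_bound :: "nat \<Rightarrow> fm \<Rightarrow> fm \<Rightarrow> nat" where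
  "p_bound c \<phi>\<^sub>1 \<phi>\<^sub>2 =
     2 * (k_bound \<phi>\<^sub>1 \<phi>\<^sub>2 - 1) * max (c + 2) (k_bound \<phi>\<^sub>1 \<phi>\<^sub>2) + k_bound \<phi>\<^sub>1 \<phi>\<^sub>2"

end

theory Submission
  imports Defs
begin

text \<open>If \<open>\<phi>\<^sub>1\<close> and \<open>\<phi>\<^sub>2\<close> have no interpolant, then there are complete types \<open>x\<^sub>1\<close> and \<open>x\<^sub>2\<close> over \<open>\<delta>\<close>
  that contain \<open>\<phi>\<^sub>1\<close> and \<open>\<not>\<phi>\<^sub>2\<close> and agree on all \<open>\<sigma>\<close>-formulas. The canonical models generated by them are
  linear and project onto the same canonical model over \<open>\<sigma>\<close>. In the two models we select, for each
  subformula, a point in the last cluster where it is true, then the points needed to keep the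
  immediate predecessors of irreflexive points, and finally, for each \<open>\<sigma>\<close>-type selected in either
  model, a last point of that \<open>\<sigma>\<close>-type. A selected cluster that is the last one satisfying some
  formula is kept as it is. A selected cluster that is a limit of later points is replaced by
  $\mathfrak C(k,\circ)$ or $\mathfrak C(k,\bullet)$, depending on whether it is a limit of such reflexive clusters or of
  irreflexive points with long irreflexive chains before them. The choice is made in the common
  projection where the clusters have to correspond, hence identically in the two models. A
  refutation of a canonical formula with at most \<open>c\<close> points in the resulting ordered sum can be moved
  into the canonical model, point by point from the last to the first, where all valuations by
  formulas validate the logic.\<close>

section \<open>Types\<close>

text \<open>Each sum must be a frame for \<open>L\<close>, that is, withstand all internal
  valuations, whereas the canonical model obeys \<open>L\<close> only under valuations by formulas.
  No formula separates a limit cluster from what follows it; kept as a finite cluster it would be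
  internal and allow refutations that no formula valuation imitates. In the infinite atomic frames
  an internal set containing some a_i contains infinitely many b_n of its class, and these can be
  moved to definable points after the cluster. Bisimilarity is obtained by projecting both
  selections to one finite set \<open>Q\<close> of \<sigma>-types and lifting each type to its last
  preimage, which is seen from every point whose type sees that type. The counting: at most
  \<open>m\<close> initial points, \<open>m\<close> being one more than the larger formula size,
  each completed by at most \<open>c + 2\<close> supporting points, give \<open>m * (c + 3)\<close>
  points per model; so \<open>Q\<close> has at most \<open>2 * m * (c + 3)\<close> members and a sum
  has size at most \<open>3 * m * (c + 3)\<close>. Here \<open>3 * m\<close> is the number
  \<open>k_bound\<close> of the statement, and \<open>c + 3\<close> does not exceed the second
  factor of the bound.\<close>

definition Fm :: "nat set \<Rightarrow> fm set" where
  "Fm X = {\<phi>. sig \<phi> \<subseteq> X}"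

lemma Fm_simps [simp]:
  "Var p \<in> Fm X \<longleftrightarrow> p \<in> X" "Top \<in> Fm X" "Bot \<in> Fm X" "Neg \<phi> \<in> Fm X \<longleftrightarrow> \<phi> \<in> Fm X"
  "And \<phi> \<psi> \<in> Fm X \<longleftrightarrow> \<phi> \<in> Fm X \<and> \<psi> \<in> Fm X" "Dia \<phi> \<in> Fm X \<longleftrightarrow> \<phi> \<in> Fm X"
  by (auto simp: Fm_def)

lemma Fm_mono: "X \<subseteq> Y \<Longrightarrow> Fm X \<subseteq> Fm Y"
  by (auto simp: Fm_def)

lemma Conj_in_Fm [simp]: "Conj xs \<in> Fm X \<longleftrightarrow> set xs \<subseteq> Fm X"
  by (induction xs) auto

lemma prop_eval_Conj [simp]: "prop_eval h (Conj xs) \<longleftrightarrow> (\<forall>\<phi>\<in>set xs. prop_eval h \<phi>)"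
  by (induction xs) auto

definition crel :: "fm set \<Rightarrow> fm set \<Rightarrow> bool" where
  "crel y z \<longleftrightarrow> (\<forall>\<chi>\<in>z. Dia \<chi> \<in> y)"

section \<open>Maximal consistent sets over a signature\<close>

locale k43_logic =
  fixes L :: "fm set"
  assumes taut: "tautology \<phi> \<Longrightarrow> \<phi> \<in> L"
    and K: "Imp (Box (Imp \<phi> \<psi>)) (Imp (Box \<phi>) (Box \<psi>)) \<in> L"
    and dual: "Iff (Dia \<phi>) (Neg (Box (Neg \<phi>))) \<in> L"
    and mp: "Imp \<phi> \<psi> \<in> L \<Longrightarrow> \<phi> \<in> L \<Longrightarrow> \<psi> \<in> L"
    and nec: "\<phi> \<in> L \<Longrightarrow> Box \<phi> \<in> L"
    and four: "Imp (Box \<phi>) (Box (Box \<phi>)) \<in> L"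
    and three: "Or (Box (Imp (Boxp \<phi>) \<psi>)) (Box (Imp (Boxp \<psi>) \<phi>)) \<in> L"
begin

lemma taut_mp: "\<phi> \<in> L \<Longrightarrow> tautology (Imp \<phi> \<psi>) \<Longrightarrow> \<psi> \<in> L"
  using mp taut by blast

lemma taut_mp2: "\<phi> \<in> L \<Longrightarrow> \<chi> \<in> L \<Longrightarrow> tautology (Imp \<phi> (Imp \<chi> \<psi>)) \<Longrightarrow> \<psi> \<in> L"
  using mp taut by blast

lemma box_mono: "Imp \<phi> \<psi> \<in> L \<Longrightarrow> Imp (Box \<phi>) (Box \<psi>) \<in> L"
  using K mp nec by blast

definition cons :: "fm set \<Rightarrow> bool" where
  "cons \<Sigma> \<longleftrightarrow> (\<forall>xs. set xs \<subseteq> \<Sigma> \<longrightarrow> Neg (Conj xs) \<notin> L)"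

text \<open>Everything is relative to the formulas over \<open>X\<close>, so that types over
  \<delta> and over \<sigma> can be compared by intersecting with \<open>Fm\<close>. The
  truth-functional clauses together with the theorems of \<open>L\<close> yield closure under
  provable implication (\<open>mcs_Imp\<close>).\<close>

definition mcs :: "nat set \<Rightarrow> fm set \<Rightarrow> bool" where
  "mcs X w \<longleftrightarrow> w \<subseteq> Fm X \<and> L \<inter> Fm X \<subseteq> w \<and>
     (\<forall>\<phi>\<in>Fm X. Neg \<phi> \<in> w \<longleftrightarrow> \<phi> \<notin> w) \<and>
     (\<forall>\<phi>\<in>Fm X. \<forall>\<psi>\<in>Fm X. And \<phi> \<psi> \<in> w \<longleftrightarrow> \<phi> \<in> w \<and> \<psi> \<in> w)"

lemma mcs_Fm: "mcs X w \<Longrightarrow> \<phi> \<in> w \<Longrightarrow> \<phi> \<in> Fm X"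
  by (auto simp: mcs_def)

lemma mcs_L: "mcs X w \<Longrightarrow> \<phi> \<in> Fm X \<Longrightarrow> \<phi> \<in> L \<Longrightarrow> \<phi> \<in> w"
  by (auto simp: mcs_def)

lemma mcs_Neg: "mcs X w \<Longrightarrow> \<phi> \<in> Fm X \<Longrightarrow> Neg \<phi> \<in> w \<longleftrightarrow> \<phi> \<notin> w"
  by (auto simp: mcs_def)

lemma mcs_And: "mcs X w \<Longrightarrow> \<phi> \<in> Fm X \<Longrightarrow> \<psi> \<in> Fm X \<Longrightarrow> And \<phi> \<psi> \<in> w \<longleftrightarrow> \<phi> \<in> w \<and> \<psi> \<in> w"
  by (auto simp: mcs_def)

lemma mcs_Top: "mcs X w \<Longrightarrow> Top \<in> w"
  by (rule mcs_L) (auto intro: taut simp: tautology_def)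

lemma mcs_Bot: "mcs X w \<Longrightarrow> Bot \<notin> w"
  using mcs_L[of X w "Neg Bot"] mcs_Neg[of X w Bot] taut[of "Neg Bot"] by (auto simp: tautology_def)

lemmas mcs_simps = mcs_Neg mcs_And mcs_Top mcs_Bot

lemma mcs_Conj: "mcs X w \<Longrightarrow> set xs \<subseteq> Fm X \<Longrightarrow> Conj xs \<in> w \<longleftrightarrow> set xs \<subseteq> w"
  by (induction xs) (auto simp: mcs_simps)

lemma mcs_Imp: "mcs X w \<Longrightarrow> Imp \<phi> \<psi> \<in> L \<Longrightarrow> \<phi> \<in> w \<Longrightarrow> \<psi> \<in> Fm X \<Longrightarrow> \<psi> \<in> w"
  using mcs_L[of X w "Imp \<phi> \<psi>"] mcs_Fm[of X w \<phi>] by (auto simp: mcs_simps)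

lemma mcs_subset_eq: "mcs X w \<Longrightarrow> mcs X v \<Longrightarrow> w \<subseteq> v \<Longrightarrow> w = v"
  using mcs_Fm mcs_Neg by blast

lemma mcs_restrict:
  assumes "mcs X w" "Y \<subseteq> X"
  shows "mcs Y (w \<inter> Fm Y)"
  unfolding mcs_def
proof (intro conjI ballI)
  fix \<phi> assume \<phi>: "\<phi> \<in> Fm Y"
  have sub: "Fm Y \<subseteq> Fm X" by (rule Fm_mono[OF assms(2)])
  show "Neg \<phi> \<in> w \<inter> Fm Y \<longleftrightarrow> \<phi> \<notin> w \<inter> Fm Y" using \<phi> sub mcs_Neg[OF assms(1), of \<phi>] by auto
  fix \<psi> assume "\<psi> \<in> Fm Y"
  then show "And \<phi> \<psi> \<in> w \<inter> Fm Y \<longleftrightarrow> \<phi> \<in> w \<inter> Fm Y \<and> \<psi> \<in> w \<inter> Fm Y"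
    using \<phi> sub mcs_And[OF assms(1), of \<phi> \<psi>] by auto
qed (use assms Fm_mono[OF assms(2)] in \<open>auto simp: mcs_def\<close>)

lemma cons_insert:
  assumes "\<not> cons (insert \<phi> \<Sigma>)"
  obtains ys where "set ys \<subseteq> \<Sigma>" "Neg (And \<phi> (Conj ys)) \<in> L"
proof -
  obtain xs where xs: "set xs \<subseteq> insert \<phi> \<Sigma>" "Neg (Conj xs) \<in> L"
    using assms by (auto simp: cons_def)
  define ys where "ys = filter (\<lambda>x. x \<noteq> \<phi>) xs"
  have "Neg (And \<phi> (Conj ys)) \<in> L"
    by (rule taut_mp[OF xs(2)]) (auto simp: tautology_def ys_def)
  moreover have "set ys \<subseteq> \<Sigma>" using xs by (auto simp: ys_def)
  ultimately show thesis using that by blast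
qed

theorem lindenbaum:
  assumes "\<Sigma> \<subseteq> Fm X" "cons \<Sigma>"
  shows "\<exists>w. mcs X w \<and> \<Sigma> \<subseteq> w"
proof -
  let ?A = "{\<Delta>. \<Sigma> \<subseteq> \<Delta> \<and> \<Delta> \<subseteq> Fm X \<and> cons \<Delta>}"
  have "\<exists>w\<in>?A. \<forall>\<Delta>\<in>?A. w \<subseteq> \<Delta> \<longrightarrow> \<Delta> = w"
  proof (rule subset_Zorn_nonempty)
    show "?A \<noteq> {}" using assms by blast
  next
    fix C assume C: "C \<noteq> {}" "subset.chain ?A C"
    have "cons (\<Union>C)"
      unfolding cons_def
    proof (intro allI impI)
      fix xs assume "set xs \<subseteq> \<Union>C"
      then obtain B where "B \<in> C" "set xs \<subseteq> B"
        using finite_subset_Union_chain[of "set xs" C] C by auto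
      then show "Neg (Conj xs) \<notin> L"
        using C by (auto simp: subset.chain_def cons_def)
    qed
    then show "\<Union>C \<in> ?A" using C by (auto simp: subset.chain_def)
  qed
  then obtain w where "w \<in> ?A" and max': "\<forall>\<Delta>\<in>?A. w \<subseteq> \<Delta> \<longrightarrow> \<Delta> = w" by (elim bexE)
  then have w: "\<Sigma> \<subseteq> w" "w \<subseteq> Fm X" "cons w" by auto
  have max: "\<Delta> = w" if "\<Delta> \<subseteq> Fm X" "cons \<Delta>" "w \<subseteq> \<Delta>" for \<Delta>
    using max' that w(1) by auto
  \<comment> \<open>Maximality gives deductive closure: if \<phi> could not be added, its negation
    would follow from finitely many members of \<open>w\<close>, against the derivation of \<phi>
    from members of \<open>w\<close>.\<close>
  have ded: "\<phi> \<in> w" if "set xs \<subseteq> w" "Imp (Conj xs) \<phi> \<in> L" "\<phi> \<in> Fm X" for xs \<phi>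
  proof (rule ccontr)
    assume "\<phi> \<notin> w"
    then have "\<not> cons (insert \<phi> w)" using max[of "insert \<phi> w"] w that by blast
    then obtain ys where ys: "set ys \<subseteq> w" "Neg (And \<phi> (Conj ys)) \<in> L" by (rule cons_insert)
    have "Neg (Conj (xs @ ys)) \<in> L"
      by (rule taut_mp2[OF that(2) ys(2)]) (auto simp: tautology_def)
    then show False using w that ys by (auto simp: cons_def)
  qed
  have "\<phi> \<in> w" if "\<phi> \<in> L" "\<phi> \<in> Fm X" for \<phi>
    by (rule ded[of "[]"]) (use that taut_mp in \<open>auto simp: tautology_def\<close>)
  moreover have neg: "Neg \<phi> \<in> w \<longleftrightarrow> \<phi> \<notin> w" if "\<phi> \<in> Fm X" for \<phi>
  proof
    assume "Neg \<phi> \<in> w"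
    show "\<phi> \<notin> w"
    proof
      assume "\<phi> \<in> w"
      then have "set [\<phi>, Neg \<phi>] \<subseteq> w" using \<open>Neg \<phi> \<in> w\<close> by simp
      then have "Neg (Conj [\<phi>, Neg \<phi>]) \<notin> L" using w by (auto simp only: cons_def)
      then show False using taut by (auto simp: tautology_def)
    qed
  next
    assume "\<phi> \<notin> w"
    then have "\<not> cons (insert \<phi> w)" using max[of "insert \<phi> w"] w that by blast
    then obtain ys where ys: "set ys \<subseteq> w" "Neg (And \<phi> (Conj ys)) \<in> L" by (rule cons_insert)
    have "Imp (Conj ys) (Neg \<phi>) \<in> L"
      by (rule taut_mp[OF ys(2)]) (auto simp: tautology_def)
    then show "Neg \<phi> \<in> w" using ded ys that by simp
  qed
  moreover have "And \<phi> \<psi> \<in> w \<longleftrightarrow> \<phi> \<in> w \<and> \<psi> \<in> w" if "\<phi> \<in> Fm X" "\<psi> \<in> Fm X" for \<phi> \<psi>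
  proof
    assume "And \<phi> \<psi> \<in> w"
    then show "\<phi> \<in> w \<and> \<psi> \<in> w"
      using ded[of "[And \<phi> \<psi>]" \<phi>] ded[of "[And \<phi> \<psi>]" \<psi>] that taut by (auto simp: tautology_def)
  next
    assume "\<phi> \<in> w \<and> \<psi> \<in> w"
    then show "And \<phi> \<psi> \<in> w"
      using ded[of "[\<phi>, \<psi>]" "And \<phi> \<psi>"] that taut by (auto simp: tautology_def)
  qed
  ultimately have "mcs X w" using w by (auto simp: mcs_def)
  then show ?thesis using w by blast
qed

section \<open>The canonical relation: successors, transitivity, linearity\<close>

lemma box_Conj: "mcs X y \<Longrightarrow> set xs \<subseteq> Fm X \<Longrightarrow> \<forall>\<chi>\<in>set xs. Box \<chi> \<in> y \<Longrightarrow> Box (Conj xs) \<in> y"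
proof (induction xs)
  case Nil
  have "Top \<in> L" by (rule taut) (auto simp: tautology_def)
  then show ?case using Nil mcs_L nec by (metis Conj.simps(1) Fm_simps(2,4,6))
next
  case (Cons \<phi> xs)
  have "Imp \<phi> (Imp (Conj xs) (And \<phi> (Conj xs))) \<in> L" by (rule taut) (auto simp: tautology_def)
  then have 1: "Imp (Box \<phi>) (Box (Imp (Conj xs) (And \<phi> (Conj xs)))) \<in> L" by (rule box_mono)
  have F: "\<phi> \<in> Fm X" "Conj xs \<in> Fm X" using Cons.prems by auto
  have "Box (Imp (Conj xs) (And \<phi> (Conj xs))) \<in> y"
    by (rule mcs_Imp[OF Cons.prems(1) 1]) (use Cons.prems F in auto)
  then have "Imp (Box (Conj xs)) (Box (And \<phi> (Conj xs))) \<in> y"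
    by (rule mcs_Imp[OF Cons.prems(1) K]) (use F in auto)
  moreover have "Box (Conj xs) \<in> y" using Cons by auto
  ultimately show ?case using Cons.prems(1) F by (auto simp: mcs_simps)
qed

lemma dual_mem: "mcs X y \<Longrightarrow> \<phi> \<in> Fm X \<Longrightarrow> Dia \<phi> \<in> y \<longleftrightarrow> Box (Neg \<phi>) \<notin> y"
  using mcs_L[OF _ _ dual, of X y \<phi>] by (auto simp: mcs_simps)

lemma crel_box: "mcs X y \<Longrightarrow> mcs X z \<Longrightarrow> crel y z \<Longrightarrow> \<chi> \<in> Fm X \<Longrightarrow> Box \<chi> \<in> y \<Longrightarrow> \<chi> \<in> z"
  unfolding crel_def using mcs_Neg[of X z \<chi>] mcs_Neg[of X y "Dia (Neg \<chi>)"] by auto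

lemma crelI_box:
  assumes "mcs X y" "mcs X z" "\<And>\<chi>. \<chi> \<in> Fm X \<Longrightarrow> Box \<chi> \<in> y \<Longrightarrow> \<chi> \<in> z"
  shows "crel y z"
  unfolding crel_def
proof
  fix \<chi> assume \<chi>: "\<chi> \<in> z"
  then have F: "\<chi> \<in> Fm X" using assms mcs_Fm by blast
  show "Dia \<chi> \<in> y"
  proof (rule ccontr)
    assume "Dia \<chi> \<notin> y"
    then have "Neg \<chi> \<in> z" using F assms dual_mem by auto
    then show False using F \<chi> assms mcs_Neg by blast
  qed
qed

text \<open>It suffices that each finite conjunction from \<Sigma> is possible at \<open>y\<close>:
  an inconsistency between \<Sigma> and the boxed formulas of \<open>y\<close> would use a finite
  list \<open>as\<close> of the former and put \<open>Box (Neg (Conj as))\<close> into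
  \<open>y\<close>. The version for whole sets serves for single successors, for compactness of
  \<open>W\<close> and for preimages of types alike.\<close>

lemma crel_sat:
  assumes y: "mcs X y" and \<Sigma>: "\<Sigma> \<subseteq> Fm X"
    and sat: "\<And>xs. set xs \<subseteq> \<Sigma> \<Longrightarrow> Dia (Conj xs) \<in> y"
  shows "\<exists>z. mcs X z \<and> crel y z \<and> \<Sigma> \<subseteq> z"
proof -
  let ?B = "{\<chi> \<in> Fm X. Box \<chi> \<in> y}"
  have "cons (\<Sigma> \<union> ?B)"
    unfolding cons_def
  proof (intro allI impI notI)
    fix xs assume xs: "set xs \<subseteq> \<Sigma> \<union> ?B" and n: "Neg (Conj xs) \<in> L"
    define as where "as = filter (\<lambda>\<phi>. \<phi> \<in> \<Sigma>) xs"
    define bs where "bs = filter (\<lambda>\<phi>. \<phi> \<in> ?B) xs"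
    have F: "set as \<subseteq> Fm X" "set bs \<subseteq> Fm X" using \<Sigma> by (auto simp: as_def bs_def)
    have "Imp (Conj bs) (Neg (Conj as)) \<in> L"
      by (rule taut_mp[OF n]) (use xs in \<open>auto simp: tautology_def as_def bs_def\<close>)
    then have "Imp (Box (Conj bs)) (Box (Neg (Conj as))) \<in> L" by (rule box_mono)
    moreover have "Box (Conj bs) \<in> y" by (rule box_Conj[OF y F(2)]) (auto simp: bs_def)
    ultimately have "Box (Neg (Conj as)) \<in> y" using mcs_Imp[OF y] F by auto
    moreover have "Dia (Conj as) \<in> y" by (rule sat) (auto simp: as_def)
    ultimately show False using dual_mem[OF y, of "Conj as"] F by auto
  qed
  then obtain z where z: "mcs X z" "\<Sigma> \<union> ?B \<subseteq> z" using lindenbaum[of "\<Sigma> \<union> ?B" X] \<Sigma> by auto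
  then have "crel y z" using crelI_box[OF y z(1)] by blast
  then show ?thesis using z by blast
qed

lemma dia_mono: 
  assumes "mcs X y" "Dia \<phi> \<in> y" "Imp \<phi> \<psi> \<in> L" "\<psi> \<in> Fm X"
  shows "Dia \<psi> \<in> y"
proof -
  have F: "\<phi> \<in> Fm X" using mcs_Fm[OF assms(1,2)] by simp
  have "Imp (Neg \<psi>) (Neg \<phi>) \<in> L"
    by (rule taut_mp[OF assms(3)]) (auto simp: tautology_def)
  then have "Imp (Box (Neg \<psi>)) (Box (Neg \<phi>)) \<in> L" by (rule box_mono)
  then show ?thesis using assms F dual_mem mcs_Imp[OF assms(1)]
    by (metis Fm_simps(4) Fm_simps(6))
qed

lemma crel_exists:
  assumes y: "mcs X y" and "Dia \<phi> \<in> y"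
  shows "\<exists>z. mcs X z \<and> crel y z \<and> \<phi> \<in> z"
proof -
  have F: "\<phi> \<in> Fm X" using mcs_Fm[OF assms] by simp
  have "\<exists>z. mcs X z \<and> crel y z \<and> {\<phi>} \<subseteq> z"
  proof (rule crel_sat[OF y])
    fix xs assume xs: "set xs \<subseteq> {\<phi>}"
    have "tautology (Imp \<phi> (Conj xs))" using xs by (force simp: tautology_def)
    then show "Dia (Conj xs) \<in> y"
      by (rule dia_mono[OF y assms(2) taut]) (use F xs in auto)
  qed (use F in auto)
  then show ?thesis by blast
qed

lemma dia_dia:
  assumes y: "mcs X y" and "Dia (Dia \<phi>) \<in> y"
  shows "Dia \<phi> \<in> y"
proof (rule ccontr)
  assume n: "Dia \<phi> \<notin> y"
  have F: "\<phi> \<in> Fm X" using mcs_Fm[OF assms] by simp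
  have "Box (Neg \<phi>) \<in> y" using dual_mem[OF y F] n by blast
  then have b: "Box (Box (Neg \<phi>)) \<in> y" using mcs_Imp[OF y four] F by auto
  obtain z where z: "mcs X z" "crel y z" "Dia \<phi> \<in> z" using crel_exists[OF assms] by blast
  have "Box (Neg \<phi>) \<in> z" by (rule crel_box[OF y z(1,2) _ b]) (use F in auto)
  then show False using dual_mem[OF z(1) F] z by blast
qed

lemma crel_trans: "mcs X y \<Longrightarrow> crel y z \<Longrightarrow> crel z u \<Longrightarrow> crel y u"
  unfolding crel_def using dia_dia by blast

lemma crel_linear:
  assumes "mcs X x" "mcs X y" "mcs X z" "crel x y" "crel x z"
  shows "y = z \<or> crel y z \<or> crel z y"
proof (rule ccontr)
  assume "\<not> ?thesis"
  then have n: "y \<noteq> z" "\<not> crel y z" "\<not> crel z y" by auto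
  from n(2) obtain \<chi> where \<chi>: "\<chi> \<in> z" "Dia \<chi> \<notin> y" by (auto simp: crel_def)
  from n(3) obtain \<psi> where \<psi>: "\<psi> \<in> y" "Dia \<psi> \<notin> z" by (auto simp: crel_def)
  obtain \<theta> where \<theta>: "\<theta> \<in> y" "\<theta> \<notin> z" using n(1) mcs_subset_eq assms by blast
  have F: "\<chi> \<in> Fm X" "\<psi> \<in> Fm X" "\<theta> \<in> Fm X" using \<chi> \<psi> \<theta> mcs_Fm assms by blast+
  \<comment> \<open>An instance of the linearity axiom that fails: \<open>?p\<close> says that
    \<chi> implies \<theta>, \<open>?q\<close> excludes \<psi> together with \<theta>. At
    \<open>y\<close> no successor satisfies \<chi>, so \<open>Boxp ?p\<close> is true and
    \<open>?q\<close> is false; at \<open>z\<close> the roles are exchanged.\<close>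
  let ?p = "Neg (And \<chi> (Neg \<theta>))" and ?q = "Neg (And \<psi> \<theta>)"
  have box: "Box \<beta> \<in> w" if "mcs X w" "\<alpha> \<in> Fm X" "\<beta> \<in> Fm X" "Dia \<alpha> \<notin> w" "Imp (Neg \<alpha>) \<beta> \<in> L" for w \<alpha> \<beta>
    using dual_mem[OF that(1,2)] that(4) box_mono[OF that(5)] mcs_Imp[OF that(1)] that(3)
    by (metis Fm_simps(4,6))
  have "Box ?p \<in> y"
    by (rule box[OF _ F(1) _ \<chi>(2)]) (use F assms in \<open>auto intro!: taut simp: tautology_def\<close>)
  moreover have "Box ?q \<in> z"
    by (rule box[OF _ F(2) _ \<psi>(2)]) (use F assms in \<open>auto intro!: taut simp: tautology_def\<close>)
  ultimately have 1: "Imp (Boxp ?p) ?q \<notin> y" "Imp (Boxp ?q) ?p \<notin> z"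
    using F \<chi> \<psi> \<theta> assms(2,3) by (auto simp: mcs_simps)
  have "Or (Box (Imp (Boxp ?p) ?q)) (Box (Imp (Boxp ?q) ?p)) \<in> x"
    by (rule mcs_L[OF assms(1) _ three]) (use F in auto)
  then have "Box (Imp (Boxp ?p) ?q) \<in> x \<or> Box (Imp (Boxp ?q) ?p) \<in> x"
    using F assms(1) mcs_Neg[OF assms(1)] mcs_And[OF assms(1)] by auto
  moreover have F': "Imp (Boxp ?p) ?q \<in> Fm X" "Imp (Boxp ?q) ?p \<in> Fm X" using F by auto
  ultimately show False
    using 1 crel_box[OF assms(1,2,4) F'(1)] crel_box[OF assms(1,3,5) F'(2)] by metis
qed

lemma crel_Dia: "mcs X y \<Longrightarrow> Dia \<phi> \<in> y \<longleftrightarrow> (\<exists>z. mcs X z \<and> crel y z \<and> \<phi> \<in> z)"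
  using crel_exists by (auto simp: crel_def)

text \<open>Points of one cluster see the same points, hence agree on formulas starting with
  \<open>Dia\<close>, and only variables can separate them. This is the source of the bound on the
  size of clusters.\<close>

lemma crel_cluster_eq:
  assumes "mcs X y" "mcs X z" "crel y z" "crel z y" "\<And>p. p \<in> X \<Longrightarrow> Var p \<in> y \<longleftrightarrow> Var p \<in> z"
  shows "y = z"
proof -
  have "\<phi> \<in> Fm X \<Longrightarrow> \<phi> \<in> y \<longleftrightarrow> \<phi> \<in> z" for \<phi>
  proof (induction \<phi>)
    case (Dia \<phi>)
    have "Dia \<phi> \<in> y \<Longrightarrow> Dia \<phi> \<in> z" "Dia \<phi> \<in> z \<Longrightarrow> Dia \<phi> \<in> y"
      unfolding crel_Dia[OF assms(1)] crel_Dia[OF assms(2)]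
      using assms(1-4) crel_trans by meson+
    then show ?case by blast
  qed (use assms in \<open>auto simp: mcs_simps\<close>)
  then show ?thesis using assms mcs_Fm by blast
qed

end

section \<open>Rooted canonical frames of linear logics\<close>

definition lt :: "fm set \<Rightarrow> fm set \<Rightarrow> bool" where
  "lt y z \<longleftrightarrow> crel y z \<and> \<not> crel z y"

definition adj :: "fm set set \<Rightarrow> fm set \<Rightarrow> fm set \<Rightarrow> bool" where
  "adj W y z \<longleftrightarrow> lt y z \<and> (\<forall>u\<in>W. \<not> (lt y u \<and> lt u z))"

fun deep :: "fm set set \<Rightarrow> nat \<Rightarrow> fm set \<Rightarrow> bool" where
  "deep W 0 v \<longleftrightarrow> \<not> crel v v"
| "deep W (Suc n) v \<longleftrightarrow> \<not> crel v v \<and> (\<exists>u\<in>W. adj W u v \<and> deep W n u)"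

text \<open>A point is \<open>dm\<close> (definably maximal) if some formula true at it fails at all points strictly after
  its cluster. All irreflexive points are, and only clusters of \<open>dm\<close> points can be used as images in a
  refutation of a canonical formula by a definable valuation. The other points are limits from the
  right: of \<open>dm\<close> clusters (\<open>limI\<close>) or of ends of long irreflexive chains (\<open>limD\<close>).\<close>

definition dm :: "fm set set \<Rightarrow> fm set \<Rightarrow> bool" where
  "dm W e \<longleftrightarrow> (\<exists>\<psi>\<in>e. \<forall>y\<in>W. crel e y \<and> \<psi> \<in> y \<longrightarrow> crel y e)"

definition limI :: "fm set set \<Rightarrow> fm set \<Rightarrow> bool" where
  "limI W e \<longleftrightarrow> (\<forall>z\<in>W. lt e z \<longrightarrow> (\<exists>y\<in>W. lt e y \<and> lt y z \<and> crel y y \<and> dm W y))"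

definition limD :: "fm set set \<Rightarrow> nat \<Rightarrow> fm set \<Rightarrow> bool" where
  "limD W n e \<longleftrightarrow> (\<forall>z\<in>W. lt e z \<longrightarrow> (\<exists>y\<in>W. lt e y \<and> lt y z \<and> deep W n y))"

lemma deep_irrefl: "deep W n v \<Longrightarrow> \<not> crel v v"
  by (cases n) auto

lemma deep_SucD: "deep W (Suc n) v \<Longrightarrow> deep W n v"
proof (induction n arbitrary: v)
  case (Suc n)
  then obtain u where "u \<in> W" "adj W u v" "deep W n u" "\<not> crel v v" by auto
  then show ?case using Suc.IH[of u] Suc.prems by auto
qed auto

lemma deep_antimono: "deep W n v \<Longrightarrow> m \<le> n \<Longrightarrow> deep W m v"
  by (induction n) (use deep_SucD le_Suc_eq in auto)

lemma lt_irrefl [simp]: "\<not> lt y y"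
  by (auto simp: lt_def)

locale canon = k43_logic +
  fixes X :: "nat set" and x :: "fm set"
  assumes root: "mcs X x" and finite_sig: "finite X"
begin

definition W :: "fm set set" where
  "W = {y. mcs X y \<and> (y = x \<or> crel x y)}"

lemma W_mcs: "y \<in> W \<Longrightarrow> mcs X y"
  by (auto simp: W_def)

lemma x_in_W [simp]: "x \<in> W"
  using root by (auto simp: W_def)

lemma W_up: "y \<in> W \<Longrightarrow> mcs X z \<Longrightarrow> crel y z \<Longrightarrow> z \<in> W"
  using crel_trans root by (auto simp: W_def)

lemma W_root: "y \<in> W \<Longrightarrow> y = x \<or> crel x y"
  by (auto simp: W_def)

lemma W_Dia: "y \<in> W \<Longrightarrow> Dia \<phi> \<in> y \<longleftrightarrow> (\<exists>z\<in>W. crel y z \<and> \<phi> \<in> z)"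
  using crel_Dia[OF W_mcs] W_up W_mcs by blast

lemma W_trans: "y \<in> W \<Longrightarrow> crel y z \<Longrightarrow> crel z u \<Longrightarrow> crel y u"
  using crel_trans W_mcs by blast

lemma W_linear: "y \<in> W \<Longrightarrow> z \<in> W \<Longrightarrow> y = z \<or> crel y z \<or> crel z y"
  using crel_linear[OF root] by (auto simp: W_def)

lemma lt_trans: "y \<in> W \<Longrightarrow> z \<in> W \<Longrightarrow> u \<in> W \<Longrightarrow> lt y z \<Longrightarrow> lt z u \<Longrightarrow> lt y u"
  unfolding lt_def using W_trans by blast

lemma lt_crel_trans: "y \<in> W \<Longrightarrow> z \<in> W \<Longrightarrow> u \<in> W \<Longrightarrow> lt y z \<Longrightarrow> crel z u \<Longrightarrow> lt y u"
  unfolding lt_def using W_trans by blast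

lemma crel_lt_trans: "y \<in> W \<Longrightarrow> z \<in> W \<Longrightarrow> u \<in> W \<Longrightarrow> crel y z \<Longrightarrow> lt z u \<Longrightarrow> lt y u"
  unfolding lt_def using W_trans by blast

lemma W_cases: "y \<in> W \<Longrightarrow> z \<in> W \<Longrightarrow> y = z \<or> crel y z \<and> crel z y \<or> lt y z \<or> lt z y"
  using W_linear unfolding lt_def by blast

lemma not_lt_root: "y \<in> W \<Longrightarrow> \<not> lt y x"
  using W_root by (auto simp: lt_def)

text \<open>If every finite part of \<Gamma> occurs at a successor of \<open>x\<close>, then
  \<open>crel_sat\<close> applies at \<open>x\<close>. Otherwise some finite \<open>F\<close> occurs
  at \<open>x\<close> only, and adding any further formula of \<Gamma> to \<open>F\<close> forces
  that formula into \<open>x\<close>.\<close>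

lemma compact:
  assumes sat: "\<And>F. finite F \<Longrightarrow> F \<subseteq> \<Gamma> \<Longrightarrow> \<exists>y\<in>W. F \<subseteq> y"
  shows "\<exists>z\<in>W. \<Gamma> \<subseteq> z"
proof -
  have \<Gamma>: "\<Gamma> \<subseteq> Fm X"
  proof
    fix \<phi> assume "\<phi> \<in> \<Gamma>"
    then show "\<phi> \<in> Fm X" using sat[of "{\<phi>}"] mcs_Fm W_mcs by fastforce
  qed
  show ?thesis
  proof (cases "\<forall>F. finite F \<and> F \<subseteq> \<Gamma> \<longrightarrow> (\<exists>y. mcs X y \<and> crel x y \<and> F \<subseteq> y)")
    case True
    have "\<exists>z. mcs X z \<and> crel x z \<and> \<Gamma> \<subseteq> z"
    proof (rule crel_sat[OF root \<Gamma>])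
      fix xs assume "set xs \<subseteq> \<Gamma>"
      then obtain y where "mcs X y" "crel x y" "set xs \<subseteq> y" using True finite_set by meson
      then show "Dia (Conj xs) \<in> x"
        using mcs_Conj[of X y xs] \<open>set xs \<subseteq> \<Gamma>\<close> \<Gamma> by (auto simp: crel_def)
    qed
    then show ?thesis by (auto simp: W_def)
  next
    case False
    then obtain F where F: "finite F" "F \<subseteq> \<Gamma>" "\<And>y. mcs X y \<Longrightarrow> crel x y \<Longrightarrow> \<not> F \<subseteq> y" by blast
    have "\<Gamma> \<subseteq> x"
    proof
      fix \<phi> assume "\<phi> \<in> \<Gamma>"
      then obtain y where "y \<in> W" "insert \<phi> F \<subseteq> y" using sat[of "insert \<phi> F"] F by auto
      then show "\<phi> \<in> x" using F by (auto simp: W_def)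
    qed
    then show ?thesis by auto
  qed
qed

section \<open>Last and first points of closed sets\<close>

lemma finite_last:
  "finite A \<Longrightarrow> A \<noteq> {} \<Longrightarrow> A \<subseteq> W \<Longrightarrow> \<exists>m\<in>A. \<forall>y\<in>A. y = m \<or> crel y m"
proof (induction A rule: finite_ne_induct)
  case (insert a A)
  then obtain m where m: "m \<in> A" "\<forall>y\<in>A. y = m \<or> crel y m" by auto
  show ?case
  proof (cases "m = a \<or> crel a m")
    case True
    then show ?thesis using m by auto
  next
    case False
    then have "crel m a" using W_linear[of m a] m insert.prems by auto
    then have "\<forall>y\<in>A. crel y a" using m insert.prems W_trans by (metis insert_subset subsetD)
    then show ?thesis by auto
  qed
qed auto

lemma finite_first:
  "finite A \<Longrightarrow> A \<noteq> {} \<Longrightarrow> A \<subseteq> W \<Longrightarrow> \<exists>m\<in>A. \<forall>y\<in>A. y = m \<or> crel m y"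
proof (induction A rule: finite_ne_induct)
  case (insert a A)
  then obtain m where m: "m \<in> A" "\<forall>y\<in>A. y = m \<or> crel m y" by auto
  show ?case
  proof (cases "m = a \<or> crel m a")
    case True
    then show ?thesis using m by auto
  next
    case False
    then have "crel a m" using W_linear[of m a] m insert.prems by auto
    then have "\<forall>y\<in>A. crel a y" using m insert.prems W_trans by (metis insert_subset)
    then show ?thesis by auto
  qed
qed auto

text \<open>Either the boxes occurring at the points containing \<open>\<Sigma>\<close> are jointly realised at such a point, which
  is then maximal, or finitely many of these points are so only because the last one has no
  successor containing \<open>\<Sigma>\<close>.\<close>

lemma ex_max:
  assumes "y0 \<in> W" "\<Sigma> \<subseteq> y0"
  shows "\<exists>y\<in>W. \<Sigma> \<subseteq> y \<and> (\<forall>z\<in>W. crel y z \<longrightarrow> \<Sigma> \<subseteq> z \<longrightarrow> crel z y)"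
proof -
  define U where "U = {y \<in> W. \<Sigma> \<subseteq> y}"
  define B where "B = {\<chi> \<in> Fm X. \<exists>y\<in>U. Box \<chi> \<in> y}"
  show ?thesis
  proof (cases "\<forall>F. finite F \<and> F \<subseteq> \<Sigma> \<union> B \<longrightarrow> (\<exists>y\<in>W. F \<subseteq> y)")
    case True
    have "\<exists>z\<in>W. \<Sigma> \<union> B \<subseteq> z" by (rule compact) (rule True[rule_format], intro conjI)
    then obtain z where z: "z \<in> W" "\<Sigma> \<union> B \<subseteq> z" by (elim bexE)
    have "crel u z" if u: "u \<in> W" "\<Sigma> \<subseteq> u" for u
      unfolding crel_def
    proof (intro ballI, rule ccontr)
      fix \<chi> assume \<chi>: "\<chi> \<in> z" "Dia \<chi> \<notin> u"
      then have F: "\<chi> \<in> Fm X" using mcs_Fm W_mcs z by blast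
      then have "Box (Neg \<chi>) \<in> u" using dual_mem[OF W_mcs[OF u(1)]] \<chi> by blast
      then have "Neg \<chi> \<in> B" using u F by (auto simp: B_def U_def)
      then have "Neg \<chi> \<in> z" using z(2) by blast
      then show False using \<chi> mcs_Neg[OF W_mcs[OF z(1)] F] by blast
    qed
    then show ?thesis using z by blast
  next
    case False
    then obtain F where "\<not> (finite F \<and> F \<subseteq> \<Sigma> \<union> B \<longrightarrow> (\<exists>y\<in>W. F \<subseteq> y))"
      unfolding not_all by (elim exE)
    then have F: "finite F" "F \<subseteq> \<Sigma> \<union> B" and nF: "\<And>y. y \<in> W \<Longrightarrow> \<not> F \<subseteq> y"
      by simp_all
    have "\<forall>\<chi>\<in>F - \<Sigma>. \<exists>y. y \<in> U \<and> Box \<chi> \<in> y" using F(2) unfolding B_def by auto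
    from bchoice[OF this] obtain f
      where f: "\<And>\<chi>. \<chi> \<in> F - \<Sigma> \<Longrightarrow> f \<chi> \<in> U \<and> Box \<chi> \<in> f \<chi>" by blast
    have "F - \<Sigma> \<noteq> {}" using nF[OF assms(1)] assms(2) by blast
    moreover have "f ` (F - \<Sigma>) \<subseteq> W" using f unfolding U_def by blast
    ultimately have "\<exists>m\<in>f ` (F - \<Sigma>). \<forall>y\<in>f ` (F - \<Sigma>). y = m \<or> crel y m"
      by (intro finite_last) (use F(1) in simp_all)
    then obtain m where m: "m \<in> f ` (F - \<Sigma>)" "\<And>\<chi>. \<chi> \<in> F - \<Sigma> \<Longrightarrow> f \<chi> = m \<or> crel (f \<chi>) m"
      by (elim bexE) simp
    then have mU: "m \<in> W" "\<Sigma> \<subseteq> m" using f unfolding U_def by auto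
    have "\<not> \<Sigma> \<subseteq> u" if u: "u \<in> W" "crel m u" for u
    proof
      assume \<Sigma>: "\<Sigma> \<subseteq> u"
      have "F \<subseteq> u"
      proof
        fix \<chi> assume "\<chi> \<in> F"
        show "\<chi> \<in> u"
        proof (cases "\<chi> \<in> \<Sigma>")
          case False
          then have *: "\<chi> \<in> F - \<Sigma>" "\<chi> \<in> Fm X" using \<open>\<chi> \<in> F\<close> F unfolding B_def by auto
          then have "f \<chi> \<in> W" using f unfolding U_def by blast
          then have "crel (f \<chi>) u" using m(2)[OF *(1)] u W_trans by blast
          then show ?thesis using crel_box[OF W_mcs W_mcs, of "f \<chi>" u \<chi>] u f[OF *(1)] * by (simp add: U_def)
        qed (use \<Sigma> in auto)
      qed
      then show False using nF u by blast
    qed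
    then show ?thesis using mU by blast
  qed
qed

text \<open>The search for last points reversed: a point sees all points containing \<Sigma> iff it
  contains \<open>B\<close>. If \<Sigma> and \<open>B\<close> are jointly realised, this gives a
  first point. Otherwise a finite part of their union occurs nowhere, and the first of the finitely
  many witnesses for its members in \<open>B\<close> is minimal, as an earlier point containing
  \<Sigma> would contain that part.\<close>

lemma ex_min:
  assumes "y0 \<in> W" "\<Sigma> \<subseteq> y0"
  shows "\<exists>y\<in>W. \<Sigma> \<subseteq> y \<and> (\<forall>z\<in>W. crel z y \<longrightarrow> \<Sigma> \<subseteq> z \<longrightarrow> crel y z)"
proof -
  define U where "U = {y \<in> W. \<Sigma> \<subseteq> y}"
  define B where "B = {Dia \<psi> | \<psi>. \<exists>y\<in>U. \<psi> \<in> y}"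
  show ?thesis
  proof (cases "\<forall>F. finite F \<and> F \<subseteq> \<Sigma> \<union> B \<longrightarrow> (\<exists>y\<in>W. F \<subseteq> y)")
    case True
    have "\<exists>z\<in>W. \<Sigma> \<union> B \<subseteq> z" by (rule compact) (rule True[rule_format], intro conjI)
    then obtain z where z: "z \<in> W" "\<Sigma> \<union> B \<subseteq> z" by (elim bexE)
    have "crel z u" if u: "u \<in> W" "\<Sigma> \<subseteq> u" for u
      unfolding crel_def using u z unfolding B_def U_def by blast
    then show ?thesis using z by blast
  next
    case False
    then obtain F where "\<not> (finite F \<and> F \<subseteq> \<Sigma> \<union> B \<longrightarrow> (\<exists>y\<in>W. F \<subseteq> y))"
      unfolding not_all by (elim exE)
    then have F: "finite F" "F \<subseteq> \<Sigma> \<union> B" and nF: "\<And>y. y \<in> W \<Longrightarrow> \<not> F \<subseteq> y"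
      by simp_all
    have "\<forall>\<chi>\<in>F - \<Sigma>. \<exists>y. y \<in> U \<and> (\<exists>\<psi>\<in>y. \<chi> = Dia \<psi>)" using F(2) unfolding B_def by blast
    from bchoice[OF this] obtain f
      where f: "\<And>\<chi>. \<chi> \<in> F - \<Sigma> \<Longrightarrow> f \<chi> \<in> U \<and> (\<exists>\<psi>\<in>f \<chi>. \<chi> = Dia \<psi>)" by blast
    have "F - \<Sigma> \<noteq> {}" using nF[OF assms(1)] assms(2) by blast
    moreover have "f ` (F - \<Sigma>) \<subseteq> W" using f unfolding U_def by blast
    ultimately have "\<exists>m\<in>f ` (F - \<Sigma>). \<forall>y\<in>f ` (F - \<Sigma>). y = m \<or> crel m y"
      by (intro finite_first) (use F(1) in simp_all)
    then obtain m where m: "m \<in> f ` (F - \<Sigma>)" "\<And>\<chi>. \<chi> \<in> F - \<Sigma> \<Longrightarrow> f \<chi> = m \<or> crel m (f \<chi>)"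
      by (elim bexE) simp
    then have mU: "m \<in> W" "\<Sigma> \<subseteq> m" using f unfolding U_def by auto
    have "\<not> \<Sigma> \<subseteq> u" if u: "u \<in> W" "crel u m" for u
    proof
      assume \<Sigma>: "\<Sigma> \<subseteq> u"
      have "F \<subseteq> u"
      proof
        fix \<chi> assume "\<chi> \<in> F"
        show "\<chi> \<in> u"
        proof (cases "\<chi> \<in> \<Sigma>")
          case False
          then have *: "\<chi> \<in> F - \<Sigma>" using \<open>\<chi> \<in> F\<close> by auto
          then have "crel u (f \<chi>)" using m(2)[OF *] u W_trans by metis
          then show ?thesis using f[OF *] by (auto simp: crel_def)
        qed (use \<Sigma> in auto)
      qed
      then show False using nF u by blast
    qed
    then show ?thesis using mU by blast
  qed
qed

text \<open>Some \<psi> true at the irreflexive \<open>v\<close> is false at all its successors. The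
  conjunction of \<psi> and \<open>Neg (Dia \<psi>)\<close> then fails after \<open>v\<close> in its
  first part and before \<open>v\<close> in its second.\<close>

lemma irr_fm:
  assumes "v \<in> W" "\<not> crel v v"
  obtains \<epsilon> where "\<epsilon> \<in> Fm X" "\<And>y. y \<in> W \<Longrightarrow> \<epsilon> \<in> y \<longleftrightarrow> y = v"
proof -
  obtain \<psi> where \<psi>: "\<psi> \<in> v" "Dia \<psi> \<notin> v" using assms by (auto simp: crel_def)
  have F: "\<psi> \<in> Fm X" using \<psi> assms mcs_Fm W_mcs by blast
  have mem: "And \<psi> (Neg (Dia \<psi>)) \<in> y \<longleftrightarrow> \<psi> \<in> y \<and> Dia \<psi> \<notin> y" if "y \<in> W" for y
    using F W_mcs[OF that] by (simp add: mcs_simps)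
  have "And \<psi> (Neg (Dia \<psi>)) \<in> y \<longleftrightarrow> y = v" if "y \<in> W" for y
    using mem[OF that] \<psi> W_linear[OF that assms(1)] by (auto simp: crel_def)
  then show thesis using that[of "And \<psi> (Neg (Dia \<psi>))"] F by auto
qed

lemma irr_dm:
  assumes "v \<in> W" "\<not> crel v v"
  shows "dm W v"
  by (rule irr_fm[OF assms]) (use assms in \<open>auto simp: dm_def\<close>)

text \<open>If \<psi> witnesses \<open>dm W e\<close> and \<open>e\<close> is reflexive,
  \<open>Dia \<psi>\<close> is true exactly up to the cluster of \<open>e\<close>; an irreflexive
  \<open>e\<close> has a characteristic formula. Definability of these initial parts is what makes
  \<open>dm\<close> points usable in valuations by formulas.\<close>

lemma le_fm:
  assumes "e \<in> W" "dm W e"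
  obtains \<mu> where "\<mu> \<in> Fm X" "\<And>y. y \<in> W \<Longrightarrow> \<mu> \<in> y \<longleftrightarrow> y = e \<or> crel y e"
proof (cases "crel e e")
  case True
  obtain \<psi> where \<psi>: "\<psi> \<in> e" "\<And>y. y \<in> W \<Longrightarrow> crel e y \<Longrightarrow> \<psi> \<in> y \<Longrightarrow> crel y e"
    using assms by (auto simp: dm_def)
  have "Dia \<psi> \<in> y \<longleftrightarrow> y = e \<or> crel y e" if y: "y \<in> W" for y
  proof
    assume "Dia \<psi> \<in> y"
    then obtain z where z: "z \<in> W" "crel y z" "\<psi> \<in> z" using W_Dia y by blast
    then show "y = e \<or> crel y e" using W_linear[OF z(1) assms(1)] \<psi>(2)[OF z(1)] W_trans[OF y z(2)] by blast
  qed (use True \<psi> in \<open>auto simp: crel_def\<close>)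
  moreover have "Dia \<psi> \<in> Fm X" using \<psi>(1) assms mcs_Fm W_mcs by fastforce
  ultimately show thesis using that by blast
next
  case False
  then obtain \<epsilon> where \<epsilon>: "\<epsilon> \<in> Fm X" "\<And>y. y \<in> W \<Longrightarrow> \<epsilon> \<in> y \<longleftrightarrow> y = e"
    using irr_fm assms by metis
  have "Or \<epsilon> (Dia \<epsilon>) \<in> y \<longleftrightarrow> y = e \<or> crel y e" if y: "y \<in> W" for y
    using \<epsilon>(1) W_mcs[OF y] W_Dia[OF y, of \<epsilon>] \<epsilon>(2) y assms(1) by (auto simp: mcs_simps)
  then show thesis using that[of "Or \<epsilon> (Dia \<epsilon>)"] \<epsilon>(1) by auto
qed

lemma dm_cluster:
  assumes "e \<in> W" "e' \<in> W" "crel e e'" "crel e' e" "dm W e"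
  shows "dm W e'"
proof -
  obtain \<mu> where \<mu>: "\<mu> \<in> Fm X" "\<And>y. y \<in> W \<Longrightarrow> \<mu> \<in> y \<longleftrightarrow> y = e \<or> crel y e"
    using le_fm assms by metis
  then have "\<mu> \<in> e'" using assms by auto
  moreover have "crel y e'" if "y \<in> W" "\<mu> \<in> y" for y
    using \<mu> that assms W_trans by blast
  ultimately show ?thesis by (auto simp: dm_def)
qed

text \<open>The points that see \<open>v\<close> are those containing \<open>Dia \<psi>\<close> for
  all \<psi> in \<open>v\<close>, a condition to which \<open>ex_max\<close> applies; irreflexivity
  keeps the last of them strictly before \<open>v\<close>.\<close>

lemma ex_pred:
  assumes "v \<in> W" "\<not> crel v v" "v \<noteq> x"
  obtains u where "u \<in> W" "adj W u v"
proof -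
  let ?S = "Dia ` v"
  have iff: "?S \<subseteq> y \<longleftrightarrow> crel y v" for y by (auto simp: crel_def)
  have "crel x v" using assms W_root by blast
  then obtain u where u: "u \<in> W" "crel u v" "\<forall>z\<in>W. crel u z \<longrightarrow> crel z v \<longrightarrow> crel z u"
    using ex_max[of x ?S] unfolding iff by auto
  have "\<not> crel v u" using u(2) assms(1,2) W_trans by blast
  then have "adj W u v" using u by (auto simp: adj_def lt_def)
  then show thesis using that u by blast
qed

lemma adj_unique:
  assumes "u \<in> W" "w \<in> W" "adj W u y" "adj W w y" "\<not> crel u u"
  shows "u = w"
  using assms W_cases[of u w] W_trans[of u w u] unfolding adj_def by blast

text \<open>With \<epsilon> characterising \<open>v\<close>, the formula
  \<open>Dia \<epsilon>\<close> is true for the last time in the cluster of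
  \<open>u\<close>.\<close>

lemma adj_dm:
  assumes "u \<in> W" "v \<in> W" "\<not> crel v v" "adj W u v"
  shows "dm W u"
proof -
  obtain \<epsilon> where \<epsilon>: "\<epsilon> \<in> Fm X" "\<And>y. y \<in> W \<Longrightarrow> \<epsilon> \<in> y \<longleftrightarrow> y = v"
    using irr_fm assms by metis
  have uv: "crel u v" using assms by (auto simp: adj_def lt_def)
  then have "Dia \<epsilon> \<in> u" using W_Dia assms \<epsilon> by blast
  moreover have "crel y u" if "y \<in> W" "crel u y" "Dia \<epsilon> \<in> y" for y
  proof (rule ccontr)
    assume "\<not> crel y u"
    moreover have "crel y v" using that W_Dia \<epsilon> by auto
    moreover have "\<not> crel v y" using calculation assms W_trans by blast
    ultimately show False using assms that by (auto simp: adj_def lt_def)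
  qed
  ultimately show ?thesis by (auto simp: dm_def)
qed

lemma not_dm_refl: "e \<in> W \<Longrightarrow> \<not> dm W e \<Longrightarrow> crel e e"
  using irr_dm by blast

text \<open>Some \<psi> in \<open>e\<close> has \<open>Dia \<psi>\<close> false at \<open>z\<close>.
  As \<open>e\<close> is not \<open>dm\<close>, \<open>Dia \<psi>\<close> stays true somewhere
  strictly after \<open>e\<close>, and a last point where it is true lies strictly between
  \<open>e\<close> and \<open>z\<close>.\<close>

lemma dm_between:
  assumes e: "e \<in> W" "\<not> dm W e" and z: "z \<in> W" "lt e z"
  obtains y where "y \<in> W" "lt e y" "lt y z" "dm W y"
proof -
  obtain \<psi> where \<psi>: "\<psi> \<in> e" "Dia \<psi> \<notin> z" using z by (auto simp: lt_def crel_def)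
  have "Dia \<psi> \<in> e" using not_dm_refl[OF e] \<psi> by (auto simp: crel_def)
  then obtain y0 where y0: "y0 \<in> W" "crel e y0" "Dia \<psi> \<in> y0" "\<not> crel y0 e"
    using e(2) by (auto simp: dm_def)
  obtain y where y: "y \<in> W" "Dia \<psi> \<in> y" "\<forall>u\<in>W. crel y u \<longrightarrow> Dia \<psi> \<in> u \<longrightarrow> crel u y"
    using ex_max[of y0 "{Dia \<psi>}"] y0 by auto
  have "y0 = y \<or> crel y0 y" using W_linear[OF y0(1) y(1)] y y0 by blast
  then have "lt e y" using y0 y(1) e(1) W_trans unfolding lt_def by blast
  moreover have "\<not> crel z y" 
    using \<psi>(2) y(2) dia_dia[OF W_mcs[OF z(1)]] by (auto simp: crel_def)
  then have "lt y z" using W_linear[OF z(1) y(1)] \<psi>(2) y(2) by (auto simp: lt_def)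
  moreover have "dm W y" using y by (auto simp: dm_def)
  ultimately show thesis using that y by blast
qed

text \<open>If reflexive \<open>dm\<close> points do not accumulate at \<open>e\<close>, then in
  some interval after \<open>e\<close> all \<open>dm\<close> points are irreflexive. An irreflexive
  point there has an immediate predecessor, which is \<open>dm\<close> by \<open>adj_dm\<close>,
  hence outside the cluster of \<open>e\<close>, hence again in the interval and irreflexive. So
  such points are deep of every degree, and \<open>dm_between\<close> finds them arbitrarily close
  to \<open>e\<close>.\<close>

lemma lim_cases:
  assumes e: "e \<in> W" "\<not> dm W e"
  shows "limI W e \<or> limD W n e"
proof (cases "limI W e")
  case False
  then obtain z0 where z0: "z0 \<in> W" "lt e z0"
    and irr: "\<And>y. y \<in> W \<Longrightarrow> lt e y \<Longrightarrow> lt y z0 \<Longrightarrow> dm W y \<Longrightarrow> \<not> crel y y" by (auto simp: limI_def)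
  have dp: "deep W n y" if "y \<in> W" "lt e y" "lt y z0" "\<not> crel y y" for y n
    using that
  proof (induction n arbitrary: y)
    case (Suc n)
    have "y \<noteq> x" using Suc.prems not_lt_root e by blast
    then obtain w where w: "w \<in> W" "adj W w y" using ex_pred Suc.prems by metis
    have d: "dm W w" using adj_dm w Suc.prems by blast
    have "\<not> lt w e" using w Suc.prems e by (auto simp: adj_def)
    then have "lt e w" using W_cases[OF e(1) w(1)] e d dm_cluster[OF w(1) e(1)] by auto
    moreover have "lt w z0" using w Suc.prems lt_trans z0 unfolding adj_def by blast
    ultimately show ?case using Suc w irr d by auto
  qed auto
  have "limD W n e"
    unfolding limD_def
  proof (intro ballI impI)
    fix z assume z: "z \<in> W" "lt e z"
    obtain z1 where z1: "z1 \<in> W" "lt e z1" "z1 = z \<or> crel z1 z" "z1 = z0 \<or> crel z1 z0"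
      using W_linear[OF z(1) z0(1)] z z0 by blast
    obtain y where y: "y \<in> W" "lt e y" "lt y z1" "dm W y" using dm_between[OF e z1(1,2)] by blast
    have "lt y z" "lt y z0" using y z1 z z0 lt_crel_trans by blast+
    then show "\<exists>y\<in>W. lt e y \<and> lt y z \<and> deep W n y" using y irr dp by blast
  qed
  then show ?thesis by blast
qed auto

lemma root_not_deep: "\<not> deep W (Suc n) x"
  using not_lt_root by (auto simp: adj_def)

text \<open>Deep points are irreflexive and so have characteristic formulas; hence \<open>?S\<close>
  can say that a point sees \<open>v\<close> and is not deep, and \<open>ex_max\<close> gives the
  last such point \<open>u\<close>. If \<open>u\<close> is \<open>dm\<close>, a nonempty gap between
  \<open>u\<close> and \<open>v\<close> has a first point, whose immediate predecessor of depth
  \<open>n\<close> can only belong to the cluster of \<open>u\<close>; being irreflexive, it is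
  \<open>u\<close> itself.\<close>

lemma last_not_deep:
  assumes v: "v \<in> W" "v \<noteq> x" "\<not> crel v v"
  obtains u where "u \<in> W" "lt u v" "\<not> deep W (Suc n) u"
    "\<And>y. y \<in> W \<Longrightarrow> lt u y \<Longrightarrow> lt y v \<Longrightarrow> deep W (Suc n) y"
    "adj W u v \<or> crel u u \<and> \<not> dm W u \<or> deep W n u"
proof -
  let ?N = "{Neg \<epsilon> | \<epsilon>. \<epsilon> \<in> Fm X \<and> (\<exists>u\<in>W. deep W (Suc n) u \<and> (\<forall>y\<in>W. \<epsilon> \<in> y \<longleftrightarrow> y = u))}"
  let ?S = "Dia ` v \<union> ?N"
  have iff: "?S \<subseteq> y \<longleftrightarrow> crel y v \<and> \<not> deep W (Suc n) y" if y: "y \<in> W" for y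
  proof -
    have "?N \<subseteq> y \<longleftrightarrow> \<not> deep W (Suc n) y"
    proof
      assume N: "?N \<subseteq> y"
      show "\<not> deep W (Suc n) y"
      proof
        assume d: "deep W (Suc n) y"
        obtain \<epsilon> where \<epsilon>: "\<epsilon> \<in> Fm X" "\<And>z. z \<in> W \<Longrightarrow> \<epsilon> \<in> z \<longleftrightarrow> z = y"
          using irr_fm[OF y deep_irrefl[OF d]] by metis
        then have "Neg \<epsilon> \<in> y" using N d y by blast
        then show False using \<epsilon> y W_mcs mcs_Neg by blast
      qed
    next
      assume "\<not> deep W (Suc n) y"
      then show "?N \<subseteq> y" using y W_mcs mcs_Neg by fastforce
    qed
    then show ?thesis by (auto simp: crel_def)
  qed
  have "?S \<subseteq> x" unfolding iff[OF x_in_W] using v W_root root_not_deep by blast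
  from ex_max[OF x_in_W this]
  obtain u where u: "u \<in> W" "?S \<subseteq> u" "\<forall>z\<in>W. crel u z \<longrightarrow> ?S \<subseteq> z \<longrightarrow> crel z u" by (elim bexE conjE)
  have uv: "crel u v" "\<not> deep W (Suc n) u" using u iff by blast+
  have max: "crel z u" if "z \<in> W" "crel u z" "crel z v" "\<not> deep W (Suc n) z" for z
    using u(3) iff that by blast
  have ltu: "lt u v" using uv(1) v W_trans[OF v(1) _ uv(1)] by (auto simp: lt_def)
  have int: "deep W (Suc n) y" if "y \<in> W" "lt u y" "lt y v" for y
    using max[OF that(1)] that by (auto simp: lt_def)
  have "adj W u v \<or> crel u u \<and> \<not> dm W u \<or> deep W n u"
  proof (rule ccontr)
    assume n: "\<not> ?thesis"
    then obtain y0 where y0: "y0 \<in> W" "lt u y0" "lt y0 v" using ltu by (auto simp: adj_def)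
    show False
    proof (cases "crel u u")
      case False
      \<comment> \<open>The strict successors of an irreflexive \<open>u\<close> are described by
        its boxed formulas, those of a reflexive \<open>dm\<close> point by the negation of the
        formula for its initial part; either way \<open>ex_min\<close> yields the first point of the
        gap.\<close>
      let ?T = "{\<chi> \<in> Fm X. Box \<chi> \<in> u}"
      have T: "?T \<subseteq> y \<longleftrightarrow> crel u y" if "y \<in> W" for y
        using crelI_box[OF W_mcs[OF u(1)] W_mcs[OF that]] crel_box[OF W_mcs[OF u(1)] W_mcs[OF that]]
        by blast
      have "?T \<subseteq> y0" using T y0 by (simp add: lt_def)
      from ex_min[OF y0(1) this]
      obtain y where y: "y \<in> W" "?T \<subseteq> y" "\<forall>z\<in>W. crel z y \<longrightarrow> ?T \<subseteq> z \<longrightarrow> crel y z" by (elim bexE conjE)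
      have uy: "crel u y" using y T by blast
      have min: "crel y z" if "z \<in> W" "crel z y" "crel u z" for z using y(3) T that by blast
      have "lt u y" using uy False W_trans[OF u(1) uy] by (auto simp: lt_def)
      have "y0 = y \<or> crel y y0" using W_linear[OF y0(1) y(1)] min y0 unfolding lt_def by blast
      then have "lt y v" using y0 y v crel_lt_trans by blast
      then obtain w where w: "w \<in> W" "adj W w y" "deep W n w"
        using int[OF y(1) \<open>lt u y\<close>] by auto
      have "adj W u y" using \<open>lt u y\<close> min by (auto simp: adj_def lt_def)
      then have "u = w" using adj_unique u w False by blast
      then show False using w n by blast
    next
      case True
      then have "dm W u" using n by blast
      then obtain \<mu> where \<mu>: "\<mu> \<in> Fm X" "\<And>y. y \<in> W \<Longrightarrow> \<mu> \<in> y \<longleftrightarrow> y = u \<or> crel y u"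
        using le_fm[OF u(1)] by blast
      have T: "{Neg \<mu>} \<subseteq> y \<longleftrightarrow> lt u y" if "y \<in> W" for y
        using \<mu> that mcs_Neg[OF W_mcs[OF that]] W_linear[OF that u(1)] by (auto simp: lt_def)
      have "{Neg \<mu>} \<subseteq> y0" using T y0 by simp
      from ex_min[OF y0(1) this]
      obtain y where "y \<in> W" "{Neg \<mu>} \<subseteq> y" "\<forall>z\<in>W. crel z y \<longrightarrow> {Neg \<mu>} \<subseteq> z \<longrightarrow> crel y z" by (elim bexE conjE)
      then have y: "y \<in> W" "lt u y" "\<forall>z\<in>W. crel z y \<longrightarrow> lt u z \<longrightarrow> crel y z" using T by auto
      have "y0 = y \<or> crel y y0" using W_linear[OF y0(1) y(1)] y y0 by blast
      then have "lt y v" using y0 y v crel_lt_trans by blast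
      then obtain w where w: "w \<in> W" "adj W w y" "deep W n w"
        using int[OF y(1,2)] by auto
      then have "\<not> crel w w" using deep_irrefl by blast
      have "\<not> lt u w" using y(3) w by (auto simp: adj_def lt_def)
      moreover have "\<not> lt w u" using w u y by (auto simp: adj_def)
      ultimately show False using W_cases[OF u(1) w(1)] True \<open>\<not> crel w w\<close> W_trans[OF w(1)] by blast
    qed
  qed
  then show thesis using that u(1) ltu uv(2) int by blast
qed

section \<open>Propositional states and the size of clusters\<close>

definition state :: "fm set \<Rightarrow> fm" where
  "state y = Conj (map (\<lambda>p. if Var p \<in> y then Var p else Neg (Var p)) (sorted_list_of_set X))"

lemma state_Fm: "state y \<in> Fm X"
  using finite_sig by (auto simp: state_def)

lemma state_iff:
  assumes z: "z \<in> W"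
  shows "state y \<in> z \<longleftrightarrow> (\<forall>p\<in>X. Var p \<in> z \<longleftrightarrow> Var p \<in> y)"
proof -
  define l where "l = (\<lambda>p. if Var p \<in> y then Var p else Neg (Var p))"
  have "state y \<in> z \<longleftrightarrow> l ` X \<subseteq> z"
    unfolding state_def l_def[symmetric]
    by (subst mcs_Conj[OF W_mcs[OF z]]) (use finite_sig in \<open>auto simp: l_def split: if_splits\<close>)
  also have "\<dots> \<longleftrightarrow> (\<forall>p\<in>X. Var p \<in> z \<longleftrightarrow> Var p \<in> y)"
    using mcs_Neg[OF W_mcs[OF z]] by (auto simp: image_subset_iff l_def)
  finally show ?thesis .
qed

lemma cluster_eq:
  "y \<in> W \<Longrightarrow> z \<in> W \<Longrightarrow> crel y z \<Longrightarrow> crel z y \<Longrightarrow> (\<And>p. p \<in> X \<Longrightarrow> Var p \<in> y \<longleftrightarrow> Var p \<in> z) \<Longrightarrow> y = z"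
  using crel_cluster_eq W_mcs by blast

lemma cluster_card:
  assumes "A \<subseteq> W" "\<And>y z. y \<in> A \<Longrightarrow> z \<in> A \<Longrightarrow> y \<noteq> z \<Longrightarrow> crel y z"
  shows "finite A \<and> card A \<le> 2 ^ card X"
proof -
  have inj: "inj_on (\<lambda>y. {p \<in> X. Var p \<in> y}) A"
  proof (rule inj_onI, rule ccontr)
    fix y z assume yz: "y \<in> A" "z \<in> A" "{p \<in> X. Var p \<in> y} = {p \<in> X. Var p \<in> z}" "y \<noteq> z"
    then have "y = z" using cluster_eq[of y z] assms(1,2) by blast
    then show False using yz by blast
  qed
  have sub: "(\<lambda>y. {p \<in> X. Var p \<in> y}) ` A \<subseteq> Pow X" by auto
  have "finite A" using finite_imageD[OF _ inj] finite_subset[OF sub] finite_sig by simp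
  moreover have "card A \<le> card (Pow X)" using card_inj_on_le[OF inj sub] finite_sig by simp
  ultimately show ?thesis using finite_sig by (simp add: card_Pow)
qed

end

section \<open>Restriction to a smaller signature\<close>

text \<open>The gap below \<open>v\<close> left by the selection of \<open>T\<close> is invisible to canonical formulas with at most \<open>n\<close>
  points: it is empty, or it consists of irreflexive points with \<open>n\<close> successive irreflexive immediate
  predecessors, so that the image of a closed-domain chain can be shifted across it.\<close>

definition supported :: "fm set set \<Rightarrow> nat \<Rightarrow> fm set set \<Rightarrow> fm set \<Rightarrow> bool" where
  "supported W n T v \<longleftrightarrow> (\<exists>w\<in>T. lt w v \<and>
     (adj W w v \<or> (deep W n w \<or> \<not> dm W w) \<and> (\<forall>y\<in>W. lt w y \<longrightarrow> lt y v \<longrightarrow> deep W n y)))"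

locale proj = canon +
  fixes Y :: "nat set"
  assumes sub: "Y \<subseteq> X"
begin

definition pr :: "fm set \<Rightarrow> fm set" where
  "pr y = y \<inter> Fm Y"

sublocale F: canon L Y "pr x"
  using mcs_restrict[OF root sub] finite_subset[OF sub finite_sig]
  by unfold_locales (auto simp: pr_def)

lemma Fm_sub: "Fm Y \<subseteq> Fm X"
  using Fm_mono sub .

lemma pr_mem: "\<phi> \<in> Fm Y \<Longrightarrow> \<phi> \<in> pr y \<longleftrightarrow> \<phi> \<in> y"
  by (auto simp: pr_def)

lemma pr_mono: "crel y z \<Longrightarrow> crel (pr y) (pr z)"
  by (auto simp: crel_def pr_def)

lemma pr_W: "y \<in> W \<Longrightarrow> pr y \<in> F.W"
  using mcs_restrict[OF _ sub, of y, folded pr_def] pr_mono[of x y] by (auto simp: W_def F.W_def)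

lemma pr_eqI:
  assumes "y \<in> W" "s \<in> F.W" "s \<subseteq> y"
  shows "pr y = s"
proof -
  have "s \<subseteq> pr y" using mcs_Fm[OF F.W_mcs[OF assms(2)]] assms(3) by (auto simp: pr_def)
  then show ?thesis using mcs_subset_eq F.W_mcs assms pr_W by metis
qed

text \<open>Every finite conjunction from \<open>s\<close> is possible at \<open>pr y\<close>, hence
  at \<open>y\<close>, and \<open>crel_sat\<close> realises all of \<open>s\<close> at once.
  Together with \<open>pr_mono\<close> this makes projection a bounded morphism between the
  canonical frames.\<close>

lemma pr_back:
  assumes y: "y \<in> W" and s: "s \<in> F.W" and "crel (pr y) s"
  obtains z where "z \<in> W" "crel y z" "pr z = s"
proof -
  have sY: "s \<subseteq> Fm Y" using F.W_mcs[OF s] mcs_Fm by blast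
  have "\<exists>z. mcs X z \<and> crel y z \<and> s \<subseteq> z"
  proof (rule crel_sat[OF W_mcs[OF y]])
    show "s \<subseteq> Fm X" using sY Fm_sub by blast
    fix xs assume xs: "set xs \<subseteq> s"
    then have "Conj xs \<in> s" using mcs_Conj[OF F.W_mcs[OF s]] sY by blast
    then show "Dia (Conj xs) \<in> y" using assms(3) by (auto simp: crel_def pr_def)
  qed
  then obtain z where "z \<in> W" "crel y z" "s \<subseteq> z" using W_up y by blast
  then show thesis using that pr_eqI s by blast
qed

text \<open>A last preimage is chosen because it is seen from every point whose projection sees
  \<open>s\<close>; so \<open>lift\<close> embeds the frame over \<open>Y\<close> into the one over
  \<open>X\<close> (\<open>crel_lift\<close>).\<close>

definition lift :: "fm set \<Rightarrow> fm set" where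
  "lift s = (SOME y. y \<in> W \<and> pr y = s \<and> (\<forall>z\<in>W. crel y z \<longrightarrow> pr z = s \<longrightarrow> crel z y))"

lemma lift_ex:
  assumes s: "s \<in> F.W"
  shows "\<exists>y. y \<in> W \<and> pr y = s \<and> (\<forall>z\<in>W. crel y z \<longrightarrow> pr z = s \<longrightarrow> crel z y)"
proof -
  obtain y0 where "y0 \<in> W" "pr y0 = s"
  proof (cases "s = pr x")
    case False
    then show ?thesis using F.W_root[OF s] pr_back[OF x_in_W s] that by blast
  next
    case True
    then show ?thesis using that[of x] by simp
  qed
  then have "s \<subseteq> y0" by (auto simp: pr_def)
  from ex_max[OF \<open>y0 \<in> W\<close> this] obtain y
    where y: "y \<in> W" "s \<subseteq> y" "\<forall>z\<in>W. crel y z \<longrightarrow> s \<subseteq> z \<longrightarrow> crel z y" by (elim bexE conjE)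
  have "s \<subseteq> z" if "pr z = s" for z using that by (auto simp: pr_def)
  then have "\<forall>z\<in>W. crel y z \<longrightarrow> pr z = s \<longrightarrow> crel z y" using y(3) by blast
  then show ?thesis using y(1) pr_eqI[OF y(1) s y(2)] by (intro exI[of _ y]) simp
qed

lemma lift_W: "s \<in> F.W \<Longrightarrow> lift s \<in> W"
  and pr_lift: "s \<in> F.W \<Longrightarrow> pr (lift s) = s"
  and lift_max: "s \<in> F.W \<Longrightarrow> z \<in> W \<Longrightarrow> crel (lift s) z \<Longrightarrow> pr z = s \<Longrightarrow> crel z (lift s)"
  using someI_ex[OF lift_ex, of s] unfolding lift_def by blast+

section \<open>Order, definable maximality, depth and limits under lifting and projection\<close>

lemma crel_lift_iff:
  assumes y: "y \<in> W" and s: "s \<in> F.W"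
  shows "crel y (lift s) \<longleftrightarrow> crel (pr y) s"
proof
  assume "crel (pr y) s"
  then obtain z where z: "z \<in> W" "crel y z" "pr z = s" using pr_back y s by blast
  then have "z = lift s \<or> crel z (lift s)" using W_linear[OF z(1) lift_W[OF s]] lift_max[OF s] by blast
  then show "crel y (lift s)" using z W_trans y by blast
qed (use pr_mono pr_lift s in fastforce)

lemma crel_lift: "s \<in> F.W \<Longrightarrow> t \<in> F.W \<Longrightarrow> crel (lift s) (lift t) \<longleftrightarrow> crel s t"
  using crel_lift_iff lift_W pr_lift by simp

lemma lt_lift: "s \<in> F.W \<Longrightarrow> t \<in> F.W \<Longrightarrow> lt (lift s) (lift t) \<longleftrightarrow> lt s t"
  by (simp add: lt_def crel_lift)

text \<open>Two different preimages of one type are comparable, so the type would see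
  itself.\<close>

lemma irr_lift: "y \<in> W \<Longrightarrow> \<not> crel (pr y) (pr y) \<Longrightarrow> lift (pr y) = y"
  using W_linear[OF lift_W[OF pr_W], of y y] pr_mono pr_lift pr_W by metis

lemma lt_lift_right: "y \<in> W \<Longrightarrow> s \<in> F.W \<Longrightarrow> lt (pr y) s \<Longrightarrow> lt y (lift s)"
  unfolding lt_def using crel_lift_iff pr_mono[of "lift s" y] pr_lift by auto

lemma lt_lift_left: "y \<in> W \<Longrightarrow> s \<in> F.W \<Longrightarrow> lt (lift s) y \<longleftrightarrow> lt s (pr y)"
  using W_linear[OF lift_W, of s y] crel_lift_iff[of y s] pr_mono[of "lift s" y] pr_lift[of s]
  unfolding lt_def by metis

lemma lt_irr:
  assumes "y \<in> W" "s \<in> F.W" "\<not> crel s s" "lt y (lift s)"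
  shows "lt (pr y) s"
  using assms crel_lift_iff[of y s] F.W_trans[of s "pr y" s] unfolding lt_def by blast

lemma adj_up:
  assumes "s \<in> F.W" "t \<in> F.W" "\<not> crel t t" "adj F.W s t"
  shows "adj W (lift s) (lift t)"
  using assms lt_irr lt_lift_left pr_W lt_lift unfolding adj_def by blast

text \<open>Suppose \<open>lift s\<close> is \<open>dm\<close> although \<open>s\<close> is not.
  Each finite part of \<open>s\<close> is then true at some type strictly after \<open>s\<close>,
  whose lift lies strictly after \<open>lift s\<close>. By compactness all of \<open>s\<close> is
  realised strictly after \<open>lift s\<close>, against its choice as a last preimage.\<close>

lemma dm_lift:
  assumes s: "s \<in> F.W"
  shows "dm W (lift s) \<longleftrightarrow> dm F.W s"
proof
  assume "dm F.W s"
  then obtain \<chi> where \<chi>: "\<chi> \<in> s" "\<And>t. t \<in> F.W \<Longrightarrow> crel s t \<Longrightarrow> \<chi> \<in> t \<Longrightarrow> crel t s"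
    by (auto simp: dm_def)
  have Y: "\<chi> \<in> Fm Y" using \<chi>(1) F.W_mcs[OF s] mcs_Fm by blast
  have "\<chi> \<in> lift s" using pr_lift[OF s] \<chi> by (auto simp: pr_def)
  moreover have "crel z (lift s)" if z: "z \<in> W" "crel (lift s) z" "\<chi> \<in> z" for z
  proof -
    have "crel (pr z) s"
      using \<chi>(2)[OF pr_W[OF z(1)]] pr_mono[OF z(2)] pr_lift[OF s] pr_mem[OF Y] z(3) by simp
    then show ?thesis using crel_lift_iff z s by blast
  qed
  ultimately show "dm W (lift s)" by (auto simp: dm_def)
next
  assume d: "dm W (lift s)"
  show "dm F.W s"
  proof (rule ccontr)
    assume nd: "\<not> dm F.W s"
    then have ss: "crel s s" using F.not_dm_refl s by blast
    obtain \<mu> where \<mu>: "\<mu> \<in> Fm X" "\<And>y. y \<in> W \<Longrightarrow> \<mu> \<in> y \<longleftrightarrow> y = lift s \<or> crel y (lift s)"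
      using le_fm[OF lift_W[OF s] d] by blast
    have N: "Neg \<mu> \<in> y \<longleftrightarrow> lt (lift s) y" if "y \<in> W" for y
      using mcs_Neg[OF W_mcs[OF that] \<mu>(1)] \<mu>(2)[OF that] W_linear[OF that lift_W[OF s]]
      unfolding lt_def using ss crel_lift s by blast
    have "\<exists>z\<in>W. insert (Neg \<mu>) s \<subseteq> z"
    proof (rule compact)
      fix A assume A: "finite A" "A \<subseteq> insert (Neg \<mu>) s"
      then obtain xs where xs: "set xs = A \<inter> s" using finite_list[of "A \<inter> s"] by auto
      then have "Conj xs \<in> s" using mcs_Conj[OF F.W_mcs[OF s], of xs] mcs_Fm[OF F.W_mcs[OF s]] by auto
      then obtain t where t: "t \<in> F.W" "crel s t" "Conj xs \<in> t" "\<not> crel t s"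
        using nd by (auto simp: dm_def)
      have "lt (lift s) (lift t)" using t s lt_lift by (simp add: lt_def)
      then have "Neg \<mu> \<in> lift t" using N lift_W t by blast
      moreover have "A \<inter> s \<subseteq> t"
        using mcs_Conj[OF F.W_mcs[OF t(1)], of xs] mcs_Fm[OF F.W_mcs[OF s]] xs t(3) by auto
      then have "A \<inter> s \<subseteq> lift t" using pr_lift[OF t(1)] by (auto simp: pr_def)
      ultimately show "\<exists>y\<in>W. A \<subseteq> y" using A lift_W[OF t(1)] by blast
    qed
    then obtain z where z: "z \<in> W" "Neg \<mu> \<in> z" "s \<subseteq> z" by auto
    then have "lt (lift s) z" "pr z = s" using N pr_eqI s by auto
    then show False using lift_max[OF s z(1)] by (auto simp: lt_def)
  qed
qed

lemma deep_up: "s \<in> F.W \<Longrightarrow> deep F.W n s \<Longrightarrow> deep W n (lift s)"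
proof (induction n arbitrary: s)
  case 0
  then show ?case by (simp add: crel_lift)
next
  case (Suc n)
  then obtain t where "t \<in> F.W" "adj F.W t s" "deep F.W n t" "\<not> crel s s" by auto
  then have "adj W (lift t) (lift s)" "deep W n (lift t)" "\<not> crel (lift s) (lift s)" "lift t \<in> W"
    using Suc.IH Suc.prems(1) adj_up lift_W crel_lift by blast+
  then show ?case by auto
qed

text \<open>An immediate predecessor \<open>u\<close> in the chain cannot have a reflexive
  projection, since \<open>lift (pr u)\<close> would then lie strictly between \<open>u\<close> and
  \<open>y\<close>. So irreflexivity passes down the chain, and along it lifting undoes
  projection.\<close>

lemma deep_down:
  "y \<in> W \<Longrightarrow> \<not> crel (pr y) (pr y) \<Longrightarrow> deep W n y \<Longrightarrow> deep F.W n (pr y)"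
proof (induction n arbitrary: y)
  case (Suc n)
  then obtain u where u: "u \<in> W" "adj W u y" "deep W n u" by auto
  have y: "lift (pr y) = y" "pr y \<in> F.W" using Suc irr_lift pr_W by auto
  have lt: "lt (pr u) (pr y)" using lt_irr[OF u(1) y(2)] Suc.prems u y by (auto simp: adj_def)
  have irr: "\<not> crel (pr u) (pr u)"
  proof
    assume r: "crel (pr u) (pr u)"
    then have "crel u (lift (pr u))" "crel (lift (pr u)) (lift (pr u))"
      using crel_lift_iff u pr_W crel_lift by auto
    moreover have "\<not> crel (lift (pr u)) u"
      using deep_irrefl[OF u(3)] W_trans[OF u(1), of "lift (pr u)" u] calculation by blast
    moreover have "lt (lift (pr u)) y" using lt_lift[of "pr u" "pr y"] lt u y pr_W by auto
    ultimately show False using u lift_W pr_W by (auto simp: adj_def lt_def)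
  qed
  have "\<not> (lt (pr u) t \<and> lt t (pr y))" if "t \<in> F.W" for t
    using lt_lift[OF pr_W[OF u(1)] that] lt_lift[OF that y(2)] irr_lift[OF u(1) irr] y(1) u(2) lift_W[OF that]
    by (auto simp: adj_def)
  then have "adj F.W (pr u) (pr y)" using lt by (auto simp: adj_def)
  then show ?case using Suc u irr pr_W by auto
qed auto

lemma limD_up:
  assumes s: "s \<in> F.W" and "limD F.W n s"
  shows "limD W n (lift s)"
  unfolding limD_def
proof (intro ballI impI)
  fix z assume z: "z \<in> W" "lt (lift s) z"
  then have "lt s (pr z)" using lt_lift_left s by blast
  then obtain t where t: "t \<in> F.W" "lt s t" "lt t (pr z)" "deep F.W n t"
    using assms pr_W z by (auto simp: limD_def)
  then show "\<exists>y\<in>W. lt (lift s) y \<and> lt y z \<and> deep W n y"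
    using lt_lift lt_lift_left lift_W deep_up s z by blast
qed

lemma limI_up:
  assumes s: "s \<in> F.W" and "limI F.W s"
  shows "limI W (lift s)"
  unfolding limI_def
proof (intro ballI impI)
  fix z assume z: "z \<in> W" "lt (lift s) z"
  then have "lt s (pr z)" using lt_lift_left s by blast
  then obtain t where t: "t \<in> F.W" "lt s t" "lt t (pr z)" "crel t t" "dm F.W t"
    using assms pr_W z by (auto simp: limI_def)
  then show "\<exists>y\<in>W. lt (lift s) y \<and> lt y z \<and> crel y y \<and> dm W y"
    using lt_lift lt_lift_left lift_W dm_lift crel_lift s z by blast
qed

text \<open>Lifts of types strictly between \<open>pr e\<close> and \<open>pr v\<close> fall
  strictly between \<open>e\<close> and \<open>v\<close>, hence are deep, and
  \<open>deep_down\<close> returns the depth to the types; \<open>dm_between\<close> finds such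
  types arbitrarily close to \<open>pr e\<close>. Thus a kind chosen in the projection agrees with
  what a single model requires below an irreflexive point.\<close>

lemma limD_down:
  assumes e: "e \<in> W" "\<not> dm W e" "crel (lift (pr e)) e" and v: "v \<in> W" "lt e v"
    and int: "\<And>y. y \<in> W \<Longrightarrow> lt e y \<Longrightarrow> lt y v \<Longrightarrow> deep W n y"
  shows "limD F.W n (pr e)"
  unfolding limD_def
proof (intro ballI impI)
  fix z assume z: "z \<in> F.W" "lt (pr e) z"
  have l: "lift (pr e) \<in> W" "pr e \<in> F.W" using lift_W pr_W e by auto
  have el: "crel e (lift (pr e))" using lift_max[OF l(2) e(1) e(3)] by simp
  have nd: "\<not> dm F.W (pr e)" using dm_lift[OF l(2)] dm_cluster[OF l(1) e(1) e(3) el] e(2) by blast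
  have "lt (lift (pr e)) v" using crel_lt_trans l e v by blast
  then have "lt (pr e) (pr v)" using lt_lift_left l v by blast
  then obtain m where m: "m \<in> F.W" "lt (pr e) m" "m = z \<or> crel m z" "m = pr v \<or> crel m (pr v)"
    using F.W_linear[OF z(1) pr_W[OF v(1)]] z pr_W[OF v(1)] by blast
  obtain t where t: "t \<in> F.W" "lt (pr e) t" "lt t m" using F.dm_between[OF l(2) nd m(1,2)] by blast
  have tz: "lt t z" "lt t (pr v)" using t m z pr_W[OF v(1)] F.lt_crel_trans by blast+
  have "lt e (lift t)" using lt_lift_right e t by blast
  moreover have "lt (lift t) v" using lt_lift_left tz t v by blast
  ultimately have d: "deep W n (lift t)" using int lift_W t by blast
  then have "\<not> crel (pr (lift t)) (pr (lift t))" using deep_irrefl crel_lift pr_lift t by metis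
  then have "deep F.W n t" using deep_down[OF lift_W[OF t(1)] _ d] pr_lift t by simp
  then show "\<exists>y\<in>F.W. lt (pr e) y \<and> lt y z \<and> deep F.W n y" using t tz by blast
qed

lemma supported_up:
  assumes s: "s \<in> F.W" "\<not> crel s s" and Q: "Q \<subseteq> F.W" and sup: "supported F.W n Q s"
  shows "supported W n (lift ` Q) (lift s)"
proof -
  obtain t where t: "t \<in> Q" "lt t s"
    and c: "adj F.W t s \<or> (deep F.W n t \<or> \<not> dm F.W t) \<and> (\<forall>y\<in>F.W. lt t y \<longrightarrow> lt y s \<longrightarrow> deep F.W n y)"
    using sup by (auto simp: supported_def)
  have tF: "t \<in> F.W" using t Q by blast
  have int: "deep W n y" if y: "y \<in> W" "lt (lift t) y" "lt y (lift s)"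
    and d: "\<forall>y\<in>F.W. lt t y \<longrightarrow> lt y s \<longrightarrow> deep F.W n y" for y
  proof -
    have "deep F.W n (pr y)"
      using d pr_W[OF y(1)] lt_lift_left[OF y(1) tF] lt_irr[OF y(1) s] y by blast
    then show ?thesis using deep_up[OF pr_W[OF y(1)]] irr_lift[OF y(1) deep_irrefl] by metis
  qed
  have "adj W (lift t) (lift s) \<or> (deep W n (lift t) \<or> \<not> dm W (lift t)) \<and>
     (\<forall>y\<in>W. lt (lift t) y \<longrightarrow> lt y (lift s) \<longrightarrow> deep W n y)"
    using c int adj_up[OF tF s] deep_up[OF tF] dm_lift[OF tF] by blast
  then show ?thesis unfolding supported_def using lt_lift[OF tF s(1)] t by blast
qed

text \<open>Apart from adjacency, the critical case is a supporting \<open>w\<close> with reflexive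
  projection. Its lift is in the cluster of \<open>w\<close>, since otherwise it would be a
  reflexive point inside the gap, where all points are deep. Hence \<open>pr w\<close> is not
  \<open>dm\<close> if \<open>w\<close> is not.\<close>

lemma supported_down:
  assumes T: "T \<subseteq> W" and u: "u \<in> W" "\<not> crel (pr u) (pr u)" and sup: "supported W n T u"
  shows "supported F.W n (pr ` T) (pr u)"
proof -
  obtain w where w: "w \<in> T" "lt w u"
    and c: "adj W w u \<or> (deep W n w \<or> \<not> dm W w) \<and> (\<forall>y\<in>W. lt w y \<longrightarrow> lt y u \<longrightarrow> deep W n y)"
    using sup by (auto simp: supported_def)
  have wW: "w \<in> W" using w T by blast
  have F: "pr w \<in> F.W" "pr u \<in> F.W" using pr_W wW u by auto
  have lu: "lift (pr u) = u" using irr_lift u by blast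
  have lt: "lt (pr w) (pr u)" using lt_irr[OF wW F(2) u(2)] w lu by simp
  have btw: "lift t \<in> W \<and> lt w (lift t) \<and> lt (lift t) u" if "t \<in> F.W" "lt (pr w) t" "lt t (pr u)" for t
    using lift_W[OF that(1)] lt_lift_right[OF wW that(1,2)] lt_lift[OF that(1) F(2)] that(3) lu by simp
  let ?l = "lift (pr w)"
  have l: "?l \<in> W" "lt ?l u" using lift_W F lt_lift[OF F] lt lu by auto
  show ?thesis
  proof (cases "adj W w u")
    case True
    then have "adj F.W (pr w) (pr u)" using lt btw unfolding adj_def by blast
    then show ?thesis using w lt unfolding supported_def by blast
  next
    case False
    then have d: "deep W n w \<or> \<not> dm W w" and int: "\<And>y. y \<in> W \<Longrightarrow> lt w y \<Longrightarrow> lt y u \<Longrightarrow> deep W n y"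
      using c by auto
    have intF: "deep F.W n t" if t: "t \<in> F.W" "lt (pr w) t" "lt t (pr u)" for t
    proof -
      have dl: "deep W n (lift t)" using int btw[OF t] by blast
      then have "\<not> crel t t" using deep_irrefl crel_lift t by blast
      then show ?thesis using deep_down[OF lift_W[OF t(1)] _ dl] pr_lift t by simp
    qed
    have cl: "crel ?l w" if r: "crel (pr w) (pr w)"
    proof (rule ccontr)
      assume "\<not> crel ?l w"
      then have "lt w ?l" using crel_lift_iff[OF wW F(1)] r by (simp add: lt_def)
      then have "deep W n ?l" using int l by blast
      then show False using deep_irrefl crel_lift F r by blast
    qed
    have "deep F.W n (pr w) \<or> \<not> dm F.W (pr w)"
    proof (cases "dm W w")
      case True
      then have dw: "deep W n w" using d by blast
      have "\<not> crel (pr w) (pr w)"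
      proof
        assume r: "crel (pr w) (pr w)"
        then have "crel w ?l" "crel ?l w" using crel_lift_iff wW F cl by auto
        then show False using deep_irrefl[OF dw] W_trans wW by blast
      qed
      then show ?thesis using deep_down wW dw by blast
    next
      case False
      then have "crel (pr w) (pr w)" using not_dm_refl wW pr_mono by blast
      then have "crel w ?l" "crel ?l w" using crel_lift_iff wW F cl by auto
      then show ?thesis using dm_lift[OF F(1)] dm_cluster[OF l(1) wW] False by blast
    qed
    then show ?thesis using w lt intF unfolding supported_def by blast
  qed
qed

end

section \<open>Soundness and refutation of canonical formulas\<close>

lemma holds_subst:
  "holds F v y (subst s \<phi>) \<longleftrightarrow> holds F (\<lambda>p. {z. holds F v z (s p)}) y \<phi>"
  by (induction \<phi> arbitrary: y) auto

lemma holds_cong_val: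
  "\<lbrakk>y \<in> worlds F; \<And>p z. p \<in> sig \<phi> \<Longrightarrow> z \<in> worlds F \<Longrightarrow> z \<in> v p \<longleftrightarrow> z \<in> v' p\<rbrakk> \<Longrightarrow>
   holds F v y \<phi> \<longleftrightarrow> holds F v' y \<phi>"
  by (induction \<phi> arbitrary: y) auto

lemma internal_truth:
  assumes "general_frame F" "\<And>p. v p \<in> internal F"
  shows "{y \<in> worlds F. holds F v y \<phi>} \<in> internal F"
proof (induction \<phi>)
  case (Var p)
  have "v p \<subseteq> worlds F" using assms by (auto simp: general_frame_def)
  then have "{y \<in> worlds F. y \<in> v p} = v p" by blast
  then show ?case using assms by simp
next
  case Bot
  have "worlds F - worlds F \<in> internal F" using assms unfolding general_frame_def by blast
  then show ?case by simp
next
  case (Neg \<phi>)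
  have "{y \<in> worlds F. \<not> holds F v y \<phi>} = worlds F - {y \<in> worlds F. holds F v y \<phi>}" by blast
  then show ?case using Neg assms by (simp add: general_frame_def)
next
  case (And \<phi> \<psi>)
  have "{y \<in> worlds F. holds F v y \<phi> \<and> holds F v y \<psi>} =
    {y \<in> worlds F. holds F v y \<phi>} \<inter> {y \<in> worlds F. holds F v y \<psi>}" by blast
  then show ?case using And assms by (simp add: general_frame_def)
next
  case (Dia \<phi>)
  have "{y \<in> worlds F. \<exists>z\<in>worlds F. acc F y z \<and> holds F v z \<phi>} =
    dia_set (worlds F) (acc F) {y \<in> worlds F. holds F v y \<phi>}" by (auto simp: dia_set_def)
  then show ?case using Dia assms by (simp add: general_frame_def)
qed (use assms in \<open>auto simp: general_frame_def\<close>)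

lemma holds_prop_eval: "prop_eval (holds F v y) \<phi> \<longleftrightarrow> holds F v y \<phi>"
  by (induction \<phi>) auto

lemma nml_sound:
  assumes F: "general_frame F" and "\<And>\<phi>. \<phi> \<in> \<Gamma> \<Longrightarrow> valid F \<phi>" and "\<phi> \<in> nml \<Gamma>"
  shows "valid F \<phi>"
  using assms(3)
proof induction
  case (taut \<phi>)
  then show ?case using holds_prop_eval by (metis tautology_def valid_def)
next
  case (mp \<phi> \<psi>)
  then show ?case by (auto simp: valid_def)
next
  case (nec \<phi>)
  then show ?case by (auto simp: valid_def)
next
  case (sub \<phi> s)
  show ?case
    unfolding valid_def
  proof (intro allI impI ballI)
    fix v :: "nat \<Rightarrow> 'a set" and y
    assume v: "\<forall>p. v p \<in> internal F" and y: "y \<in> worlds F"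
    let ?u = "\<lambda>p. {z \<in> worlds F. holds F v z (s p)}"
    have "\<forall>p. ?u p \<in> internal F" using internal_truth F v by blast
    then have "holds F ?u y \<phi>" using sub.IH y by (auto simp: valid_def)
    then show "holds F v y (subst s \<phi>)"
      unfolding holds_subst using y by (subst holds_cong_val[of _ _ _ _ ?u]) auto
  qed
qed (use assms in \<open>auto simp: valid_def\<close>)

lemma holds_Imp: "holds F v y (Imp \<phi> \<psi>) \<longleftrightarrow> (holds F v y \<phi> \<longrightarrow> holds F v y \<psi>)"
  by auto

definition linear_frame :: "'w gframe \<Rightarrow> bool" where
  "linear_frame F \<longleftrightarrow>
     (\<forall>y\<in>worlds F. \<forall>z\<in>worlds F. \<forall>u\<in>worlds F. acc F y z \<longrightarrow> acc F z u \<longrightarrow> acc F y u) \<and>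
     (\<forall>y\<in>worlds F. \<forall>z\<in>worlds F. \<forall>u\<in>worlds F.
        acc F y z \<longrightarrow> acc F y u \<longrightarrow> z = u \<or> acc F z u \<or> acc F u z)"

lemma K43_sound:
  assumes F: "general_frame F" and lin: "linear_frame F" and "\<phi> \<in> K43"
  shows "valid F \<phi>"
proof -
  have K: "valid F \<phi>" if "\<phi> \<in> logic_K" for \<phi>
    using nml_sound[OF F _ that[unfolded logic_K_def]] by blast
  have "valid F (Imp (Box (Var 0)) (Box (Box (Var 0))))"
    unfolding valid_def
  proof (intro allI impI ballI)
    fix v y assume "y \<in> worlds F"
    then have "acc F y u" if "z \<in> worlds F" "u \<in> worlds F" "acc F y z" "acc F z u" for z u
      using lin that unfolding linear_frame_def by blast
    then show "holds F v y (Imp (Box (Var 0)) (Box (Box (Var 0))))" by (simp add: holds_Imp) blast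
  qed
  then have four: "valid F \<phi>" if "\<phi> \<in> oplus logic_K {Imp (Box (Var 0)) (Box (Box (Var 0)))}" for \<phi>
    using nml_sound[OF F _ that[unfolded oplus_def]] K by blast
  have "valid F (Or (Box (Imp (Boxp (Var 0)) (Var 1))) (Box (Imp (Boxp (Var 1)) (Var 0))))"
    unfolding valid_def
  proof (intro allI impI ballI, rule ccontr)
    fix v y assume y: "y \<in> worlds F"
      and "\<not> holds F v y (Or (Box (Imp (Boxp (Var 0)) (Var 1))) (Box (Imp (Boxp (Var 1)) (Var 0))))"
    then obtain z u where z: "z \<in> worlds F" "acc F y z" "z \<in> v 0" "z \<notin> v 1"
        "\<And>w. w \<in> worlds F \<Longrightarrow> acc F z w \<Longrightarrow> w \<in> v 0"
      and u: "u \<in> worlds F" "acc F y u" "u \<in> v 1" "u \<notin> v 0"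
        "\<And>w. w \<in> worlds F \<Longrightarrow> acc F u w \<Longrightarrow> w \<in> v 1"
      by auto
    have "z = u \<or> acc F z u \<or> acc F u z" using lin y z u unfolding linear_frame_def by blast
    then show False using z u by blast
  qed
  then show ?thesis
    using nml_sound[OF F _ assms(3)[unfolded K43_def, unfolded oplus_def[of "oplus _ _"]]] four by blast
qed

lemma K43_four: "Imp (Box (Var 0)) (Box (Box (Var 0))) \<in> K43"
  by (auto simp: K43_def oplus_def intro!: nml.ax)

lemma K43_three:
  "Or (Box (Imp (Boxp (Var 0)) (Var 1))) (Box (Imp (Boxp (Var 1)) (Var 0))) \<in> K43"
  by (auto simp: K43_def oplus_def intro!: nml.ax)

lemma K43_kripke_linear:
  assumes "frame_for K43 (kripke V S)"
  shows "linear_frame (kripke V S)"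
proof -
  have val: "holds (kripke V S) v y \<phi>" if "\<phi> \<in> K43" "\<And>p. v p \<subseteq> V" "y \<in> V" for v y \<phi>
    using assms that unfolding frame_for_def valid_def kripke_def by auto
  show ?thesis
    unfolding linear_frame_def
  proof (intro conjI ballI impI)
    fix y z u assume V: "y \<in> worlds (kripke V S)" "z \<in> worlds (kripke V S)" "u \<in> worlds (kripke V S)"
      and yz: "acc (kripke V S) y z" and zu: "acc (kripke V S) z u"
    show "acc (kripke V S) y u"
    proof -
      have "holds (kripke V S) (\<lambda>_. {w \<in> V. S y w}) y (Imp (Box (Var 0)) (Box (Box (Var 0))))"
        by (rule val[OF K43_four]) (use V in \<open>auto simp: kripke_def\<close>)
      then have "\<forall>z\<in>V. S y z \<longrightarrow> (\<forall>u\<in>V. S z u \<longrightarrow> S y u)" by (simp add: kripke_def)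
      moreover have "y \<in> V" "z \<in> V" "u \<in> V" "S y z" "S z u" using V yz zu by (simp_all add: kripke_def)
      ultimately have "S y u" by blast
      then show ?thesis by (simp add: kripke_def)
    qed
  next
    fix y z u assume V: "y \<in> worlds (kripke V S)" "z \<in> worlds (kripke V S)" "u \<in> worlds (kripke V S)"
      and yz: "acc (kripke V S) y z" "acc (kripke V S) y u"
    show "z = u \<or> acc (kripke V S) z u \<or> acc (kripke V S) u z"
    proof (rule ccontr)
      assume n: "\<not> ?thesis"
      \<comment> \<open>The points from \<open>z\<close> on and the points from \<open>u\<close> on:
        each set is closed under successors and misses the other point.\<close>
      let ?v = "\<lambda>p. if p = 0 then {w \<in> V. w = z \<or> S z w} else {w \<in> V. w = u \<or> S u w}"
      have "holds (kripke V S) ?v y (Or (Box (Imp (Boxp (Var 0)) (Var 1))) (Box (Imp (Boxp (Var 1)) (Var 0))))"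
        by (rule val[OF K43_three]) (use V in \<open>auto simp: kripke_def\<close>)
      then show False using V yz n by (auto simp: kripke_def)
    qed
  qed
qed

lemma k43_logic_oplus: "k43_logic (oplus K43 \<Gamma>)"
proof unfold_locales
  have sub: "subst s \<phi> \<in> oplus K43 \<Gamma>" if "\<phi> \<in> K43" for s \<phi>
    using that unfolding oplus_def by (intro nml.sub nml.ax) auto
  fix \<phi> \<psi>
  show "Imp (Box \<phi>) (Box (Box \<phi>)) \<in> oplus K43 \<Gamma>"
    using sub[OF K43_four, of "\<lambda>_. \<phi>"] by simp
  show "Or (Box (Imp (Boxp \<phi>) \<psi>)) (Box (Imp (Boxp \<psi>) \<phi>)) \<in> oplus K43 \<Gamma>"
    using sub[OF K43_three, of "\<lambda>p. if p = 0 then \<phi> else \<psi>"] by simp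
qed (auto simp: oplus_def intro: nml.intros)

section \<open>Refutations of canonical formulas in semantic form\<close>

definition up :: "'w gframe \<Rightarrow> 'w \<Rightarrow> 'w set" where
  "up F r = {y \<in> worlds F. y = r \<or> acc F r y}"

text \<open>Index \<open>i\<close> is realised at the points of \<open>up F r\<close> outside
  \<open>v i\<close>. The clauses: \<open>r\<close> realises the root index; realisers of
  \<open>i\<close> see realisers of all \<open>T\<close>-successors of \<open>i\<close>, see
  realisers of nothing else, and realise no second index; the closed domain condition holds at
  points realising no index; every point realises an index or sees a realiser of one. This is a
  cofinal subreduction written in terms of the refuting valuation.\<close>

definition refutes ::
  "'w gframe \<Rightarrow> (nat \<Rightarrow> 'w set) \<Rightarrow> 'w \<Rightarrow> (nat \<Rightarrow> nat \<Rightarrow> bool) \<Rightarrow> nat \<Rightarrow> nat set \<Rightarrow> bool" where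
  "refutes F v r T n D \<longleftrightarrow> r \<notin> v 0 \<and>
     (\<forall>i<n. \<forall>j<n. T i j \<longrightarrow> (\<forall>y\<in>up F r. y \<notin> v i \<longrightarrow> (\<exists>z\<in>worlds F. acc F y z \<and> z \<notin> v j))) \<and>
     (\<forall>i<n. \<forall>y\<in>up F r. y \<notin> v i \<longrightarrow>
        (\<forall>k<n. \<not> T i k \<longrightarrow> (\<forall>z\<in>worlds F. acc F y z \<longrightarrow> z \<in> v k)) \<and> (\<forall>j<n. j \<noteq> i \<longrightarrow> y \<in> v j)) \<and>
     (\<forall>d\<in>D. \<forall>y\<in>up F r.
        (\<forall>i<n. i \<noteq> d \<longrightarrow> \<not> T d i \<longrightarrow> (\<forall>z\<in>worlds F. acc F y z \<longrightarrow> z \<in> v i)) \<longrightarrow>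
        (\<forall>i<n. y \<in> v i) \<longrightarrow>
        (\<forall>z\<in>worlds F. acc F y z \<longrightarrow> z \<in> v d)) \<and>
     (\<forall>y\<in>up F r. \<exists>i<n. y \<notin> v i \<or> (\<exists>z\<in>worlds F. acc F y z \<and> z \<notin> v i))"

lemma holds_Conj [simp]: "holds F v y (Conj xs) \<longleftrightarrow> (\<forall>\<phi>\<in>set xs. holds F v y \<phi>)"
  by (induction xs) auto

lemma holds_Boxp: "r \<in> worlds F \<Longrightarrow> holds F v r (Boxp \<phi>) \<longleftrightarrow> (\<forall>y\<in>up F r. holds F v y \<phi>)"
  by (auto simp: up_def)

lemma holds_Box: "holds F v y (Box \<phi>) \<longleftrightarrow> (\<forall>z\<in>worlds F. acc F y z \<longrightarrow> holds F v z \<phi>)"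
  by auto

lemma ball_compr1:
  "(\<forall>\<phi>\<in>set (concat (map (\<lambda>i. if P i then [f i] else []) xs)). Q \<phi>) \<longleftrightarrow>
     (\<forall>i\<in>set xs. P i \<longrightarrow> Q (f i))"
  by auto

lemma ball_compr2:
  "(\<forall>\<phi>\<in>set (concat (map (\<lambda>i. concat (map (\<lambda>j. if P i j then [f i j] else []) ys)) xs)). Q \<phi>) \<longleftrightarrow>
     (\<forall>i\<in>set xs. \<forall>j\<in>set ys. P i j \<longrightarrow> Q (f i j))"
  by auto

lemma ball_map: "(\<forall>\<phi>\<in>set (map f xs). Q \<phi>) \<longleftrightarrow> (\<forall>i\<in>set xs. Q (f i))"
  by auto

lemma ball_single: "(\<forall>\<phi>\<in>set [a]. Q \<phi>) \<longleftrightarrow> Q a"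
  by auto

lemma ball_upt: "(\<forall>i\<in>set [0..<n]. P i) \<longleftrightarrow> (\<forall>i<n. P i)"
  by auto

lemma canonical_fm_refutes:
  assumes r: "r \<in> worlds F"
  shows "\<not> holds F v r (canonical_fm S as D) \<longleftrightarrow>
    refutes F v r (\<lambda>i j. S (as ! i) (as ! j)) (length as) {d. d < length as \<and> as ! d \<in> D}"
    (is "_ \<longleftrightarrow> ?R")
proof -
  have up: "holds F v y (Boxp \<phi>) \<longleftrightarrow> holds F v y \<phi> \<and> (\<forall>z\<in>worlds F. acc F y z \<longrightarrow> holds F v z \<phi>)" for y \<phi>
    by auto
  have "\<not> holds F v r (canonical_fm S as D) \<longleftrightarrow> r \<notin> v 0 \<and>
     (\<forall>i<length as. \<forall>j<length as. S (as ! i) (as ! j) \<longrightarrow>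
        (\<forall>y\<in>up F r. (\<forall>z\<in>worlds F. acc F y z \<longrightarrow> z \<in> v j) \<longrightarrow> y \<in> v i)) \<and>
     (\<forall>i<length as. \<forall>y\<in>up F r.
        (((\<forall>k<length as. \<not> S (as ! i) (as ! k) \<longrightarrow> (\<forall>z\<in>worlds F. acc F y z \<longrightarrow> z \<in> v k)) \<and>
          (\<forall>j<length as. j \<noteq> i \<longrightarrow> y \<in> v j) \<longrightarrow> y \<in> v i) \<longrightarrow> y \<in> v i)) \<and>
     (\<forall>d<length as. as ! d \<in> D \<longrightarrow> (\<forall>y\<in>up F r.
        (\<forall>i<length as. i \<noteq> d \<and> \<not> S (as ! d) (as ! i) \<longrightarrow> (\<forall>z\<in>worlds F. acc F y z \<longrightarrow> z \<in> v i)) \<and>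
        (\<forall>i<length as. y \<in> v i) \<longrightarrow> (\<forall>z\<in>worlds F. acc F y z \<longrightarrow> z \<in> v d))) \<and>
     (\<forall>y\<in>up F r. \<not> (\<forall>i<length as. y \<in> v i \<and> (\<forall>z\<in>worlds F. acc F y z \<longrightarrow> z \<in> v i)))"
    unfolding canonical_fm_def Let_def holds_Imp holds_Conj set_append ball_Un
      ball_compr1 ball_compr2 ball_map ball_single ball_upt holds_Boxp[OF r] holds_Box holds.simps(1,3)
    unfolding holds.simps(1,5) holds_Conj ball_compr1 ball_map ball_upt holds_Box
    by (simp add: conj_ac)
  also have "\<dots> \<longleftrightarrow> ?R" unfolding refutes_def
  proof (intro conj_cong refl, goal_cases)
    case 1
    show ?case
      by (rule all_cong1, rule imp_cong[OF refl], rule all_cong1, rule imp_cong[OF refl],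
          rule imp_cong[OF refl], rule ball_cong[OF refl]) blast
  next
    case 2
    show ?case
      by (rule all_cong1, rule imp_cong[OF refl], rule ball_cong[OF refl]) blast
  next
    case 3
    show ?case by (simp only: mem_Collect_eq Ball_Collect subset_iff imp_conjL)
  next
    case 4
    show ?case by (intro ball_cong refl; blast)
  qed
  finally show ?thesis .
qed

section \<open>Ordered sums of blocks\<close>

text \<open>All points are compared, not only those with a common predecessor, since in an ordered
  sum the points of a later summand have common predecessors in the earlier ones.\<close>

definition total_frame :: "'w gframe \<Rightarrow> bool" where
  "total_frame F \<longleftrightarrow>
     (\<forall>y\<in>worlds F. \<forall>z\<in>worlds F. \<forall>u\<in>worlds F. acc F y z \<longrightarrow> acc F z u \<longrightarrow> acc F y u) \<and>
     (\<forall>y\<in>worlds F. \<forall>z\<in>worlds F. y = z \<or> acc F y z \<or> acc F z y)"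

lemma total_frame_linear: "total_frame F \<Longrightarrow> linear_frame F"
  unfolding total_frame_def linear_frame_def by blast

lemma general_frame_kripke: "W \<noteq> {} \<Longrightarrow> general_frame (kripke W R)"
  by (auto simp: general_frame_def kripke_def dia_set_def)

lemma CX_subset: "i < k \<Longrightarrow> CX k i \<subseteq> C_worlds k"
  by (auto simp: CX_def C_worlds_def)

lemma internal_C_subset: "X \<in> internal (C_frame rf k) \<Longrightarrow> X \<subseteq> C_worlds k"
proof -
  assume "X \<in> internal (C_frame rf k)"
  then have "X \<in> generated_internal (C_worlds k) (C_acc rf) (CX k ` {..<k} \<union> {{PB n} | n. True})"
    by (simp add: C_frame_def)
  then show ?thesis
  proof induction
    case (gen X)
    then consider i where "i < k" "X = CX k i" | n where "X = {PB n}" by auto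
    then show ?case by cases (use CX_subset in \<open>auto simp: C_worlds_def\<close>)
  qed (auto simp: dia_set_def)
qed

lemma general_frame_C: "general_frame (C_frame rf k)"
  unfolding general_frame_def
proof (intro conjI ballI)
  show "internal (C_frame rf k) \<subseteq> Pow (worlds (C_frame rf k))"
    using internal_C_subset by (fastforce simp: C_frame_def)
qed (auto simp: C_frame_def C_worlds_def intro: generated_internal.intros)

text \<open>Far enough out, an internal set cannot tell b_n from a_(n mod k). In the diamond step,
  one b_l in the set puts all a_i and all b_n with n > l into its diamond, while by the induction
  hypothesis a set without any b_l is empty.\<close>

lemma internal_C_eventually:
  assumes "X \<in> internal (C_frame rf k)" and k: "0 < k"
  shows "\<exists>m. \<forall>n\<ge>m. PB n \<in> X \<longleftrightarrow> PA (n mod k) \<in> X"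
proof -
  have "X \<in> generated_internal (C_worlds k) (C_acc rf) (CX k ` {..<k} \<union> {{PB n} | n. True})"
    using assms by (simp add: C_frame_def)
  then show ?thesis
  proof induction
    case (gen X)
    then consider i where "i < k" "X = CX k i" | n where "X = {PB n}" by auto
    then show ?case
    proof cases
      case 1
      then show ?thesis by (auto simp: CX_def)
    next
      case 2
      then show ?thesis by (auto intro!: exI[of _ "Suc n"])
    qed
  next
    case top
    then show ?case using k by (auto simp: C_worlds_def)
  next
    case (int X Y)
    then obtain m m' where "\<forall>n\<ge>m. PB n \<in> X \<longleftrightarrow> PA (n mod k) \<in> X" "\<forall>n\<ge>m'. PB n \<in> Y \<longleftrightarrow> PA (n mod k) \<in> Y"
      by blast
    then show ?case by (intro exI[of _ "max m m'"]) auto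
  next
    case (compl X)
    then show ?case using k by (auto simp: C_worlds_def)
  next
    case (dia X)
    then obtain m where m: "\<forall>n\<ge>m. PB n \<in> X \<longleftrightarrow> PA (n mod k) \<in> X" by blast
    show ?case
    proof (cases "\<exists>l. PB l \<in> X")
      case True
      then obtain l where "PB l \<in> X" by blast
      then show ?thesis using k
        by (intro exI[of _ "Suc l"]) (auto simp: dia_set_def C_acc_def C_worlds_def Bex_def intro!: exI[of _ "PB l"])
    next
      case False
      have "PA i \<notin> X" for i
      proof
        assume "PA i \<in> X"
        moreover have "X \<subseteq> C_worlds k" using dia.hyps internal_C_subset[of X rf k] by (simp add: C_frame_def)
        ultimately have "i < k" by (auto simp: C_worlds_def)
        then have "PB (i + k * m) \<in> X" using m \<open>PA i \<in> X\<close> k by (auto simp: trans_le_add2)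
        then show False using False by blast
      qed
      then have "X = {}" using False by (metis equals0I point.exhaust)
      then show ?thesis by (auto simp: dia_set_def)
    qed
  qed
qed

lemma total_frame_C: "total_frame (C_frame rf k)"
  by (auto simp: total_frame_def C_frame_def C_worlds_def C_acc_def)

lemma worlds_osum: "worlds (osum_frame Fs) = (SIGMA j:{..<length Fs}. worlds (Fs ! j))"
  by (simp add: osum_frame_def)

lemma acc_osum: "acc (osum_frame Fs) (i, p) (j, q) \<longleftrightarrow> i < j \<or> i = j \<and> acc (Fs ! i) p q"
  by (simp add: osum_frame_def)

lemma total_frame_osum:
  assumes "\<And>F. F \<in> set Fs \<Longrightarrow> total_frame F"
  shows "total_frame (osum_frame Fs)"
proof -
  have t: "total_frame (Fs ! j)" if "j < length Fs" for j using assms that by simp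
  show ?thesis
    unfolding total_frame_def
  proof (intro conjI ballI impI)
    fix p q r assume "p \<in> worlds (osum_frame Fs)" "q \<in> worlds (osum_frame Fs)" "r \<in> worlds (osum_frame Fs)"
      and a: "acc (osum_frame Fs) p q" "acc (osum_frame Fs) q r"
    then obtain i p' j q' k r' where e: "p = (i, p')" "q = (j, q')" "r = (k, r')"
      and w: "i < length Fs" "p' \<in> worlds (Fs ! i)" "q' \<in> worlds (Fs ! j)" "r' \<in> worlds (Fs ! k)"
      by (auto simp: worlds_osum)
    have "acc (Fs ! i) p' r'" if "i = j" "j = k" "acc (Fs ! i) p' q'" "acc (Fs ! j) q' r'"
      using t[OF w(1)] w that unfolding total_frame_def by blast
    then show "acc (osum_frame Fs) p r"
      using a unfolding e acc_osum by auto
  next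
    fix p q assume "p \<in> worlds (osum_frame Fs)" "q \<in> worlds (osum_frame Fs)"
    then obtain i p' j q' where e: "p = (i, p')" "q = (j, q')"
      and w: "i < length Fs" "p' \<in> worlds (Fs ! i)" "q' \<in> worlds (Fs ! j)"
      by (auto simp: worlds_osum)
    have "p' = q' \<or> acc (Fs ! i) p' q' \<or> acc (Fs ! i) q' p'" if "i = j"
      using t[OF w(1)] w that unfolding total_frame_def by blast
    then show "p = q \<or> acc (osum_frame Fs) p q \<or> acc (osum_frame Fs) q p"
      unfolding e acc_osum by auto
  qed
qed

lemma general_frame_osum:
  assumes ne: "Fs \<noteq> []" and gf: "\<And>F. F \<in> set Fs \<Longrightarrow> general_frame F"
  shows "general_frame (osum_frame Fs)"
proof -
  have gfj: "general_frame (Fs ! j)" if "j < length Fs" for j using gf that by simp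
  have I: "X \<in> internal (osum_frame Fs) \<longleftrightarrow>
      (\<exists>Z. X = (SIGMA j:{..<length Fs}. Z j) \<and> (\<forall>j<length Fs. Z j \<in> internal (Fs ! j)))" for X
    by (auto simp: osum_frame_def)
  show ?thesis
    unfolding general_frame_def
  proof (intro conjI ballI)
    show "worlds (osum_frame Fs) \<noteq> {}"
    proof -
      have "worlds (Fs ! 0) \<noteq> {}" using ne gfj[of 0] by (simp add: general_frame_def)
      then obtain q where "q \<in> worlds (Fs ! 0)" by blast
      then have "(0, q) \<in> worlds (osum_frame Fs)" using ne by (simp add: worlds_osum)
      then show ?thesis by blast
    qed
    show "internal (osum_frame Fs) \<subseteq> Pow (worlds (osum_frame Fs))"
    proof
      fix X assume "X \<in> internal (osum_frame Fs)"
      then obtain Z where Z: "X = (SIGMA j:{..<length Fs}. Z j)" "\<forall>j<length Fs. Z j \<in> internal (Fs ! j)"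
        using I by blast
      have "Z j \<subseteq> worlds (Fs ! j)" if "j < length Fs" for j
        using Z(2) gfj[OF that] that unfolding general_frame_def by blast
      then show "X \<in> Pow (worlds (osum_frame Fs))" by (auto simp: Z(1) worlds_osum)
    qed
    show "worlds (osum_frame Fs) \<in> internal (osum_frame Fs)"
      unfolding I worlds_osum using gfj by (intro exI[of _ "\<lambda>j. worlds (Fs ! j)"]) (simp add: general_frame_def)
  next
    fix X Y assume "X \<in> internal (osum_frame Fs)" "Y \<in> internal (osum_frame Fs)"
    then obtain Z Z' where Z: "X = (SIGMA j:{..<length Fs}. Z j)" "\<forall>j<length Fs. Z j \<in> internal (Fs ! j)"
      "Y = (SIGMA j:{..<length Fs}. Z' j)" "\<forall>j<length Fs. Z' j \<in> internal (Fs ! j)"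
      unfolding I by blast
    then show "X \<inter> Y \<in> internal (osum_frame Fs)"
      unfolding I using gfj by (intro exI[of _ "\<lambda>j. Z j \<inter> Z' j"]) (auto simp: general_frame_def)
  next
    fix X assume "X \<in> internal (osum_frame Fs)"
    then obtain Z where Z: "X = (SIGMA j:{..<length Fs}. Z j)" "\<forall>j<length Fs. Z j \<in> internal (Fs ! j)"
      unfolding I by blast
    then show "worlds (osum_frame Fs) - X \<in> internal (osum_frame Fs)"
      unfolding I worlds_osum using gfj
      by (intro exI[of _ "\<lambda>j. worlds (Fs ! j) - Z j"]) (auto simp: general_frame_def)
    have sub: "Z j \<subseteq> worlds (Fs ! j)" if "j < length Fs" for j
      using Z(2) gfj[OF that] that unfolding general_frame_def by blast
    let ?later = "\<lambda>i. \<exists>j<length Fs. i < j \<and> Z j \<noteq> {}"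
    \<comment> \<open>The diamond fills every summand that precedes a nonempty part of the
      set.\<close>
    let ?D = "\<lambda>i. if ?later i then worlds (Fs ! i) else dia_set (worlds (Fs ! i)) (acc (Fs ! i)) (Z i)"
    have "dia_set (worlds (osum_frame Fs)) (acc (osum_frame Fs)) X = (SIGMA j:{..<length Fs}. ?D j)"
    proof (intro set_eqI)
      fix p :: "nat \<times> 'a"
      obtain i q where p: "p = (i, q)" by (cases p)
      have "p \<in> dia_set (worlds (osum_frame Fs)) (acc (osum_frame Fs)) X \<longleftrightarrow>
        i < length Fs \<and> q \<in> worlds (Fs ! i) \<and>
        (\<exists>j q'. j < length Fs \<and> q' \<in> Z j \<and> (i < j \<or> i = j \<and> acc (Fs ! i) q q'))"
        unfolding dia_set_def worlds_osum p Z(1) by (auto simp: acc_osum)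
      also have "\<dots> \<longleftrightarrow> p \<in> (SIGMA j:{..<length Fs}. ?D j)"
        unfolding p dia_set_def by auto
      finally show "p \<in> dia_set (worlds (osum_frame Fs)) (acc (osum_frame Fs)) X \<longleftrightarrow>
        p \<in> (SIGMA j:{..<length Fs}. ?D j)" .
    qed
    moreover have "?D j \<in> internal (Fs ! j)" if "j < length Fs" for j
      using gfj[OF that] Z(2) that by (simp add: general_frame_def)
    ultimately show "dia_set (worlds (osum_frame Fs)) (acc (osum_frame Fs)) X \<in> internal (osum_frame Fs)"
      unfolding I by blast
  qed
qed

datatype kind = KP | KC | KD | KO

text \<open>A block consists of its kind (an irreflexive point, a reflexive cluster, or one of the two
  infinite atomic frames), the set of types that it represents if it has to be matched exactly by
  the other model, and the points of the canonical model from which it is built.\<close>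

type_synonym block = "kind \<times> fm set set option \<times> fm set list"

abbreviation kd :: "block \<Rightarrow> kind" where "kd b \<equiv> fst b"
abbreviation tag :: "block \<Rightarrow> fm set set option" where "tag b \<equiv> fst (snd b)"
abbreviation ws :: "block \<Rightarrow> fm set list" where "ws b \<equiv> snd (snd b)"
abbreviation reg :: "block \<Rightarrow> bool" where "reg b \<equiv> kd b = KP \<or> kd b = KC"

section \<open>Models built from blocks\<close>

definition atom :: "block \<Rightarrow> atomic" where
  "atom b = (case kd b of KP \<Rightarrow> IrrChain | KC \<Rightarrow> Cluster | KD \<Rightarrow> CIrr | KO \<Rightarrow> CRefl) (length (ws b))"

definition bval :: "block \<Rightarrow> nat \<Rightarrow> point set" where
  "bval b p = (let I = {i. i < length (ws b) \<and> Var p \<in> ws b ! i} in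
     if reg b then PA ` I else (\<Union>i\<in>I. CX (length (ws b)) i))"

definition bseq :: "block list \<Rightarrow> atomic_seq" where
  "bseq Bs = map (\<lambda>b. (atom b, bval b)) Bs"

abbreviation bmodel :: "block list \<Rightarrow> (nat \<times> point) gmodel" where
  "bmodel Bs \<equiv> osum (seq_models (bseq Bs))"

definition bworlds :: "block \<Rightarrow> point set" where
  "bworlds b = PA ` {..<length (ws b)} \<union> (if reg b then {} else range PB)"

definition bacc :: "block \<Rightarrow> point \<Rightarrow> point \<Rightarrow> bool" where
  "bacc b q q' = acc (atomic_frame (atom b)) q q'"

text \<open>The canonical point that is copied: a_i and all b_n with n congruent to i are copies of
  the same one.\<close>

definition bpt :: "block \<Rightarrow> point \<Rightarrow> fm set" where
  "bpt b q = (case q of PA i \<Rightarrow> ws b ! i | PB n \<Rightarrow> ws b ! (n mod length (ws b)))"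

lemma worlds_atom: "worlds (atomic_frame (atom b)) = bworlds b"
  by (cases "kd b") (auto simp: atom_def bworlds_def kripke_def C_frame_def C_worlds_def)

lemma bacc_simps:
  "kd b = KP \<Longrightarrow> bacc b (PA i) (PA j) \<longleftrightarrow> i < j"
  "kd b = KC \<Longrightarrow> bacc b q q'"
  "\<not> reg b \<Longrightarrow> bacc b (PA i) q"
  "\<not> reg b \<Longrightarrow> \<not> bacc b (PB n) (PA i)"
  "kd b = KD \<Longrightarrow> bacc b (PB n) (PB m) \<longleftrightarrow> m < n"
  "kd b = KO \<Longrightarrow> bacc b (PB n) (PB m) \<longleftrightarrow> m \<le> n"
  by (cases "kd b"; auto simp: bacc_def atom_def kripke_def C_frame_def C_acc_def)+

lemma worlds_bmodel: "(j, q) \<in> worlds (fst (bmodel Bs)) \<longleftrightarrow> j < length Bs \<and> q \<in> bworlds (Bs ! j)"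
  by (auto simp: osum_def seq_models_def bseq_def worlds_osum worlds_atom)

lemma acc_bmodel:
  "i < length Bs \<Longrightarrow>
   acc (fst (bmodel Bs)) (i, q) (j, q') \<longleftrightarrow> i < j \<or> i = j \<and> bacc (Bs ! i) q q'"
  by (auto simp: osum_def seq_models_def bseq_def acc_osum bacc_def)

lemma total_frame_atom: "total_frame (atomic_frame (atom b))"
proof (cases "kd b")
  case KP
  then show ?thesis by (auto simp: atom_def total_frame_def kripke_def)
next
  case KC
  then show ?thesis by (auto simp: atom_def total_frame_def kripke_def)
qed (auto simp: atom_def total_frame_C)

lemma general_frame_atom: "ws b \<noteq> [] \<Longrightarrow> general_frame (atomic_frame (atom b))"
  by (cases "kd b") (auto simp: atom_def intro!: general_frame_kripke general_frame_C)

lemma bmodel_fst: "fst (bmodel Bs) = osum_frame (map (atomic_frame \<circ> atom) Bs)"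
  by (simp add: osum_def seq_models_def bseq_def comp_def)

lemma bmodel_val: "snd (bmodel Bs) p = (SIGMA j:{..<length Bs}. bval (Bs ! j) p)"
  by (auto simp: osum_def seq_models_def bseq_def)

lemma bmodel_total: "total_frame (fst (bmodel Bs))"
  unfolding bmodel_fst by (rule total_frame_osum) (auto simp: total_frame_atom)

lemma bmodel_general:
  "Bs \<noteq> [] \<Longrightarrow> (\<And>b. b \<in> set Bs \<Longrightarrow> ws b \<noteq> []) \<Longrightarrow> general_frame (fst (bmodel Bs))"
  unfolding bmodel_fst by (rule general_frame_osum) (auto intro: general_frame_atom)

lemma bval_iff:
  assumes "q \<in> bworlds b" "ws b \<noteq> []"
  shows "q \<in> bval b p \<longleftrightarrow> Var p \<in> bpt b q"
proof (cases "reg b")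
  case True
  then show ?thesis using assms by (auto simp: bval_def bworlds_def bpt_def)
next
  case False
  let ?k = "length (ws b)"
  have "?k > 0" using assms by simp
  have B: "PB n \<in> CX ?k i \<longleftrightarrow> n mod ?k = i" if "i < ?k" for n i using that by (auto simp: CX_def)
  have A: "PA j \<in> CX ?k i \<longleftrightarrow> j = i" for i j by (auto simp: CX_def)
  show ?thesis
  proof (cases q)
    case (PA j)
    then show ?thesis using False assms A by (auto simp: bval_def bworlds_def bpt_def)
  next
    case (PB n)
    have "n mod ?k < ?k" using \<open>?k > 0\<close> by simp
    then show ?thesis using False PB B by (auto simp: bval_def bpt_def)
  qed
qed

lemma CX_Union_internal:
  "finite I \<Longrightarrow> I \<subseteq> {..<k} \<Longrightarrow> (\<Union>i\<in>I. CX k i) \<in> internal (C_frame rf k)"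
proof (induction I rule: finite_induct)
  case empty
  have "C_worlds k - C_worlds k \<in> generated_internal (C_worlds k) (C_acc rf) (CX k ` {..<k} \<union> {{PB n} | n. True})"
    by (intro generated_internal.intros)
  then show ?case by (simp add: C_frame_def)
next
  case (insert a I)
  let ?G = "generated_internal (C_worlds k) (C_acc rf) (CX k ` {..<k} \<union> {{PB n} | n. True})"
  have 1: "CX k a \<in> ?G" using insert.prems by (intro generated_internal.gen) auto
  have 2: "(\<Union>i\<in>I. CX k i) \<in> ?G" using insert by (simp add: C_frame_def)
  have "C_worlds k - ((C_worlds k - CX k a) \<inter> (C_worlds k - (\<Union>i\<in>I. CX k i))) \<in> ?G"
    by (intro generated_internal.compl generated_internal.int 1 2)
  moreover have "C_worlds k - ((C_worlds k - CX k a) \<inter> (C_worlds k - (\<Union>i\<in>I. CX k i))) = (\<Union>i\<in>insert a I. CX k i)"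
  proof -
    have "CX k a \<subseteq> C_worlds k" "(\<Union>i\<in>I. CX k i) \<subseteq> C_worlds k"
      using insert.prems CX_subset by blast+
    then show ?thesis by blast
  qed
  ultimately show ?case by (simp add: C_frame_def)
qed

lemma bval_internal: "bval b p \<in> internal (atomic_frame (atom b))"
proof (cases "reg b")
  case True
  then show ?thesis by (cases "kd b") (auto simp: bval_def atom_def kripke_def)
next
  case False
  then have "bval b p \<in> internal (C_frame rf (length (ws b)))" for rf
    using CX_Union_internal[of "{i. i < length (ws b) \<and> Var p \<in> ws b ! i}" "length (ws b)" rf]
    by (auto simp: bval_def Let_def)
  then show ?thesis using False by (cases "kd b") (auto simp: atom_def)
qed

lemma bseq_simple:
  assumes "ws b \<noteq> []"
  shows "simple_model \<delta> (atomic_frame (atom b), bval b)"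
proof -
  have m: "is_model \<delta> (atomic_frame (atom b), bval b)"
    using general_frame_atom[OF assms] bval_internal by (auto simp: is_model_def)
  show ?thesis
  proof (cases "reg b")
    case True
    then have "\<exists>W R. finite W \<and> atomic_frame (atom b) = kripke W R"
      by (cases "kd b") (auto simp: atom_def intro!: exI[of _ "PA ` {..<length (ws b)}"])
    then show ?thesis using m by (simp add: simple_model_def)
  next
    case False
    have "\<exists>I\<subseteq>{..<length (ws b)}. bval b p = (\<Union>i\<in>I. CX (length (ws b)) i)" for p
      using False by (intro exI[of _ "{i. i < length (ws b) \<and> Var p \<in> ws b ! i}"]) (auto simp: bval_def Let_def)
    moreover have "\<exists>rf. atomic_frame (atom b) = C_frame rf (length (ws b))"
      using False by (cases "kd b") (auto simp: atom_def)
    ultimately show ?thesis using m assms unfolding simple_model_def by auto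
  qed
qed

lemma bmodel_is_model:
  assumes "Bs \<noteq> []" "\<And>b. b \<in> set Bs \<Longrightarrow> ws b \<noteq> []"
  shows "is_model \<delta> (bmodel Bs)"
proof -
  have "snd (bmodel Bs) p \<in> internal (fst (bmodel Bs))" for p
    unfolding bmodel_val bmodel_fst osum_frame_def
    by (auto intro!: exI[of _ "\<lambda>j. bval (Bs ! j) p"] bval_internal)
  then show ?thesis using bmodel_general assms by (simp add: is_model_def)
qed

lemma seq_size_bseq: "seq_size (bseq Bs) = (\<Sum>b\<leftarrow>Bs. length (ws b))"
proof (induction Bs)
  case (Cons b Bs)
  then show ?case by (cases "kd b") (auto simp: seq_size_def bseq_def atom_def)
qed (auto simp: seq_size_def bseq_def)

text \<open>The interface between the choice of summands and the transfer of refutations. Strictness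
  is demanded of regular summands only, as one limit cluster may give two consecutive infinite
  summands. By \<open>sup\<close> and \<open>supD\<close> the closed domain part of a refutation can
  be moved; \<open>supD\<close> forbids the kind \<open>KO\<close> where only deep points separate
  the limit from an irreflexive summand.\<close>

locale blocks = canon +
  fixes c :: nat and Bs :: "block list"
  assumes Bs_ne: "Bs \<noteq> []"
    and ws_ne: "b \<in> set Bs \<Longrightarrow> ws b \<noteq> []"
    and ws_dist: "b \<in> set Bs \<Longrightarrow> distinct (ws b)"
    and ws_W: "b \<in> set Bs \<Longrightarrow> y \<in> set (ws b) \<Longrightarrow> y \<in> W"
    and KP: "b \<in> set Bs \<Longrightarrow> kd b = KP \<Longrightarrow> \<exists>u. ws b = [u] \<and> \<not> crel u u"
    and cluster: "b \<in> set Bs \<Longrightarrow> kd b \<noteq> KP \<Longrightarrow> y \<in> set (ws b) \<Longrightarrow> z \<in> set (ws b) \<Longrightarrow> crel y z"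
    and KC: "b \<in> set Bs \<Longrightarrow> kd b = KC \<Longrightarrow> y \<in> set (ws b) \<Longrightarrow> dm W y"
    and nreg: "b \<in> set Bs \<Longrightarrow> \<not> reg b \<Longrightarrow> y \<in> set (ws b) \<Longrightarrow> \<not> dm W y"
    and KD: "b \<in> set Bs \<Longrightarrow> kd b = KD \<Longrightarrow> y \<in> set (ws b) \<Longrightarrow> limD W c y"
    and KO: "b \<in> set Bs \<Longrightarrow> kd b = KO \<Longrightarrow> y \<in> set (ws b) \<Longrightarrow> limI W y"
    and ord: "i < j \<Longrightarrow> j < length Bs \<Longrightarrow> y \<in> set (ws (Bs ! i)) \<Longrightarrow> z \<in> set (ws (Bs ! j)) \<Longrightarrow> crel y z"
    and strict: "i < j \<Longrightarrow> j < length Bs \<Longrightarrow> reg (Bs ! i) \<Longrightarrow> reg (Bs ! j) \<Longrightarrow>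
      y \<in> set (ws (Bs ! i)) \<Longrightarrow> z \<in> set (ws (Bs ! j)) \<Longrightarrow> \<not> crel z y"
    and sup: "b \<in> set Bs \<Longrightarrow> ws b = [u] \<Longrightarrow> kd b = KP \<Longrightarrow> u \<noteq> x \<Longrightarrow>
      supported W c (\<Union>b\<in>set Bs. set (ws b)) u"
    and supD: "b \<in> set Bs \<Longrightarrow> y \<in> set (ws b) \<Longrightarrow> \<not> dm W y \<Longrightarrow> b' \<in> set Bs \<Longrightarrow> kd b' = KP \<Longrightarrow> ws b' = [u] \<Longrightarrow>
      lt y u \<Longrightarrow> (\<And>z. z \<in> W \<Longrightarrow> lt y z \<Longrightarrow> lt z u \<Longrightarrow> deep W c z) \<Longrightarrow> kd b = KD"
    and final: "\<exists>b\<in>set Bs. reg b \<and> (\<exists>y\<in>set (ws b). \<forall>z\<in>W. z = y \<or> crel z y)"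
begin

section \<open>Order and truth in a sum of blocks\<close>

definition "N = fst (bmodel Bs)"

definition g :: "nat \<times> point \<Rightarrow> fm set" where
  "g p = bpt (Bs ! fst p) (snd p)"

lemma N_worlds: "p \<in> worlds N \<longleftrightarrow> fst p < length Bs \<and> snd p \<in> bworlds (Bs ! fst p)"
  using worlds_bmodel[of "fst p" "snd p" Bs] by (simp add: N_def)

lemma N_acc: "p \<in> worlds N \<Longrightarrow>
    acc N p p' \<longleftrightarrow> fst p < fst p' \<or> fst p = fst p' \<and> bacc (Bs ! fst p) (snd p) (snd p')"
  using acc_bmodel[of "fst p" Bs "snd p" "fst p'" "snd p'"] by (simp add: N_def N_worlds[unfolded N_def])

lemma N_trans: "p \<in> worlds N \<Longrightarrow> q \<in> worlds N \<Longrightarrow> r \<in> worlds N \<Longrightarrow> acc N p q \<Longrightarrow> acc N q r \<Longrightarrow> acc N p r"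
  using bmodel_total[of Bs] unfolding N_def total_frame_def by blast

lemma N_total: "p \<in> worlds N \<Longrightarrow> q \<in> worlds N \<Longrightarrow> p = q \<or> acc N p q \<or> acc N q p"
  using bmodel_total[of Bs] unfolding N_def total_frame_def by blast

lemma blk: "p \<in> worlds N \<Longrightarrow> Bs ! fst p \<in> set Bs"
  by (simp add: N_worlds)

lemma g_ws: "p \<in> worlds N \<Longrightarrow> g p \<in> set (ws (Bs ! fst p))"
  using ws_ne[OF blk, of p] by (auto simp: N_worlds g_def bpt_def bworlds_def split: if_splits)

lemma g_W: "p \<in> worlds N \<Longrightarrow> g p \<in> W"
  using g_ws ws_W blk by blast

lemma reg_dm:
  assumes "p \<in> worlds N"
  shows "reg (Bs ! fst p) \<longleftrightarrow> dm W (g p)"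
proof
  assume r: "reg (Bs ! fst p)"
  show "dm W (g p)"
  proof (cases "kd (Bs ! fst p) = KP")
    case True
    then show ?thesis using KP[OF blk[OF assms]] g_ws[OF assms] irr_dm g_W[OF assms] by force
  next
    case False
    then show ?thesis using KC[OF blk[OF assms]] g_ws[OF assms] r by blast
  qed
qed (use nreg[OF blk[OF assms]] g_ws[OF assms] in blast)

lemma g_mono:
  assumes "p \<in> worlds N" "q \<in> worlds N" "acc N p q"
  shows "crel (g p) (g q)"
proof (cases "fst p < fst q")
  case True
  then show ?thesis using ord[of "fst p" "fst q"] g_ws assms by (simp add: N_worlds)
next
  case False
  then have e: "fst q = fst p" and b: "bacc (Bs ! fst p) (snd p) (snd q)" using assms N_acc by auto
  have "kd (Bs ! fst p) \<noteq> KP"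
  proof
    assume k: "kd (Bs ! fst p) = KP"
    then obtain u where "ws (Bs ! fst p) = [u]" using KP blk assms by blast
    then have "snd p = PA 0" "snd q = PA 0" using assms e k by (auto simp: N_worlds bworlds_def)
    then show False using b bacc_simps(1)[OF k] by simp
  qed
  then show ?thesis using cluster[OF blk[OF assms(1)]] g_ws assms e by metis
qed

text \<open>Accessibility of canonical points returns to the sum for regular targets, because two
  regular summands never share a cluster. For limit clusters it may fail: b_n does not see the
  a_i.\<close>

lemma acc_regI:
  assumes p: "p \<in> worlds N" and q: "q \<in> worlds N" "reg (Bs ! fst q)" and r: "crel (g p) (g q)"
  shows "acc N p q"
proof -
  consider "fst p < fst q" | "fst p = fst q" | "fst q < fst p" by linarith
  then show ?thesis
  proof cases
    case 2
    have "kd (Bs ! fst q) \<noteq> KP"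
    proof
      assume k: "kd (Bs ! fst q) = KP"
      then obtain u where "ws (Bs ! fst q) = [u]" "\<not> crel u u" using KP blk q by blast
      then show False using g_ws[OF p] g_ws[OF q(1)] 2 r by auto
    qed
    then show ?thesis using 2 q bacc_simps(2) N_acc p by auto
  next
    case 3
    then have "crel (g q) (g p)" using ord[OF 3] g_ws p q by (simp add: N_worlds)
    then have "dm W (g p)" using dm_cluster[OF g_W g_W, OF q(1) p] r reg_dm q by blast
    then have "\<not> crel (g p) (g q)" using strict[OF 3] reg_dm[OF p] q g_ws p by (simp add: N_worlds)
    then show ?thesis using r by blast
  qed (use N_acc p in simp)
qed

lemma lt_acc: "p \<in> worlds N \<Longrightarrow> q \<in> worlds N \<Longrightarrow> lt (g p) (g q) \<Longrightarrow> acc N p q \<and> fst p < fst q"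
proof -
  assume p: "p \<in> worlds N" and q: "q \<in> worlds N" and l: "lt (g p) (g q)"
  have "fst p < fst q"
  proof (rule ccontr)
    assume "\<not> fst p < fst q"
    then consider "fst p = fst q" | "fst q < fst p" by linarith
    then show False
    proof cases
      case 1
      show False
      proof (cases "kd (Bs ! fst q) = KP")
        case True
        then obtain u where "ws (Bs ! fst q) = [u]" using KP blk q by blast
        then show False using g_ws[OF p] g_ws[OF q] 1 l by auto
      next
        case False
        then show False using cluster[OF blk[OF q] False] g_ws[OF p] g_ws[OF q] 1 l by (auto simp: lt_def)
      qed
    next
      case 2
      then have "crel (g q) (g p)" using ord[OF 2] g_ws p q by (simp add: N_worlds)
      then show False using l by (simp add: lt_def)
    qed
  qed
  then show ?thesis using N_acc p by simp
qed

lemma point_of: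
  assumes "b \<in> set Bs" "y \<in> set (ws b)"
  obtains j i where "j < length Bs" "Bs ! j = b" "i < length (ws b)" "ws b ! i = y"
    "(j, PA i) \<in> worlds N" "g (j, PA i) = y"
proof -
  obtain j where j: "j < length Bs" "Bs ! j = b" using assms(1) by (auto simp: in_set_conv_nth)
  obtain i where i: "i < length (ws b)" "ws b ! i = y" using assms(2) by (auto simp: in_set_conv_nth)
  have "(j, PA i) \<in> worlds N" "g (j, PA i) = y" using i j by (auto simp: N_worlds bworlds_def g_def bpt_def)
  then show thesis using that i j by blast
qed

text \<open>For \<open>Dia\<close> a witness in the canonical model has to be turned into a visible
  point of the sum. By \<open>acc_regI\<close> a point of a regular summand is visible from
  everything that should see it, so the hypothesis asks for witnesses there; last points of the
  subformulas will provide them.\<close>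

lemma truth:
  assumes Sub: "\<And>\<psi> y. \<psi> \<in> subfms \<phi> \<Longrightarrow> y \<in> W \<Longrightarrow> \<psi> \<in> y \<Longrightarrow>
      \<exists>b\<in>set Bs. reg b \<and> (\<exists>z\<in>set (ws b). \<psi> \<in> z \<and> (y = z \<or> crel y z))"
    and "\<phi> \<in> Fm X" "p \<in> worlds N"
  shows "holds N (snd (bmodel Bs)) p \<phi> \<longleftrightarrow> \<phi> \<in> g p"
  using assms
proof (induction \<phi> arbitrary: p)
  case (Var n)
  have "p \<in> snd (bmodel Bs) n \<longleftrightarrow> snd p \<in> bval (Bs ! fst p) n"
    unfolding bmodel_val using Var.prems(3) by (cases p) (auto simp: N_worlds)
  then show ?case using bval_iff ws_ne blk Var.prems(3) by (simp add: g_def N_worlds)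
next
  case Top
  then show ?case using mcs_Top[OF W_mcs[OF g_W]] by simp
next
  case Bot
  then show ?case using mcs_Bot[OF W_mcs[OF g_W]] by simp
next
  case (Neg \<phi>)
  have "holds N (snd (bmodel Bs)) p \<phi> \<longleftrightarrow> \<phi> \<in> g p" by (rule Neg.IH) (use Neg.prems in auto)
  then show ?case using mcs_Neg[OF W_mcs[OF g_W]] Neg.prems by simp
next
  case (And \<phi> \<psi>)
  have "holds N (snd (bmodel Bs)) p \<phi> \<longleftrightarrow> \<phi> \<in> g p" by (rule And.IH(1)) (use And.prems in auto)
  moreover have "holds N (snd (bmodel Bs)) p \<psi> \<longleftrightarrow> \<psi> \<in> g p" by (rule And.IH(2)) (use And.prems in auto)
  ultimately show ?case using mcs_And[OF W_mcs[OF g_W]] And.prems by simp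
next
  case (Dia \<phi>)
  have IH: "holds N (snd (bmodel Bs)) q \<phi> \<longleftrightarrow> \<phi> \<in> g q" if "q \<in> worlds N" for q
    by (rule Dia.IH) (use Dia.prems that in auto)
  show ?case
  proof
    assume "holds N (snd (bmodel Bs)) p (Dia \<phi>)"
    then obtain q where "q \<in> worlds N" "acc N p q" "\<phi> \<in> g q" using IH by auto
    then show "Dia \<phi> \<in> g p" using g_mono[OF Dia.prems(3)] by (auto simp: crel_def)
  next
    assume "Dia \<phi> \<in> g p"
    then obtain y where y: "y \<in> W" "crel (g p) y" "\<phi> \<in> y" using W_Dia g_W Dia.prems by blast
    have "\<phi> \<in> subfms (Dia \<phi>)" by (cases \<phi>) auto
    then obtain b z where b: "b \<in> set Bs" "reg b" "z \<in> set (ws b)" "\<phi> \<in> z" "y = z \<or> crel y z"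
      using Dia.prems(1)[OF _ y(1,3)] by blast
    obtain j i where q: "(j, PA i) \<in> worlds N" "g (j, PA i) = z" "Bs ! j = b"
      using point_of[OF b(1,3)] by metis
    have "crel (g p) z" using W_trans g_W[OF Dia.prems(3)] y b by blast
    then have "acc N p (j, PA i)" using acc_regI[OF Dia.prems(3) q(1)] q b by simp
    then show "holds N (snd (bmodel Bs)) p (Dia \<phi>)" using IH[OF q(1)] q b by auto
  qed
qed

end

section \<open>Transfer of refutations\<close>

text \<open>The frame of a canonical formula on the indices of its enumeration, with root
  \<open>0\<close>. That a closed domain \<open>d\<close> is not the root appears as an index other
  than \<open>d\<close> that \<open>d\<close> does not see.\<close>

locale root_order =
  fixes T :: "nat \<Rightarrow> nat \<Rightarrow> bool" and n :: nat and D :: "nat set"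
  assumes T_trans: "i < n \<Longrightarrow> j < n \<Longrightarrow> k < n \<Longrightarrow> T i j \<Longrightarrow> T j k \<Longrightarrow> T i k"
    and T_lin: "i < n \<Longrightarrow> j < n \<Longrightarrow> i \<noteq> j \<Longrightarrow> T i j \<or> T j i"
    and T_root: "0 < j \<Longrightarrow> j < n \<Longrightarrow> T 0 j"
    and n_pos: "0 < n"
    and D_irr: "d \<in> D \<Longrightarrow> d < n \<and> \<not> T d d \<and> (\<exists>e<n. e \<noteq> d \<and> \<not> T d e)"

lemma sorted_enum:
  assumes "finite A" "\<And>a b. a \<in> A \<Longrightarrow> b \<in> A \<Longrightarrow> a \<noteq> b \<Longrightarrow> R a b \<or> R b a"
    "\<And>a b c. a \<in> A \<Longrightarrow> b \<in> A \<Longrightarrow> c \<in> A \<Longrightarrow> R a b \<Longrightarrow> R b c \<Longrightarrow> R a c"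
  shows "\<exists>xs. set xs = A \<and> distinct xs \<and> sorted_wrt R xs"
  using assms
proof (induction A rule: finite_psubset_induct)
  case (psubset A)
  show ?case
  proof (cases "A = {}")
    case False
    have "\<exists>m\<in>B. \<forall>a\<in>B. a \<noteq> m \<longrightarrow> R a m" if "finite B" "B \<noteq> {}" "B \<subseteq> A" for B
      using that
    proof (induction B rule: finite_ne_induct)
      case (insert b B)
      then obtain m where m: "m \<in> B" "\<forall>a\<in>B. a \<noteq> m \<longrightarrow> R a m" by auto
      show ?case
      proof (cases "R b m")
        case True
        then show ?thesis using m by auto
      next
        case False
        then have "R m b" using psubset.prems(1)[of m b] m insert by auto
        then have "\<forall>a\<in>B. R a b" using m insert.prems psubset.prems(2) by (metis insert_subset subsetD)
        then show ?thesis by auto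
      qed
    qed auto
    then obtain m where m: "m \<in> A" "\<forall>a\<in>A. a \<noteq> m \<longrightarrow> R a m" using psubset.hyps False by blast
    have "\<exists>xs. set xs = A - {m} \<and> distinct xs \<and> sorted_wrt R xs"
      by (rule psubset.IH) (use m psubset.prems in blast)+
    then obtain xs where "set xs = A - {m}" "distinct xs" "sorted_wrt R xs" by blast
    then show ?thesis using m by (intro exI[of _ "xs @ [m]"]) (auto simp: sorted_wrt_append)
  qed auto
qed

context canon
begin

definition CF :: "fm set gframe" where
  "CF = \<lparr>worlds = W, acc = crel, internal = {}\<rparr>"

lemma subst_Fm: "(\<And>p. s p \<in> Fm X) \<Longrightarrow> subst s \<phi> \<in> Fm X"
  by (induction \<phi>) auto

text \<open>A valuation by formulas amounts to a substitution. Hence a formula whose substitution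
  instances all lie in \<open>L\<close> cannot be refuted by such a valuation, even where the
  underlying frame refutes it by another one.\<close>

lemma CF_truth:
  assumes s: "\<And>p. s p \<in> Fm X" and "y \<in> W"
  shows "holds CF (\<lambda>p. {z \<in> W. s p \<in> z}) y \<phi> \<longleftrightarrow> subst s \<phi> \<in> y"
  using assms(2)
proof (induction \<phi> arbitrary: y)
  case (Dia \<phi>)
  then show ?case using W_Dia[of y "subst s \<phi>"] by (auto simp: CF_def)
next
  case (Neg \<phi>)
  then show ?case using mcs_Neg[OF W_mcs[OF Neg.prems] subst_Fm[of s \<phi>, OF s]] by simp
next
  case (And \<phi> \<psi>)
  then show ?case
    using mcs_And[OF W_mcs[OF And.prems] subst_Fm[of s \<phi>, OF s] subst_Fm[of s \<psi>, OF s]] by simp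
qed (simp_all add: mcs_Top[OF W_mcs] mcs_Bot[OF W_mcs])

text \<open>The point \<open>i\<close> of the canonical formula is realised by the points that lie between the images of its
  strict predecessors and \<open>Z i\<close> and satisfy the same variables as \<open>Z i\<close>.\<close>

lemma no_embedding:
  assumes "root_order T n D"
    and T: "T = (\<lambda>i j. S (as ! i) (as ! j))" and n: "n = length as"
    and D: "D = {d. d < length as \<and> as ! d \<in> D'}"
    and L: "\<And>s. subst s (canonical_fm S as D') \<in> L"
    and ZW: "\<And>i. i < n \<Longrightarrow> Z i \<in> W" and Zdm: "\<And>i. i < n \<Longrightarrow> dm W (Z i)"
    and ZT: "\<And>i j. i < n \<Longrightarrow> j < n \<Longrightarrow> T i j \<longleftrightarrow> crel (Z i) (Z j)"
    and Zinj: "\<And>i j. i < n \<Longrightarrow> j < n \<Longrightarrow> i \<noteq> j \<Longrightarrow> Z i \<noteq> Z j"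
    and Zfin: "\<exists>i<n. \<forall>y\<in>W. y = Z i \<or> crel y (Z i)"
    and ZD: "\<And>d. d \<in> D \<Longrightarrow> \<exists>e<n. adj W (Z e) (Z d)"
  shows False
proof -
  interpret root_order T n D by fact
  have "\<exists>\<mu>. \<mu> \<in> Fm X \<and> (\<forall>y\<in>W. \<mu> \<in> y \<longleftrightarrow> y = Z i \<or> crel y (Z i))" if i: "i < n" for i
  proof -
    obtain \<mu> where "\<mu> \<in> Fm X" "\<And>y. y \<in> W \<Longrightarrow> \<mu> \<in> y \<longleftrightarrow> y = Z i \<or> crel y (Z i)"
      using le_fm[OF ZW[OF i] Zdm[OF i]] by blast
    then show ?thesis by (intro exI[of _ \<mu>]) simp
  qed
  then obtain \<mu> where \<mu>F: "\<And>i. i < n \<Longrightarrow> \<mu> i \<in> Fm X"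
    and \<mu>: "\<And>i y. i < n \<Longrightarrow> y \<in> W \<Longrightarrow> \<mu> i \<in> y \<longleftrightarrow> y = Z i \<or> crel y (Z i)" by metis
  have "\<exists>\<epsilon>. \<epsilon> \<in> Fm X \<and> (\<forall>y\<in>W. \<epsilon> \<in> y \<longleftrightarrow> (\<not> crel (Z i) (Z i) \<longrightarrow> y = Z i))" if i: "i < n" for i
  proof (cases "crel (Z i) (Z i)")
    case True
    then show ?thesis by (intro exI[of _ Top]) (simp add: mcs_Top[OF W_mcs])
  next
    case False
    obtain \<epsilon> where "\<epsilon> \<in> Fm X" "\<And>y. y \<in> W \<Longrightarrow> \<epsilon> \<in> y \<longleftrightarrow> y = Z i" using irr_fm[OF ZW[OF i] False] by blast
    then show ?thesis using False by (intro exI[of _ \<epsilon>]) simp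
  qed
  then obtain \<epsilon> where \<epsilon>F: "\<And>i. i < n \<Longrightarrow> \<epsilon> i \<in> Fm X"
    and \<epsilon>: "\<And>i y. i < n \<Longrightarrow> y \<in> W \<Longrightarrow> \<epsilon> i \<in> y \<longleftrightarrow> (\<not> crel (Z i) (Z i) \<longrightarrow> y = Z i)" by metis
  \<comment> \<open>\<open>state\<close> selects the point within its cluster, \<epsilon> makes an
    irreflexive image the only solution, \<mu> bounds from above, and the negated \<mu> exclude
    everything up to the strict predecessors.\<close>
  define \<chi> where "\<chi> i = Conj (state (Z i) # \<epsilon> i # \<mu> i #
    map (\<lambda>j. Neg (\<mu> j)) (filter (\<lambda>j. lt (Z j) (Z i)) [0..<n]))" for i
  have \<chi>F: "\<chi> i \<in> Fm X" if "i < n" for i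
    using that \<mu>F \<epsilon>F state_Fm by (auto simp: \<chi>_def)
  have \<chi>: "\<chi> i \<in> y \<longleftrightarrow> (\<forall>p\<in>X. Var p \<in> y \<longleftrightarrow> Var p \<in> Z i) \<and> (\<not> crel (Z i) (Z i) \<longrightarrow> y = Z i) \<and>
      (y = Z i \<or> crel y (Z i)) \<and> (\<forall>j<n. lt (Z j) (Z i) \<longrightarrow> \<not> (y = Z j \<or> crel y (Z j)))"
    if i: "i < n" and y: "y \<in> W" for i y
  proof -
    have F: "set (state (Z i) # \<epsilon> i # \<mu> i # map (\<lambda>j. Neg (\<mu> j)) (filter (\<lambda>j. lt (Z j) (Z i)) [0..<n])) \<subseteq> Fm X"
      using i \<mu>F \<epsilon>F state_Fm by auto
    have "\<chi> i \<in> y \<longleftrightarrow> state (Z i) \<in> y \<and> \<epsilon> i \<in> y \<and> \<mu> i \<in> y \<and> (\<forall>j<n. lt (Z j) (Z i) \<longrightarrow> Neg (\<mu> j) \<in> y)"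
      unfolding \<chi>_def mcs_Conj[OF W_mcs[OF y] F] by auto
    also have "(\<forall>j<n. lt (Z j) (Z i) \<longrightarrow> Neg (\<mu> j) \<in> y) \<longleftrightarrow>
        (\<forall>j<n. lt (Z j) (Z i) \<longrightarrow> \<not> (y = Z j \<or> crel y (Z j)))"
      using mcs_Neg[OF W_mcs[OF y] \<mu>F] \<mu>[OF _ y] by auto
    finally show ?thesis using state_iff[OF y] \<epsilon>[OF i y] \<mu>[OF i y] by simp
  qed
  define s where "s i = (if i < n then Neg (\<chi> i) else Top)" for i
  have sF: "s i \<in> Fm X" for i using \<chi>F by (simp add: s_def)
  define v where "v = (\<lambda>p. {z \<in> W. s p \<in> z})"
  have v: "y \<in> v i \<longleftrightarrow> \<chi> i \<notin> y" if "i < n" "y \<in> W" for i y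
    using that mcs_Neg[OF W_mcs[OF that(2)] \<chi>F[OF that(1)]] by (simp add: v_def s_def)
  have ZZ: "\<chi> i \<in> Z i" if "i < n" for i
    unfolding \<chi>[OF that ZW[OF that]] by (auto simp: lt_def)
  have up: "y \<in> W" if "y \<in> up CF (Z 0)" for y using that by (auto simp: up_def CF_def)
  have le: "y = Z i \<or> crel y (Z i)" if "i < n" "y \<in> W" "\<chi> i \<in> y" for y i using \<chi> that by blast
  have notle: "\<not> (y = Z j \<or> crel y (Z j))" if "i < n" "j < n" "y \<in> W" "\<chi> i \<in> y" "lt (Z j) (Z i)" for y i j
    using \<chi> that by blast
  have irr: "y = Z i" if "i < n" "y \<in> W" "\<chi> i \<in> y" "\<not> crel (Z i) (Z i)" for y i using \<chi> that by blast
  have "refutes CF v (Z 0) T n D"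
    unfolding refutes_def
  proof (intro conjI allI impI ballI)
    show "Z 0 \<notin> v 0" using v ZZ ZW n_pos by blast
  next
    fix i j y assume *: "i < n" "j < n" "T i j" "y \<in> up CF (Z 0)" "y \<notin> v i"
    then have "\<chi> i \<in> y" "y \<in> W" using v up by blast+
    then have "crel y (Z j)" using le * ZT W_trans by blast
    then show "\<exists>z\<in>worlds CF. acc CF y z \<and> z \<notin> v j" using v ZZ ZW * by (auto simp: CF_def)
  next
    fix i y k z assume *: "i < n" "y \<in> up CF (Z 0)" "y \<notin> v i" "k < n" "\<not> T i k" "z \<in> worlds CF" "acc CF y z"
    then have y: "\<chi> i \<in> y" "y \<in> W" "z \<in> W" "crel y z" using v up by (auto simp: CF_def)
    show "z \<in> v k"
    proof (rule ccontr)
      assume "z \<notin> v k"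
      then have z: "\<chi> k \<in> z" using v * y by blast
      show False
      proof (cases "i = k")
        case True
        then have "\<not> crel (Z i) (Z i)" using * ZT by blast
        then show False using irr y z * True by blast
      next
        case False
        then have "lt (Z k) (Z i)" using T_lin[of i k] * ZT by (auto simp: lt_def)
        moreover have "crel y (Z k)" using le[OF _ y(3) z] * y W_trans by blast
        ultimately show False using notle y * by blast
      qed
    qed
  next
    fix i y j assume *: "i < n" "y \<in> up CF (Z 0)" "y \<notin> v i" "j < n" "j \<noteq> i"
    then have y: "\<chi> i \<in> y" "y \<in> W" using v up by auto
    show "y \<in> v j"
    proof (rule ccontr)
      assume "y \<notin> v j"
      then have j: "\<chi> j \<in> y" using v * y by blast
      have "\<not> lt (Z i) (Z j)" "\<not> lt (Z j) (Z i)" using notle le y j * by blast+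
      then have "crel (Z i) (Z j)" "crel (Z j) (Z i)"
        using W_cases[OF ZW ZW, of i j] Zinj[of i j] * by auto
      moreover have "Var p \<in> Z i \<longleftrightarrow> Var p \<in> Z j" if "p \<in> X" for p using \<chi> y j * that by blast
      ultimately have "Z i = Z j" using cluster_eq ZW * by blast
      then show False using Zinj * by blast
    qed
  next
    fix d y z
    assume *: "d \<in> D" "y \<in> up CF (Z 0)"
      "\<forall>i<n. i \<noteq> d \<longrightarrow> \<not> T d i \<longrightarrow> (\<forall>z\<in>worlds CF. acc CF y z \<longrightarrow> z \<in> v i)" "\<forall>i<n. y \<in> v i"
      "z \<in> worlds CF" "acc CF y z"
    have d: "d < n" "\<not> crel (Z d) (Z d)" using D_irr[OF *(1)] ZT by auto
    have y: "y \<in> W" "z \<in> W" "crel y z" using * up by (auto simp: CF_def)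
    obtain e where e: "e < n" "adj W (Z e) (Z d)" using ZD * by blast
    show "z \<in> v d"
    proof (rule ccontr)
      assume "z \<notin> v d"
      then have z: "z = Z d" using irr d v y by blast
      \<comment> \<open>A point that realises no index, sees the image of \<open>d\<close> and does
        not see the image of \<open>e\<close> would lie strictly between these two images, which are
        adjacent.\<close>
      have "e \<noteq> d" "\<not> T d e" using e d ZT by (auto simp: adj_def lt_def)
      then have ne: "\<not> crel y (Z e)" using *(3)[rule_format, of e "Z e"] e(1) ZW[OF e(1)] v[OF e(1)] ZZ[OF e(1)]
        unfolding CF_def by auto
      moreover have "y \<noteq> Z e" using *(4) e v ZW ZZ by blast
      ultimately have "lt (Z e) y" using W_linear[OF y(1) ZW[OF e(1)]] by (auto simp: lt_def)
      moreover have "lt y (Z d)" using y z d W_trans[OF ZW[OF d(1)], of y "Z d"] by (auto simp: lt_def)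
      ultimately show False using e y by (auto simp: adj_def)
    qed
  next
    fix y assume y: "y \<in> up CF (Z 0)"
    obtain i where i: "i < n" "\<forall>y\<in>W. y = Z i \<or> crel y (Z i)" using Zfin by blast
    then show "\<exists>i<n. y \<notin> v i \<or> (\<exists>z\<in>worlds CF. acc CF y z \<and> z \<notin> v i)"
      using up[OF y] v[OF i(1) ZW[OF i(1)]] ZZ[OF i(1)] ZW[OF i(1)] by (auto simp: CF_def intro!: exI[of _ i])
  qed
  then have "\<not> holds CF v (Z 0) (canonical_fm S as D')"
    using canonical_fm_refutes[of "Z 0" CF v S as D'] ZW[OF n_pos] unfolding T n D by (simp add: CF_def)
  then have "subst s (canonical_fm S as D') \<notin> Z 0"
    using CF_truth[of s, OF sF ZW[OF n_pos]] unfolding v_def by blast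
  then show False using mcs_L[OF W_mcs[OF ZW[OF n_pos]] subst_Fm[of s, OF sF] L] by blast
qed

end

locale refutation = blocks + root_order T n D for T n D +
  fixes v :: "nat \<Rightarrow> (nat \<times> point) set" and r
  assumes n_le: "n \<le> c"
    and v_int: "\<And>p. v p \<in> internal N"
    and r: "r \<in> worlds N"
    and ref: "refutes N v r T n D"
begin

section \<open>Last realisers of the indices\<close>

definition Xs :: "nat \<Rightarrow> (nat \<times> point) set" where
  "Xs i = {p \<in> up N r. p \<notin> v i}"

definition npt :: "nat \<times> point \<Rightarrow> bool" where
  "npt p \<longleftrightarrow> p \<in> worlds N \<and> (reg (Bs ! fst p) \<or> (\<exists>m. snd p = PB m))"

lemma up_N: "p \<in> up N r \<Longrightarrow> p \<in> worlds N"
  by (auto simp: up_def)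

lemma up_acc: "p \<in> up N r \<Longrightarrow> q \<in> worlds N \<Longrightarrow> acc N p q \<Longrightarrow> q \<in> up N r"
  using N_trans[OF r] unfolding up_def by blast

lemma ref_parts:
  "\<forall>i<n. \<forall>j<n. T i j \<longrightarrow> (\<forall>y\<in>up N r. y \<notin> v i \<longrightarrow> (\<exists>z\<in>worlds N. acc N y z \<and> z \<notin> v j))"
  "\<forall>i<n. \<forall>y\<in>up N r. y \<notin> v i \<longrightarrow>
     (\<forall>k<n. \<not> T i k \<longrightarrow> (\<forall>z\<in>worlds N. acc N y z \<longrightarrow> z \<in> v k)) \<and> (\<forall>j<n. j \<noteq> i \<longrightarrow> y \<in> v j)"
  "\<forall>d\<in>D. \<forall>y\<in>up N r.
     (\<forall>i<n. i \<noteq> d \<longrightarrow> \<not> T d i \<longrightarrow> (\<forall>z\<in>worlds N. acc N y z \<longrightarrow> z \<in> v i)) \<longrightarrow>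
     (\<forall>i<n. y \<in> v i) \<longrightarrow> (\<forall>z\<in>worlds N. acc N y z \<longrightarrow> z \<in> v d)"
  "\<forall>y\<in>up N r. \<exists>i<n. y \<notin> v i \<or> (\<exists>z\<in>worlds N. acc N y z \<and> z \<notin> v i)"
proof -
  note p = ref[unfolded refutes_def]
  note p = p[THEN conjunct2]
  show "\<forall>i<n. \<forall>j<n. T i j \<longrightarrow> (\<forall>y\<in>up N r. y \<notin> v i \<longrightarrow> (\<exists>z\<in>worlds N. acc N y z \<and> z \<notin> v j))"
    using p by (rule conjunct1)
  note p = p[THEN conjunct2]
  show "\<forall>i<n. \<forall>y\<in>up N r. y \<notin> v i \<longrightarrow>
     (\<forall>k<n. \<not> T i k \<longrightarrow> (\<forall>z\<in>worlds N. acc N y z \<longrightarrow> z \<in> v k)) \<and> (\<forall>j<n. j \<noteq> i \<longrightarrow> y \<in> v j)"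
    using p by (rule conjunct1)
  note p = p[THEN conjunct2]
  show "\<forall>d\<in>D. \<forall>y\<in>up N r.
     (\<forall>i<n. i \<noteq> d \<longrightarrow> \<not> T d i \<longrightarrow> (\<forall>z\<in>worlds N. acc N y z \<longrightarrow> z \<in> v i)) \<longrightarrow>
     (\<forall>i<n. y \<in> v i) \<longrightarrow> (\<forall>z\<in>worlds N. acc N y z \<longrightarrow> z \<in> v d)"
    using p by (rule conjunct1)
  show "\<forall>y\<in>up N r. \<exists>i<n. y \<notin> v i \<or> (\<exists>z\<in>worlds N. acc N y z \<and> z \<notin> v i)"
    using p by (rule conjunct2)
qed

lemma Xs_iff: "p \<in> Xs i \<longleftrightarrow> p \<in> up N r \<and> p \<notin> v i"
  by (simp add: Xs_def)

lemma ref1: "i < n \<Longrightarrow> j < n \<Longrightarrow> T i j \<Longrightarrow> p \<in> Xs i \<Longrightarrow> \<exists>q\<in>Xs j. acc N p q"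
  using ref_parts(1) up_acc unfolding Bex_def Xs_iff by meson

lemma ref2: "i < n \<Longrightarrow> k < n \<Longrightarrow> p \<in> Xs i \<Longrightarrow> q \<in> Xs k \<Longrightarrow> acc N p q \<Longrightarrow> T i k"
  using ref_parts(2) up_N unfolding Xs_iff by meson

lemma ref3: "i < n \<Longrightarrow> j < n \<Longrightarrow> p \<in> Xs i \<Longrightarrow> p \<in> Xs j \<Longrightarrow> i = j"
  using ref_parts(2) unfolding Xs_iff by meson

lemma ref4: 
  assumes "d \<in> D" "p \<in> up N r" "q \<in> Xs d" "acc N p q"
  obtains i where "i < n" "p \<in> Xs i" | i q' where "i < n" "i \<noteq> d" "\<not> T d i" "q' \<in> Xs i" "acc N p q'"
proof -
  have q: "q \<in> worlds N" "q \<notin> v d" using assms(3) up_N by (auto simp: Xs_def)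
  have "(\<forall>i<n. i \<noteq> d \<longrightarrow> \<not> T d i \<longrightarrow> (\<forall>z\<in>worlds N. acc N p z \<longrightarrow> z \<in> v i)) \<longrightarrow>
      (\<forall>i<n. p \<in> v i) \<longrightarrow> (\<forall>z\<in>worlds N. acc N p z \<longrightarrow> z \<in> v d)"
    using ref_parts(3) assms(1,2) by meson
  then consider "\<exists>i<n. p \<notin> v i" |
      "\<exists>i<n. i \<noteq> d \<and> \<not> T d i \<and> (\<exists>z\<in>worlds N. acc N p z \<and> z \<notin> v i)"
    using q assms(4) by blast
  then show thesis
  proof cases
    case 1
    then show ?thesis using that(1) assms(2) by (auto simp: Xs_def)
  next
    case 2
    then obtain i z where "i < n" "i \<noteq> d" "\<not> T d i" "z \<in> worlds N" "acc N p z" "z \<notin> v i" by blast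
    then show ?thesis using that(2)[of i z] up_acc[OF assms(2)] by (simp add: Xs_iff)
  qed
qed

lemma ref5: "p \<in> up N r \<Longrightarrow> \<exists>i<n. \<exists>q\<in>Xs i. q = p \<or> acc N p q"
proof -
  assume p: "p \<in> up N r"
  then obtain i where i: "i < n" "p \<notin> v i \<or> (\<exists>z\<in>worlds N. acc N p z \<and> z \<notin> v i)" using ref_parts(4) by blast
  then show ?thesis using up_acc[OF p] p unfolding Bex_def Xs_iff by blast
qed

lemma Xs_ne: "i < n \<Longrightarrow> Xs i \<noteq> {}"
proof -
  assume i: "i < n"
  have r0: "r \<in> Xs 0" using ref r by (auto simp: refutes_def Xs_def up_def)
  then show ?thesis using ref1[OF n_pos i _ r0] T_root i by (cases "i = 0") auto
qed

text \<open>As \<open>v\<close> is internal, the limit cluster of an infinite summand never contains all maximal points.\<close>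

lemma Xs_max:
  assumes "i < n"
  shows "\<exists>p\<in>Xs i. npt p \<and> (\<forall>q\<in>Xs i. acc N p q \<longrightarrow> acc N q p)"
proof -
  have "fst ` Xs i \<subseteq> {..<length Bs}" using up_N by (auto simp: Xs_def N_worlds)
  then have fin: "finite (fst ` Xs i)" using finite_subset by blast
  define j where "j = Max (fst ` Xs i)"
  have "j \<in> fst ` Xs i" unfolding j_def using Max_in[OF fin] Xs_ne[OF assms] by blast
  then obtain p where p: "p \<in> Xs i" "fst p = j" by blast
  have jmax: "fst q \<le> j" if "q \<in> Xs i" for q using fin that by (simp add: j_def)
  have pN: "p \<in> worlds N" using p up_N by (auto simp: Xs_def)
  have same: "fst q = j" if "q \<in> Xs i" "fst p' = j" "p' \<in> worlds N" "acc N p' q" for q p'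
    using jmax[OF that(1)] N_acc[OF that(3)] that by auto
  show ?thesis
  proof (cases "reg (Bs ! j)")
    case True
    have "acc N q p" if q: "q \<in> Xs i" "acc N p q" for q
    proof -
      have qN: "q \<in> worlds N" using q up_N by (auto simp: Xs_def)
      have e: "fst q = j" using same[OF q(1) p(2) pN q(2)] .
      have b: "bacc (Bs ! j) (snd p) (snd q)" using N_acc[OF pN] q e p by auto
      have "kd (Bs ! j) \<noteq> KP"
      proof
        assume k: "kd (Bs ! j) = KP"
        then obtain u where "ws (Bs ! j) = [u]" using KP blk[OF pN] p by metis
        then have "snd p = PA 0" "snd q = PA 0" using pN qN e k p by (auto simp: N_worlds bworlds_def)
        then show False using b bacc_simps(1)[OF k] by simp
      qed
      then show ?thesis using True bacc_simps(2) N_acc[OF qN] e p by auto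
    qed
    then show ?thesis using p pN True by (auto simp: npt_def)
  next
    case False
    let ?b = "Bs ! j" and ?k = "length (ws (Bs ! j))"
    have jl: "j < length Bs" using pN p by (simp add: N_worlds)
    have k: "0 < ?k" using ws_ne blk[OF pN] p by auto
    have B: "(j, PB m) \<in> worlds N" for m using jl False by (simp add: N_worlds bworlds_def)
    have "\<exists>m. (j, PB m) \<in> Xs i"
    proof (cases "snd p")
      case (PB m)
      then show ?thesis using p by (metis prod.collapse)
    next
      case (PA a)
      have a: "a < ?k" using pN p PA False by (auto simp: N_worlds bworlds_def)
      \<comment> \<open>If an a-point realises the index, then so do all b-points of its class far
        enough out.\<close>
      obtain Z where Z: "v i = (SIGMA j:{..<length Bs}. Z j)"
          "\<forall>j<length Bs. Z j \<in> internal (atomic_frame (atom (Bs ! j)))"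
        using v_int[of i] unfolding N_def bmodel_fst osum_frame_def by auto
      obtain rf where rf: "atomic_frame (atom ?b) = C_frame rf ?k"
        using False by (cases "kd ?b") (auto simp: atom_def)
      obtain m where m: "\<forall>l\<ge>m. PB l \<in> Z j \<longleftrightarrow> PA (l mod ?k) \<in> Z j"
        using internal_C_eventually[of "Z j" rf ?k] Z(2)[rule_format, OF jl] k unfolding rf by blast
      have "PA a \<notin> Z j" using p PA jl by (cases p) (auto simp: Xs_def Z(1))
      moreover have "1 * m \<le> ?k * m" using Suc_leI[OF k] by (intro mult_le_mono1) simp
      then have "a + ?k * m \<ge> m" by linarith
      ultimately have "PB (a + ?k * m) \<notin> Z j" using m a by auto
      then have "(j, PB (a + ?k * m)) \<notin> v i" by (simp add: Z(1))
      moreover have "acc N p (j, PB (a + ?k * m))" using N_acc[OF pN] p PA False bacc_simps(3) by simp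
      ultimately show ?thesis using up_acc[of p] p(1) B by (auto simp: Xs_def)
    qed
    \<comment> \<open>Among the b-points smaller numbers come later in the order, so the least
      number gives the last realiser.\<close>
    then obtain m where m: "(j, PB m) \<in> Xs i" "\<And>l. l < m \<Longrightarrow> (j, PB l) \<notin> Xs i"
      using exists_least_iff[of "\<lambda>m. (j, PB m) \<in> Xs i"] by blast
    have "acc N q (j, PB m)" if q: "q \<in> Xs i" "acc N (j, PB m) q" for q
    proof -
      have e: "fst q = j" using same[OF q(1) _ B q(2)] by simp
      then have b: "bacc ?b (PB m) (snd q)" using N_acc[OF B] q by auto
      then obtain l where l: "snd q = PB l" using bacc_simps(4)[OF False] by (cases "snd q") auto
      have "l \<le> m" using b l False bacc_simps(5,6)[of ?b m l] by (cases "kd ?b") auto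
      moreover have "\<not> l < m" using m(2) q e l by (metis prod.collapse)
      ultimately have "q = (j, PB m)" using e l by (metis le_neq_implies_less prod.collapse)
      then show ?thesis using q by simp
    qed
    moreover have "npt (j, PB m)" using B by (simp add: npt_def)
    ultimately show ?thesis using m(1) by blast
  qed
qed

definition h :: "nat \<Rightarrow> nat \<times> point" where
  "h i = (SOME p. p \<in> Xs i \<and> npt p \<and> (\<forall>q\<in>Xs i. acc N p q \<longrightarrow> acc N q p))"

lemma h: "i < n \<Longrightarrow> h i \<in> Xs i" "i < n \<Longrightarrow> npt (h i)"
  "i < n \<Longrightarrow> q \<in> Xs i \<Longrightarrow> acc N (h i) q \<Longrightarrow> acc N q (h i)"
  using someI_ex[of "\<lambda>p. p \<in> Xs i \<and> npt p \<and> (\<forall>q\<in>Xs i. acc N p q \<longrightarrow> acc N q p)"] Xs_max[of i]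
  unfolding h_def by blast+

lemma h_N: "i < n \<Longrightarrow> h i \<in> worlds N"
  using h(2) by (auto simp: npt_def)

lemma h_last: "i < n \<Longrightarrow> q \<in> Xs i \<Longrightarrow> q = h i \<or> acc N q (h i)"
  using N_total[of q "h i"] h(3) h_N up_N unfolding Xs_iff by blast

lemma h_see: "i < n \<Longrightarrow> q \<in> Xs i \<Longrightarrow> p \<in> worlds N \<Longrightarrow> acc N p q \<Longrightarrow> acc N p (h i)"
  using h_last[of i q] N_trans[of p q "h i"] h_N up_N unfolding Xs_iff by blast

text \<open>Passing from any realiser to the last one keeps it visible (\<open>h_see\<close>), so
  the last realisers alone reproduce \<open>T\<close>.\<close>

lemma h_T: "i < n \<Longrightarrow> j < n \<Longrightarrow> T i j \<longleftrightarrow> acc N (h i) (h j)"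
  using ref1[of i j "h i"] ref2[of i j "h i" "h j"] h_see[of j _ "h i"] h(1) h_N by blast

lemma h_inj: "i < n \<Longrightarrow> j < n \<Longrightarrow> i \<noteq> j \<Longrightarrow> h i \<noteq> h j"
  using ref3 h(1) by metis

text \<open>A regular summand contains a point of the last canonical cluster, and every other point
  of the sum sees it. By cofinality this point realises an index or sees a realiser, and a last
  realiser found from there is in the same cluster.\<close>

lemma h_final: "\<exists>i<n. reg (Bs ! fst (h i)) \<and> (\<forall>z\<in>W. z = g (h i) \<or> crel z (g (h i)))"
proof -
  obtain b y where b: "b \<in> set Bs" "reg b" "y \<in> set (ws b)" "\<forall>z\<in>W. z = y \<or> crel z y"
    using final by blast
  obtain j i0 where l: "(j, PA i0) \<in> worlds N" "g (j, PA i0) = y" "Bs ! j = b"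
    using point_of[OF b(1,3)] by metis
  let ?l = "(j, PA i0)"
  have see: "p = ?l \<or> acc N p ?l" if p: "p \<in> worlds N" for p
  proof -
    have "p = ?l \<or> acc N p ?l \<or> crel (g p) (g ?l)"
      using N_total[OF p l(1)] g_mono[OF l(1) p] b(4) g_W[OF p] l(2) by metis
    then show ?thesis using acc_regI[OF p l(1)] b l by auto
  qed
  then have "?l \<in> up N r" using l(1) r unfolding up_def by blast
  then obtain i q where i: "i < n" "q \<in> Xs i" "q = ?l \<or> acc N ?l q" using ref5 by blast
  then have hi: "h i = ?l \<or> acc N ?l (h i)" using h_last[OF i(1,2)] h_see[OF i(1,2) l(1)] by metis
  show ?thesis
  proof (cases "h i = ?l")
    case True
    then have "fst (h i) = j" "g (h i) = y" using l(2) by simp_all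
    then show ?thesis using i(1) b(2,4) l(3) by blast
  next
    case False
    then have a: "acc N ?l (h i)" "acc N (h i) ?l" using hi see h_N[OF i(1)] by blast+
    then have c: "crel y (g (h i))" "crel (g (h i)) y" using g_mono l h_N[OF i(1)] by metis+
    have yW: "y \<in> W" using b ws_W by blast
    have "dm W y" using reg_dm[OF l(1)] b l by simp
    then have "reg (Bs ! fst (h i))" using dm_cluster[OF yW g_W[OF h_N[OF i(1)]] c] reg_dm[OF h_N[OF i(1)]] by blast
    moreover have "z = g (h i) \<or> crel z (g (h i))" if "z \<in> W" for z
      using b(4) that c W_trans by metis
    ultimately show ?thesis using i by blast
  qed
qed

text \<open>The closed domain clause at \<open>z\<close> gives two cases: \<open>z\<close> realises
  an index below \<open>d\<close>, or it sees a realiser of an index other than \<open>d\<close>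
  that \<open>d\<close> does not see. Either way this index is \<open>e\<close> or sees
  \<open>e\<close>, so \<open>z\<close> realises \<open>e\<close> or sees a realiser of
  \<open>e\<close>. Thus nothing lies strictly between \<open>h e\<close> and
  \<open>h d\<close>.\<close>

lemma h_gap:
  assumes d: "d \<in> D" and e: "e < n" and "\<And>b. b < n \<Longrightarrow> b \<noteq> d \<Longrightarrow> T b d \<Longrightarrow> b = e \<or> T b e"
    and z: "z \<in> worlds N" "acc N (h e) z" "acc N z (h d)"
  shows "acc N z (h e)"
proof -
  have dn: "d < n" "\<not> T d d" using D_irr d by auto
  have zu: "z \<in> up N r" using up_acc[OF _ z(1,2)] h(1)[OF e] by (simp add: Xs_def)
  have *: "acc N z (h e)" if q: "q \<in> Xs i" "q = z \<or> acc N z q" and i: "i < n" "i = e \<or> T i e" for q i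
  proof -
    have qN: "q \<in> worlds N" using q up_N by (auto simp: Xs_def)
    obtain q' where q': "q' \<in> Xs e" "q' = q \<or> acc N q q'" using i ref1[OF i(1) e _ q(1)] q by blast
    then have q'N: "q' \<in> worlds N" using up_N by (auto simp: Xs_def)
    have "q' = z \<or> acc N z q'" using q' q N_trans[OF z(1) qN q'N] by auto
    then show ?thesis
      using h_see[OF e q'(1) z(1)] h(3)[OF e, of z] z q' by blast
  qed
  from ref4[OF d zu h(1)[OF dn(1)] z(3)] show ?thesis
  proof cases
    case (1 i)
    have "T i d" using ref2[OF 1(1) dn(1) 1(2) h(1)[OF dn(1)] z(3)] .
    then show ?thesis using *[OF 1(2)] 1 assms(3)[of i] dn by auto
  next
    case (2 i q')
    have "T i d" using T_lin[of i d] 2 dn by blast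
    then show ?thesis using *[OF 2(4)] 2 assms(3)[of i] by auto
  qed
qed

text \<open>\<open>Inv i p z\<close> says that \<open>z\<close> may replace the point \<open>p\<close> of the ordered sum in the canonical model when
  at most \<open>i\<close> points of the refuting chain remain to be placed below it.\<close>

definition Inv :: "nat \<Rightarrow> nat \<times> point \<Rightarrow> fm set \<Rightarrow> bool" where
  "Inv i p z \<longleftrightarrow> z \<in> W \<and> (case kd (Bs ! fst p) of
      KP \<Rightarrow> z = g p \<or> lt (g p) z \<and> deep W i z \<and> deep W i (g p)
    | KC \<Rightarrow> z = g p
    | KD \<Rightarrow> lt (g p) z \<and> deep W i z
    | KO \<Rightarrow> lt (g p) z \<and> crel z z \<and> dm W z)"

section \<open>Replacing the points of a refutation one at a time\<close>

lemma npt_N: "npt p \<Longrightarrow> p \<in> worlds N"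
  by (simp add: npt_def)

lemma Inv_W: "Inv i p z \<Longrightarrow> z \<in> W"
  by (simp add: Inv_def)

lemma Inv_reg: "npt p \<Longrightarrow> reg (Bs ! fst p) \<Longrightarrow> Inv i p (g p)"
  using g_W[OF npt_N] by (auto simp: Inv_def)

lemma Inv_le:
  "Inv i p z \<Longrightarrow> z = g p \<or> lt (g p) z" "Inv i p z \<Longrightarrow> \<not> reg (Bs ! fst p) \<Longrightarrow> lt (g p) z"
  by (cases "kd (Bs ! fst p)"; auto simp: Inv_def)+

lemma KP_irr: "p \<in> worlds N \<Longrightarrow> kd (Bs ! fst p) = KP \<Longrightarrow> \<not> crel (g p) (g p) \<and> ws (Bs ! fst p) = [g p]"
  using KP[OF blk] g_ws by fastforce

lemma not_KP_refl: "p \<in> worlds N \<Longrightarrow> kd (Bs ! fst p) \<noteq> KP \<Longrightarrow> crel (g p) (g p)"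
  using cluster[OF blk] g_ws by blast

lemma Inv_dm: "npt p \<Longrightarrow> Inv i p z \<Longrightarrow> dm W z"
  using reg_dm[OF npt_N, of p] irr_dm[of z] deep_irrefl[of W i z]
  by (cases "kd (Bs ! fst p)") (auto simp: Inv_def)

lemma Inv_refl:
  assumes p: "npt p" and I: "Inv i p z"
  shows "acc N p p \<longleftrightarrow> crel z z"
proof -
  have pN: "p \<in> worlds N" using p npt_N by blast
  have a: "acc N p p \<longleftrightarrow> bacc (Bs ! fst p) (snd p) (snd p)" using N_acc[OF pN] by simp
  show ?thesis
  proof (cases "kd (Bs ! fst p)")
    case KP
    then have "snd p = PA 0" using KP_irr[OF pN KP] pN by (auto simp: N_worlds bworlds_def)
    then show ?thesis using a bacc_simps(1)[OF KP] KP I KP_irr[OF pN KP] deep_irrefl by (auto simp: Inv_def)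
  next
    case KC
    then show ?thesis using a bacc_simps(2)[OF KC] I not_KP_refl[OF pN] by (auto simp: Inv_def)
  next
    case KD
    then obtain m where "snd p = PB m" using p by (auto simp: npt_def)
    then show ?thesis using a bacc_simps(5)[OF KD] I KD deep_irrefl by (auto simp: Inv_def)
  next
    case KO
    then obtain m where "snd p = PB m" using p by (auto simp: npt_def)
    then show ?thesis using a bacc_simps(6)[OF KO] I KO by (auto simp: Inv_def)
  qed
qed

text \<open>Distinct b-points see each other in one direction only, and \<open>npt\<close> excludes
  the a-points of infinite summands, so only finite clusters remain.\<close>

lemma mutual:
  assumes p: "npt p" "npt q" and a: "acc N p q" "acc N q p" and "p \<noteq> q"
  shows "kd (Bs ! fst p) = KC \<and> fst p = fst q"
proof -
  have N: "p \<in> worlds N" "q \<in> worlds N" using p npt_N by auto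
  from a have "fst p < fst q \<or> fst p = fst q \<and> bacc (Bs ! fst p) (snd p) (snd q)"
    "fst q < fst p \<or> fst q = fst p \<and> bacc (Bs ! fst q) (snd q) (snd p)"
    by (simp_all only: N_acc[OF N(1)] N_acc[OF N(2)])
  then have e: "fst p = fst q" and b: "bacc (Bs ! fst p) (snd p) (snd q)" "bacc (Bs ! fst p) (snd q) (snd p)"
    by auto
  show ?thesis
  proof (cases "kd (Bs ! fst p)")
    case KP
    then have "snd p = PA 0" "snd q = PA 0" using KP_irr[OF N(1) KP] N e by (auto simp: N_worlds bworlds_def)
    then show ?thesis using b bacc_simps(1)[OF KP] by simp
  next
    case KD
    then obtain m l where "snd p = PB m" "snd q = PB l" using p e by (auto simp: npt_def)
    then show ?thesis using b bacc_simps(5)[OF KD] by auto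
  next
    case KO
    then obtain m l where "snd p = PB m" "snd q = PB l" using p e by (auto simp: npt_def)
    then show ?thesis using b bacc_simps(6)[OF KO] e assms(5) by (metis le_antisym prod.collapse)
  qed (use e in simp)
qed

lemma KC_inj:
  assumes "p \<in> worlds N" "q \<in> worlds N" "fst p = fst q" "kd (Bs ! fst p) = KC" "p \<noteq> q"
  shows "g p \<noteq> g q"
proof -
  obtain i j where "snd p = PA i" "snd q = PA j" "i < length (ws (Bs ! fst p))" "j < length (ws (Bs ! fst p))"
    using assms by (auto simp: N_worlds bworlds_def)
  moreover from this have "i \<noteq> j" using assms by (metis prod.collapse)
  ultimately show ?thesis using ws_dist[OF blk[OF assms(1)]] assms(3)
    by (simp add: g_def bpt_def nth_eq_iff_index_eq)
qed

lemma Inv_step_same: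
  assumes "npt p" "npt q" "acc N p q" "acc N q p" "p \<noteq> q" "Inv k q z"
  shows "\<exists>z'. Inv i p z' \<and> crel z' z \<and> crel z z'"
proof -
  have k: "kd (Bs ! fst p) = KC" "fst p = fst q" using mutual[OF assms(1-5)] by blast+
  then have "z = g q" using assms(6) by (simp add: Inv_def)
  moreover have "crel (g p) (g q)" "crel (g q) (g p)"
    using g_mono[OF npt_N npt_N, OF assms(1,2,3)] g_mono[OF npt_N npt_N, OF assms(2,1,4)] .
  ultimately show ?thesis using Inv_reg[OF assms(1)] k by auto
qed

text \<open>If \<open>q\<close> is regular, its canonical point is already strictly after that of
  \<open>p\<close>. If not, the two may share a cluster, and strictness comes from the replacement
  \<open>z\<close>, which lies beyond that cluster.\<close>

lemma Inv_lt:
  assumes p: "npt p" "npt q" and a: "acc N p q" "\<not> acc N q p" and I: "Inv k q z"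
  shows "lt (g p) z"
proof -
  have N: "p \<in> worlds N" "q \<in> worlds N" using p npt_N by auto
  have c: "crel (g p) (g q)" using g_mono[OF N a(1)] .
  show ?thesis
  proof (cases "reg (Bs ! fst q)")
    case True
    have "\<not> crel (g q) (g p)"
    proof
      assume c': "crel (g q) (g p)"
      have "dm W (g p)" using dm_cluster[OF g_W g_W, OF N(2) N(1) c' c] reg_dm[OF N(2)] True by blast
      then have "acc N q p" using acc_regI[OF N(2) N(1) _ c'] reg_dm[OF N(1)] by blast
      then show False using a by blast
    qed
    then have "lt (g p) (g q)" using c by (simp add: lt_def)
    then show ?thesis using Inv_le(1)[OF I] lt_trans[OF g_W[OF N(1)] g_W[OF N(2)] Inv_W[OF I]] by auto
  next
    case False
    then show ?thesis using Inv_le(2)[OF I False] crel_lt_trans[OF g_W[OF N(1)] g_W[OF N(2)] Inv_W[OF I] c] by blast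
  qed
qed

text \<open>Points of the sort prescribed for a limit summand occur arbitrarily close to the limit,
  so one of them fits before \<open>z\<close>.\<close>

lemma Inv_step:
  assumes p: "npt p" and z: "z \<in> W" "lt (g p) z" and i: "i \<le> c"
  shows "\<exists>z'. Inv i p z' \<and> lt z' z"
proof (cases "reg (Bs ! fst p)")
  case True
  then show ?thesis using Inv_reg[OF p] z by blast
next
  case False
  have pN: "p \<in> worlds N" using p npt_N by blast
  show ?thesis
  proof (cases "kd (Bs ! fst p) = KD")
    case True
    then have "limD W c (g p)" using KD[OF blk[OF pN]] g_ws[OF pN] by blast
    then obtain y where "y \<in> W" "lt (g p) y" "lt y z" "deep W c y" using z by (auto simp: limD_def)
    then show ?thesis using deep_antimono i True by (auto simp: Inv_def)
  next
    case KO': False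
    then have k: "kd (Bs ! fst p) = KO" using False by (cases "kd (Bs ! fst p)") auto
    then have "limI W (g p)" using KO[OF blk[OF pN]] g_ws[OF pN] by blast
    then obtain y where "y \<in> W" "lt (g p) y" "lt y z" "crel y y" "dm W y" using z by (auto simp: limI_def)
    then show ?thesis using k by (auto simp: Inv_def)
  qed
qed

lemma le_adj:
  assumes "e \<in> W" "lt e z" "z' \<in> W" "adj W z' z" "\<not> crel z' z'"
  shows "e = z' \<or> lt e z'"
  using W_cases[OF assms(1,3)] assms W_trans[OF assms(3)] unfolding adj_def by blast

text \<open>At a closed domain the new image must be an immediate predecessor of \<open>z\<close>;
  one unit of depth is spent on it, which is why \<open>Inv\<close> carries a number. As nothing in
  the sum lies strictly between \<open>p\<close> and \<open>q\<close>, either both are neighbouring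
  b-points of one summand, or \<open>q\<close> is an irreflexive summand and its support cannot lie
  beyond \<open>p\<close>; then the canonical points are adjacent or the gap between them is
  deep.\<close>

lemma Inv_step_adj:
  assumes p: "npt p" "npt q" and a: "acc N p q" "\<not> acc N q q" and I: "Inv (Suc i) q z" and i: "Suc i \<le> c"
    and gap: "\<And>y. y \<in> worlds N \<Longrightarrow> acc N p y \<Longrightarrow> acc N y q \<Longrightarrow> acc N y p"
  shows "\<exists>z'. Inv i p z' \<and> adj W z' z"
proof -
  have N: "p \<in> worlds N" "q \<in> worlds N" using p npt_N by auto
  have zW: "z \<in> W" using I Inv_W by blast
  have aqp: "\<not> acc N q p" using a N_trans[OF N(2) N(1) N(2)] by blast
  show ?thesis
  proof (cases "kd (Bs ! fst q) = KP")
    case False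
    then have kq: "kd (Bs ! fst q) = KD" and nreg: "\<not> reg (Bs ! fst q)"
    proof -
      have nb: "\<not> bacc (Bs ! fst q) (snd q) (snd q)" using a(2) unfolding N_acc[OF N(2)] by simp
      show kq: "kd (Bs ! fst q) = KD"
      proof (cases "kd (Bs ! fst q)")
        case KC
        then show ?thesis using nb bacc_simps(2) by blast
      next
        case KO
        then obtain m where "snd q = PB m" using p(2) by (auto simp: npt_def)
        then show ?thesis using nb bacc_simps(6)[OF KO] by simp
      qed (use False in simp_all)
      then show "\<not> reg (Bs ! fst q)" by simp
    qed
    then obtain m where m: "snd q = PB m" using p(2) by (auto simp: npt_def)
    \<comment> \<open>The immediate predecessor of b_m is b_(m+1); any point before it would leave
      it in the forbidden gap.\<close>
    define p0 where "p0 = (fst q, PB (Suc m))"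
    have p0N: "p0 \<in> worlds N" using N(2) nreg by (simp add: p0_def N_worlds bworlds_def)
    have p0q: "acc N p0 q" using N_acc[OF p0N] bacc_simps(5)[OF kq] m by (simp add: p0_def)
    have "p = p0 \<or> acc N p0 p"
      using N_total[OF N(1) p0N] gap[OF p0N _ p0q] by blast
    moreover have "\<not> acc N p0 p"
    proof
      assume "acc N p0 p"
      then have "fst q < fst p \<or> fst q = fst p \<and> bacc (Bs ! fst q) (PB (Suc m)) (snd p)"
        using N_acc[OF p0N] by (simp add: p0_def)
      moreover have "fst p < fst q \<or> fst p = fst q \<and> bacc (Bs ! fst p) (snd p) (snd q)"
        using a(1) unfolding N_acc[OF N(1)] .
      ultimately have b: "fst q = fst p" "bacc (Bs ! fst q) (PB (Suc m)) (snd p)" "bacc (Bs ! fst q) (snd p) (PB m)"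
        using m by auto
      then obtain l where "snd p = PB l" using bacc_simps(4)[OF nreg] by (cases "snd p") auto
      then show False using b bacc_simps(5)[OF kq] by auto
    qed
    ultimately have pp0: "p = p0" by blast
    then have kp: "kd (Bs ! fst p) = KD" by (simp add: p0_def kq)
    have c: "crel (g p) (g q)" using g_mono N a by blast
    have lz: "lt (g p) z" using Inv_lt[OF p a(1) aqp I] .
    obtain z' where z': "z' \<in> W" "adj W z' z" "deep W i z'" using I kq by (auto simp: Inv_def)
    have "lt (g p) z'"
      using le_adj[OF g_W[OF N(1)] lz z'(1,2) deep_irrefl[OF z'(3)]] not_KP_refl[OF N(1)] kp deep_irrefl[OF z'(3)]
      by auto
    then show ?thesis using z' kp by (auto simp: Inv_def)
  next
    case True
    define u where "u = g q"
    have u: "u \<in> W" "\<not> crel u u" "ws (Bs ! fst q) = [u]" using g_W[OF N(2)] KP_irr[OF N(2) True] by (auto simp: u_def)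
    define e where "e = g p"
    have eW: "e \<in> W" using g_W N by (simp add: e_def)
    have "crel e u" using g_mono[OF N a(1)] by (simp add: e_def u_def)
    then have eu: "lt e u" using u W_trans[OF u(1)] by (auto simp: lt_def)
    then have ux: "u \<noteq> x" using not_lt_root eW by blast
    obtain b w where b: "b \<in> set Bs" "w \<in> set (ws b)" and wu: "lt w u"
      and c: "adj W w u \<or> (deep W c w \<or> \<not> dm W w) \<and> (\<forall>y\<in>W. lt w y \<longrightarrow> lt y u \<longrightarrow> deep W c y)"
      using sup[OF blk[OF N(2)] u(3) True ux] by (auto simp: supported_def)
    obtain j i0 where yw: "(j, PA i0) \<in> worlds N" "g (j, PA i0) = w" using point_of[OF b] by metis
    have wW: "w \<in> W" using b ws_W by blast
    \<comment> \<open>A support of \<open>u\<close> strictly after \<open>e\<close> would be a point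
      of the sum inside the gap.\<close>
    have we: "\<not> lt e w"
    proof
      assume l: "lt e w"
      have "acc N p (j, PA i0)" "acc N (j, PA i0) q"
        using lt_acc[OF N(1) yw(1)] lt_acc[OF yw(1) N(2)] l wu by (auto simp: e_def u_def yw(2))
      then have "acc N (j, PA i0) p" using gap yw(1) by blast
      then have "crel w e" using g_mono[OF yw(1) N(1)] yw by (simp add: e_def)
      then show False using l by (simp add: lt_def)
    qed
    have zu: "z = u \<or> lt u z \<and> deep W (Suc i) z \<and> deep W (Suc i) u"
      using I True by (auto simp: Inv_def u_def)
    \<comment> \<open>If \<open>u\<close> has been replaced by a later deep point, the immediate
      predecessor of that point is \<open>u\<close> or still later, hence strictly after
      \<open>e\<close>.\<close>
    have above: "\<exists>z'\<in>W. adj W z' z \<and> deep W i z' \<and> lt e z'" if l: "lt u z" and d: "deep W (Suc i) z"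
    proof -
      obtain z' where z': "z' \<in> W" "adj W z' z" "deep W i z'" using d by auto
      then have "u = z' \<or> lt u z'" using le_adj[OF u(1) l] deep_irrefl by blast
      then have "lt e z'" using lt_trans[OF eW u(1) z'(1) eu] eu by auto
      then show ?thesis using z' by blast
    qed
    show ?thesis
    proof (cases "adj W w u")
      case ad: True
      have "\<not> lt w e" using ad eu eW by (auto simp: adj_def)
      then have same: "w = e \<or> crel w e \<and> crel e w" using W_cases[OF wW eW] we by blast
      have ade: "adj W e u"
        using ad same eu W_trans[OF wW] crel_lt_trans[OF wW eW] unfolding adj_def by blast
      then have reg: "reg (Bs ! fst p)" using adj_dm[OF eW u(1,2)] reg_dm[OF N(1)] by (simp add: e_def)
      show ?thesis
      proof (cases "z = u")
        case True
        then show ?thesis using Inv_reg[OF p(1) reg] ade by (auto simp: e_def)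
      next
        case False
        then have zz: "lt u z" "deep W (Suc i) z" "deep W (Suc i) u" using zu by auto
        obtain t where t: "t \<in> W" "adj W t u" "deep W i t" using zz(3) by auto
        have "t = e" using adj_unique[OF t(1) eW t(2) ade deep_irrefl[OF t(3)]] .
        then have de: "deep W i e" using t by blast
        then have kp: "kd (Bs ! fst p) = KP" using not_KP_refl[OF N(1)] deep_irrefl by (auto simp: e_def)
        obtain z' where "z' \<in> W" "adj W z' z" "deep W i z'" "lt e z'" using above zz by blast
        then show ?thesis using kp de by (auto simp: Inv_def e_def)
      qed
    next
      case False
      then have dw: "deep W c w \<or> \<not> dm W w" and int: "\<And>y. y \<in> W \<Longrightarrow> lt w y \<Longrightarrow> lt y u \<Longrightarrow> deep W c y"
        using c by auto
      obtain u1 where u1: "u1 \<in> W" "adj W u1 u" using ex_pred[OF u(1,2) ux] by blast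
      \<comment> \<open>The immediate predecessor \<open>u1\<close> of \<open>u\<close> is
        \<open>dm\<close>. So it is not in the cluster of a limit \<open>w\<close>: it is
        \<open>w\<close> itself, when \<open>w\<close> is deep, or a point of the gap, and deep in
        both cases.\<close>
      have du1: "deep W c u1"
      proof -
        have "\<not> lt u1 w" using u1 wu wW by (auto simp: adj_def)
        then consider "u1 = w" | "crel w u1" "crel u1 w" | "lt w u1" using W_cases[OF wW u1(1)] by blast
        then show ?thesis
        proof cases
          case 1
          then show ?thesis using dw adj_dm[OF u1(1) u(1,2) u1(2)] by blast
        next
          case 2
          then have "\<not> deep W c w" using deep_irrefl W_trans[OF wW] by blast
          then show ?thesis using dw dm_cluster[OF u1(1) wW 2(2,1) adj_dm[OF u1(1) u(1,2) u1(2)]] by blast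
        next
          case 3
          then show ?thesis using int u1 by (auto simp: adj_def)
        qed
      qed
      have "\<exists>z'\<in>W. adj W z' z \<and> deep W i z' \<and> (e = z' \<or> lt e z')"
      proof (cases "z = u")
        case True
        have "deep W i u1" using deep_antimono[OF du1] i by simp
        then show ?thesis using True u1 le_adj[OF eW eu u1(1,2)] deep_irrefl[OF du1] by blast
      next
        case False
        then show ?thesis using above zu by blast
      qed
      then obtain z' where z': "z' \<in> W" "adj W z' z" "deep W i z'" "e = z' \<or> lt e z'" by blast
      have KPcase: ?thesis if de: "deep W c e"
      proof -
        have kp: "kd (Bs ! fst p) = KP" using not_KP_refl[OF N(1)] deep_irrefl[OF de] by (auto simp: e_def)
        have "deep W i e" using deep_antimono[OF de] i by simp
        then show ?thesis using kp z' by (auto simp: Inv_def e_def)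
      qed
      consider "lt w e" | "w = e \<or> crel w e \<and> crel e w" using W_cases[OF wW eW] we by blast
      then show ?thesis
      proof cases
        case 1
        then show ?thesis using int[OF eW] eu KPcase by blast
      next
        case 2
        show ?thesis
        proof (cases "dm W w")
          case True
          then have d: "deep W c w" using dw by blast
          then have "w = e" using 2 deep_irrefl W_trans[OF wW] by blast
          then show ?thesis using KPcase d by blast
        next
          case False
          have nd: "\<not> dm W e" using 2 False dm_cluster[OF eW wW] by blast
          have "deep W c y" if y: "y \<in> W" "lt e y" "lt y u" for y
            using int[OF y(1)] y 2 crel_lt_trans[OF wW eW y(1)] by blast
          \<comment> \<open>This is the use of \<open>supD\<close>: a limit cluster separated from
            \<open>u\<close> by deep points only is of kind \<open>KD\<close>, so a deep point may
            replace \<open>p\<close>.\<close>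
          then have kp: "kd (Bs ! fst p) = KD"
            using supD[OF blk[OF N(1)] _ nd blk[OF N(2)] True u(3) eu] g_ws[OF N(1)] \<open>kd (Bs ! fst q) = KP\<close>
            by (simp add: e_def)
          have "crel e e" using not_dm_refl[OF eW nd] .
          then have "lt e z'" using z' deep_irrefl by blast
          then show ?thesis using kp z' by (auto simp: Inv_def e_def)
        qed
      qed
    qed
  qed
qed

end

context refutation
begin

lemma refutation_False:
  assumes T: "T = (\<lambda>i j. S (as ! i) (as ! j))" and n: "n = length as"
    and D: "D = {d. d < length as \<and> as ! d \<in> D'}"
    and L: "\<And>s. subst s (canonical_fm S as D') \<in> L"
  shows False
proof -
  have "\<exists>xs. set xs = {..<n} \<and> distinct xs \<and> sorted_wrt T xs"
  proof (rule sorted_enum)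
    fix a b d assume "a \<in> {..<n}" "b \<in> {..<n}" "d \<in> {..<n}" "T a b" "T b d"
    then show "T a d" using T_trans[of a b d] by simp
  qed (use T_lin in auto)
  then obtain xs where xs: "set xs = {..<n}" "distinct xs" "sorted_wrt T xs" by blast
  have len: "length xs = n" using distinct_card[OF xs(2)] xs(1) by simp
  have xn: "xs ! i < n" if "i < n" for i using xs(1) len that by (metis lessThan_iff nth_mem)
  have xT: "T (xs ! i) (xs ! j)" if "i < j" "j < n" for i j
    using sorted_wrt_nth_less[OF xs(3)] that len by simp
  have xne: "xs ! i \<noteq> xs ! j" if "i < n" "j < n" "i \<noteq> j" for i j
    using xs(2) that len by (simp add: nth_eq_iff_index_eq)
  \<comment> \<open>The requirement on neighbouring images: same cluster, or strict order, with
    adjacency below a closed domain. Indices further apart are then ordered correctly by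
    transitivity.\<close>
  define lk where "lk i a b \<longleftrightarrow>
      (if T (xs ! Suc i) (xs ! i) then crel a b \<and> crel b a
       else lt a b \<and> (xs ! Suc i \<in> D \<longrightarrow> adj W a b))" for i a b
  let ?last = "g (h (xs ! (n - 1)))"
  have n1: "n - 1 < n" using n_pos by simp
  have last: "reg (Bs ! fst (h (xs ! (n - 1))))" "\<And>y. y \<in> W \<Longrightarrow> y = ?last \<or> crel y ?last"
  proof -
    obtain i where i: "i < n" "reg (Bs ! fst (h i))" "\<forall>z\<in>W. z = g (h i) \<or> crel z (g (h i))"
      using h_final by blast
    obtain k where k: "k < n" "xs ! k = i" using i xs len by (metis in_set_conv_nth lessThan_iff)
    have gW: "g (h i) \<in> W" "?last \<in> W" using g_W h_N i xn n1 by blast+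
    have "reg (Bs ! fst (h (xs ! (n - 1)))) \<and> (\<forall>y\<in>W. y = ?last \<or> crel y ?last)"
    proof (cases "k = n - 1")
      case True
      then show ?thesis using i k by simp
    next
      case False
      then have "T i (xs ! (n - 1))" using xT[of k "n - 1"] k by auto
      then have "acc N (h i) (h (xs ! (n - 1)))" using h_T i xn[OF n1] by blast
      then have c: "crel (g (h i)) ?last" using g_mono h_N i xn[OF n1] by blast
      then have c': "?last = g (h i) \<or> crel ?last (g (h i))" using i gW by blast
      have "dm W (g (h i))" using reg_dm h_N i by blast
      then have "dm W ?last" using dm_cluster gW c c' by metis
      then have "reg (Bs ! fst (h (xs ! (n - 1))))" using reg_dm h_N xn[OF n1] by blast
      moreover have "y = ?last \<or> crel y ?last" if "y \<in> W" for y
        using i(3) that c W_trans by metis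
      ultimately show ?thesis by blast
    qed
    then show "reg (Bs ! fst (h (xs ! (n - 1))))" "\<And>y. y \<in> W \<Longrightarrow> y = ?last \<or> crel y ?last" by blast+
  qed
  have down: "\<exists>a. Inv i (h (xs ! i)) a \<and> lk i a b"
    if i: "Suc i < n" and I: "Inv (Suc i) (h (xs ! Suc i)) b" for i b
  proof -
    let ?a = "xs ! i" and ?b = "xs ! Suc i"
    have ab: "?a < n" "?b < n" "?a \<noteq> ?b" "T ?a ?b" using xn xne xT i by auto
    have acc: "acc N (h ?a) (h ?b)" using h_T ab by blast
    have hab: "h ?a \<noteq> h ?b" using h_inj ab by blast
    show ?thesis
    proof (cases "T ?b ?a")
      case True
      then have "acc N (h ?b) (h ?a)" using h_T ab by blast
      then show ?thesis using Inv_step_same[OF h(2) h(2), OF ab(1,2) acc _ hab I] True by (auto simp: lk_def)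
    next
      case False
      then have nacc: "\<not> acc N (h ?b) (h ?a)" using h_T ab by blast
      show ?thesis
      proof (cases "?b \<in> D")
        case True
        have irr: "\<not> T ?b ?b" using D_irr True by blast
        have "\<exists>z'. Inv i (h ?a) z' \<and> adj W z' b"
        proof (rule Inv_step_adj[OF h(2) h(2), OF ab(1,2) acc _ I])
          show "\<not> acc N (h ?b) (h ?b)" using irr h_T ab by blast
          show "Suc i \<le> c" using i n_le by simp
          fix y assume y: "y \<in> worlds N" "acc N (h ?a) y" "acc N y (h ?b)"
          show "acc N y (h ?a)"
          proof (rule h_gap[OF True ab(1) _ y])
            fix d assume d: "d < n" "d \<noteq> ?b" "T d ?b"
            obtain j where j: "j < n" "xs ! j = d" using d xs len by (metis in_set_conv_nth lessThan_iff)
            have "\<not> Suc i < j"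
            proof
              assume "Suc i < j"
              then have "T ?b d" using xT j by blast
              then show False using irr T_trans[of ?b d ?b] d ab by blast
            qed
            then have "j \<le> i" using j d i by (metis le_SucE not_less)
            then show "d = ?a \<or> T d ?a" using xT[of j i] j i by (metis Suc_lessD le_neq_implies_less)
          qed
        qed
        then show ?thesis using False by (auto simp: lk_def adj_def)
      next
        case nD: False
        have "lt (g (h ?a)) b" using Inv_lt[OF h(2) h(2), OF ab(1,2) acc nacc I] .
        then have "\<exists>z'. Inv i (h ?a) z' \<and> lt z' b"
          using Inv_step[OF h(2)[OF ab(1)] Inv_W[OF I]] i n_le by simp
        then show ?thesis using False nD by (auto simp: lk_def)
      qed
    qed
  qed
  \<comment> \<open>Position \<open>i\<close> in the sorted list has \<open>i\<close> positions
    below it, so depth \<open>i\<close> suffices there, and \<open>i\<close> stays below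
    \<open>c\<close>. The construction starts at the final cluster, whose point is kept
    unchanged.\<close>
  have "\<exists>z. (\<forall>i<n. m \<le> i \<longrightarrow> Inv i (h (xs ! i)) (z i) \<and> (Suc i < n \<longrightarrow> lk i (z i) (z (Suc i)))) \<and>
      z (n - 1) = ?last" if "m \<le> n - 1" for m
    using that
  proof (induction m rule: inc_induct)
    case base
    have "i = n - 1" if "i < n" "n - 1 \<le> i" for i using that by linarith
    then show ?case
      using Inv_reg[OF h(2)[OF xn[OF n1]] last(1)] by (intro exI[of _ "\<lambda>_. ?last"]) auto
  next
    case (step m)
    then obtain z where z: "\<forall>i<n. Suc m \<le> i \<longrightarrow> Inv i (h (xs ! i)) (z i) \<and> (Suc i < n \<longrightarrow> lk i (z i) (z (Suc i)))"
      "z (n - 1) = ?last" by blast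
    have m: "Suc m < n" using step.hyps by linarith
    then obtain a where a: "Inv m (h (xs ! m)) a" "lk m a (z (Suc m))" using down[of m "z (Suc m)"] z by blast
    show ?case
    proof (intro exI[of _ "z(m := a)"] conjI allI impI)
      fix i assume "i < n" "m \<le> i"
      then show "Inv i (h (xs ! i)) ((z(m := a)) i)" using a z by (cases "i = m") auto
    next
      fix i assume "i < n" "m \<le> i" "Suc i < n"
      then show "lk i ((z(m := a)) i) ((z(m := a)) (Suc i))" using a z by (cases "i = m") auto
    next
      show "(z(m := a)) (n - 1) = ?last" using z step.hyps by auto
    qed
  qed
  from this[OF le0] obtain z
    where zs: "\<forall>i<n. 0 \<le> i \<longrightarrow> Inv i (h (xs ! i)) (z i) \<and> (Suc i < n \<longrightarrow> lk i (z i) (z (Suc i)))"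
      and zlast: "z (n - 1) = ?last" by blast
  have zI: "Inv i (h (xs ! i)) (z i)" if "i < n" for i using zs that by simp
  have zl: "lk i (z i) (z (Suc i))" if "Suc i < n" for i using zs that Suc_lessD by blast
  have zW: "z i \<in> W" if "i < n" for i using zI[OF that] Inv_W by blast
  have zz: "crel (z i) (z j) \<and> (T (xs ! j) (xs ! i) \<longleftrightarrow> crel (z j) (z i))" if "i < j" "j < n" for i j
    using that
  proof (induction j)
    case (Suc j)
    have lkj: "lk j (z j) (z (Suc j))" using zl Suc.prems by blast
    have n: "i < n" "j < n" "Suc j < n" using Suc.prems by auto
    show ?case
    proof (cases "i = j")
      case True
      then show ?thesis using lkj by (auto simp: lk_def lt_def split: if_splits)
    next
      case False
      then have IH: "crel (z i) (z j)" "T (xs ! j) (xs ! i) \<longleftrightarrow> crel (z j) (z i)" using Suc by auto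
      have ij: "T (xs ! i) (xs ! j)" "T (xs ! j) (xs ! Suc j)" using xT False Suc.prems by auto
      have c: "crel (z j) (z (Suc j))" using lkj by (auto simp: lk_def lt_def split: if_splits)
      then have c': "crel (z i) (z (Suc j))" using W_trans zW IH n by blast
      show ?thesis
      proof (cases "T (xs ! Suc j) (xs ! j)")
        case True
        then have "crel (z (Suc j)) (z j)" using lkj by (simp add: lk_def)
        then have "crel (z (Suc j)) (z i) \<longleftrightarrow> crel (z j) (z i)" using c W_trans zW n by blast
        moreover have "T (xs ! Suc j) (xs ! i) \<longleftrightarrow> T (xs ! j) (xs ! i)"
          using True ij T_trans xn n by blast
        ultimately show ?thesis using IH c' by blast
      next
        case False
        then have "\<not> crel (z (Suc j)) (z j)" using lkj by (simp add: lk_def lt_def)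
        then have "\<not> crel (z (Suc j)) (z i)" using IH W_trans zW n by blast
        moreover have "\<not> T (xs ! Suc j) (xs ! i)" using False ij T_trans xn n by blast
        ultimately show ?thesis using c' by blast
      qed
    qed
  qed simp
  have zr: "T (xs ! i) (xs ! i) \<longleftrightarrow> crel (z i) (z i)" if "i < n" for i
    using Inv_refl[OF h(2) zI[OF that]] h_T xn that by blast
  have zT: "T (xs ! i) (xs ! j) \<longleftrightarrow> crel (z i) (z j)" if "i < n" "j < n" for i j
    using zz[of i j] zz[of j i] zr[of i] xT[of i j] that by (metis linorder_neqE_nat)
  have zinj: "z i \<noteq> z j" if ij: "i < j" "j < n" for i j
  proof (cases "T (xs ! j) (xs ! i)")
    case False
    then show ?thesis using zz[OF ij] zr[of i] by metis
  next
    case True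
    have i: "i < n" using ij by simp
    let ?p = "h (xs ! i)" and ?q = "h (xs ! j)"
    have N: "?p \<in> worlds N" "?q \<in> worlds N" using h_N xn i ij by blast+
    have acc: "acc N ?p ?q" "acc N ?q ?p" using h_T xn i ij True xT[OF ij] by blast+
    have ne: "?p \<noteq> ?q" using h_inj xn xne i ij by (metis nat_neq_iff)
    have k: "kd (Bs ! fst ?p) = KC" "fst ?p = fst ?q"
      using mutual[OF h(2) h(2), OF xn[OF i] xn[OF ij(2)] acc ne] by blast+
    have "z i = g ?p" "z j = g ?q" using zI[OF i] zI[OF ij(2)] k by (auto simp: Inv_def)
    then show ?thesis using KC_inj[OF N k(2,1) ne] by simp
  qed
  \<comment> \<open>From positions in the sorted list back to the indices of the formula.\<close>
  define pos where "pos a = (SOME i. i < n \<and> xs ! i = a)" for a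
  have pos: "pos a < n \<and> xs ! pos a = a" if "a < n" for a
  proof -
    have "a \<in> set xs" using that xs(1) by simp
    then obtain i where i: "i < n" "xs ! i = a" using len by (auto simp: in_set_conv_nth)
    show ?thesis unfolding pos_def by (rule someI[of _ i]) (use i in simp)
  qed
  define Z where "Z a = z (pos a)" for a
  show False
  proof (rule no_embedding[OF root_order_axioms T n D L, of Z])
    fix a assume a: "a < n"
    show "Z a \<in> W" "dm W (Z a)"
      using zW Inv_dm[OF h(2) zI] xn pos[OF a] by (auto simp: Z_def)
    fix b assume b: "b < n"
    show "T a b \<longleftrightarrow> crel (Z a) (Z b)" using zT[of "pos a" "pos b"] pos a b by (simp add: Z_def)
    assume "a \<noteq> b"
    then have "pos a \<noteq> pos b" using pos a b by metis
    then show "Z a \<noteq> Z b" using zinj[of "pos a" "pos b"] zinj[of "pos b" "pos a"] pos a b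
      unfolding Z_def by (metis linorder_neqE_nat)
  next
    have p: "pos (xs ! (n - 1)) = n - 1" using pos[OF xn[OF n1]] xne[OF _ n1] by metis
    show "\<exists>i<n. \<forall>y\<in>W. y = Z i \<or> crel y (Z i)"
    proof (intro exI conjI)
      have "Z (xs ! (n - 1)) = ?last" by (simp only: Z_def p zlast)
      then show "\<forall>y\<in>W. y = Z (xs ! (n - 1)) \<or> crel y (Z (xs ! (n - 1)))" using last(2) by simp
    qed (rule xn[OF n1])
  next
    fix d assume d: "d \<in> D"
    then have dn: "d < n" "\<not> T d d" "\<exists>e<n. e \<noteq> d \<and> \<not> T d e" using D_irr by blast+
    \<comment> \<open>The first index of the list sees all others, which a closed domain does not;
      so \<open>d\<close> has a neighbour before it, and the link between them is adjacency.\<close>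
    have "pos d \<noteq> 0"
    proof
      assume "pos d = 0"
      then have "T d e" if "e < n" "e \<noteq> d" for e
        using xT[of 0 "pos e"] pos[OF that(1)] pos[OF dn(1)] that by (metis gr0I)
      then show False using dn by blast
    qed
    then obtain i where i: "pos d = Suc i" using not0_implies_Suc by blast
    then have s: "Suc i < n" "xs ! Suc i = d" using pos[OF dn(1)] by auto
    have "\<not> T (xs ! Suc i) (xs ! i)" using s dn T_trans[of d "xs ! i" d] xT[of i "Suc i"] xn[of i] by auto
    then have "adj W (z i) (Z d)" using zl[OF s(1)] s d i by (simp add: lk_def Z_def)
    moreover have "pos (xs ! i) = i" using pos[OF xn, of i] xne s by (metis Suc_lessD)
    ultimately show "\<exists>e<n. adj W (Z e) (Z d)" using xn[of i] s by (intro exI[of _ "xs ! i"]) (simp add: Z_def)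
  qed
qed

end

lemma canonical_root_order:
  assumes "canonical_data V S as D"
  shows "root_order (\<lambda>i j. S (as ! i) (as ! j)) (length as) {d. d < length as \<and> as ! d \<in> D}"
    "length as = card V"
proof -
  have V: "finite V" "set as = V" "distinct as" "is_root (kripke V S) (hd as)"
      "D \<subseteq> {d \<in> V. \<not> S d d \<and> \<not> is_root (kripke V S) d}"
    and fr: "frame_for K43 (kripke V S)" using assms by (auto simp: canonical_data_def)
  have lin: "linear_frame (kripke V S)" using K43_kripke_linear fr by blast
  have ne: "as \<noteq> []" using fr V by (auto simp: frame_for_def general_frame_def kripke_def)
  have hd: "hd as = as ! 0" using ne by (simp add: hd_conv_nth)
  have mem: "as ! i \<in> V" if "i < length as" for i using V that by auto
  have root: "S (as ! 0) y" if "y \<in> V" "y \<noteq> as ! 0" for y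
    using V(4) that by (auto simp: is_root_def kripke_def hd)
  note l = lin[unfolded linear_frame_def kripke_def gframe.select_convs]
  have lin': "\<forall>y\<in>V. \<forall>z\<in>V. \<forall>u\<in>V. S y z \<longrightarrow> S z u \<longrightarrow> S y u" using l by (rule conjunct1)
  have lin'': "\<forall>y\<in>V. \<forall>z\<in>V. \<forall>u\<in>V. S y z \<longrightarrow> S y u \<longrightarrow> z = u \<or> S z u \<or> S u z"
    using l by (rule conjunct2)
  have tr: "S a c" if "a \<in> V" "b \<in> V" "c \<in> V" "S a b" "S b c" for a b c
    using lin' that by blast
  have conn: "b = c \<or> S b c \<or> S c b" if "a \<in> V" "b \<in> V" "c \<in> V" "S a b" "S a c" for a b c
    using lin'' that by blast
  have tot: "S a b \<or> S b a" if "a \<in> V" "b \<in> V" "a \<noteq> b" for a b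
  proof (cases "a = as ! 0 \<or> b = as ! 0")
    case True
    then show ?thesis using root that by blast
  next
    case False
    then have "S (as ! 0) a" "S (as ! 0) b" using root that by auto
    then show ?thesis using conn[OF mem[of 0] that(1,2)] ne that(3) by simp
  qed
  show "length as = card V" using V distinct_card by metis
  show "root_order (\<lambda>i j. S (as ! i) (as ! j)) (length as) {d. d < length as \<and> as ! d \<in> D}"
  proof
    fix i j k assume "i < length as" "j < length as" "k < length as" "S (as ! i) (as ! j)" "S (as ! j) (as ! k)"
    then show "S (as ! i) (as ! k)" using tr[OF mem mem mem] by blast
  next
    fix i j assume "i < length as" "j < length as" "i \<noteq> j"
    then show "S (as ! i) (as ! j) \<or> S (as ! j) (as ! i)"
      using tot mem V(3) by (simp add: nth_eq_iff_index_eq)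
  next
    fix j assume "0 < j" "j < length as"
    then show "S (as ! 0) (as ! j)" using root mem V(3) ne by (auto simp: nth_eq_iff_index_eq)
  next
    show "0 < length as" using ne by simp
  next
    fix d assume "d \<in> {d. d < length as \<and> as ! d \<in> D}"
    then have d: "d < length as" "as ! d \<in> V" "\<not> S (as ! d) (as ! d)" "\<not> is_root (kripke V S) (as ! d)"
      using V(5) by auto
    then obtain e where e: "e \<in> V" "e \<noteq> as ! d" "\<not> S (as ! d) e" by (auto simp: is_root_def kripke_def)
    then obtain j where "j < length as" "as ! j = e" using V(2) by (metis in_set_conv_nth)
    then show "d < length as \<and> \<not> S (as ! d) (as ! d) \<and> (\<exists>e<length as. e \<noteq> d \<and> \<not> S (as ! d) (as ! e))"
      using d e by auto
  qed
qed

lemma (in blocks) N_validates: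
  assumes cd: "canonical_data V S as D" and "card V \<le> c"
    and L: "\<And>s. subst s (canonical_fm S as D) \<in> L"
  shows "valid N (canonical_fm S as D)"
  unfolding valid_def
proof (intro allI impI ballI, rule ccontr)
  fix v :: "nat \<Rightarrow> (nat \<times> point) set" and r
  assume v: "\<forall>p. v p \<in> internal N" and r: "r \<in> worlds N"
    and "\<not> holds N v r (canonical_fm S as D)"
  then have ref: "refutes N v r (\<lambda>i j. S (as ! i) (as ! j)) (length as) {d. d < length as \<and> as ! d \<in> D}"
    using canonical_fm_refutes[OF r, of v S as D] by blast
  interpret root_order "\<lambda>i j. S (as ! i) (as ! j)" "length as" "{d. d < length as \<and> as ! d \<in> D}"
    using canonical_root_order cd by blast
  interpret refutation L X x c Bs "\<lambda>i j. S (as ! i) (as ! j)" "length as" "{d. d < length as \<and> as ! d \<in> D}" v r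
    using ref r v canonical_root_order(2)[OF cd] assms(2) by unfold_locales auto
  show False by (rule refutation_False[OF refl refl refl L])
qed

section \<open>Construction of the summands\<close>

definition enum :: "'a set \<Rightarrow> 'a list" where
  "enum A = (SOME xs. set xs = A \<and> distinct xs)"

lemma enum: "finite A \<Longrightarrow> set (enum A) = A \<and> distinct (enum A)"
  unfolding enum_def by (rule someI_ex) (rule finite_distinct_list)

lemma length_enum: "finite A \<Longrightarrow> length (enum A) = card A"
  using enum distinct_card by metis

definition cl :: "fm set \<Rightarrow> fm set set" where
  "cl e = {y. y = e \<or> crel y e \<and> crel e y}"

lemma cl_refl [simp]: "e \<in> cl e"
  by (simp add: cl_def)

lemma cl_sym: "y \<in> cl e \<Longrightarrow> e \<in> cl y"
  by (auto simp: cl_def)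

lemma sorted_wrt_concat_map:
  "\<lbrakk>\<forall>e\<in>set es. sorted_wrt P (f e); sorted_wrt R es;
    \<forall>e\<in>set es. \<forall>e'\<in>set es. \<forall>b\<in>set (f e). \<forall>b'\<in>set (f e'). R e e' \<longrightarrow> P b b'\<rbrakk> \<Longrightarrow>
   sorted_wrt P (concat (map f es))"
proof (induction es)
  case (Cons a es)
  have "sorted_wrt P (concat (map f es))" by (rule Cons.IH) (use Cons.prems in auto)
  moreover have "\<forall>b\<in>set (f a). \<forall>b'\<in>set (concat (map f es)). P b b'" using Cons.prems by auto
  ultimately show ?case using Cons.prems by (simp add: sorted_wrt_append)
qed simp

context canon
begin

lemma cl_trans: "u \<in> W \<Longrightarrow> y \<in> W \<Longrightarrow> z \<in> W \<Longrightarrow> y \<in> cl u \<Longrightarrow> z \<in> cl y \<Longrightarrow> z \<in> cl u"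
  unfolding cl_def using W_trans by blast

lemma cl_eq: "A \<subseteq> W \<Longrightarrow> u \<in> W \<Longrightarrow> y \<in> W \<Longrightarrow> y \<in> cl u \<Longrightarrow> A \<inter> cl u = A \<inter> cl y"
  using cl_trans cl_sym by blast

lemma cl_lt: 
  assumes "u \<in> W" "v \<in> W" "y \<in> W" "z \<in> W" "lt u v" "y \<in> cl u" "z \<in> cl v"
  shows "lt y z"
proof -
  have "lt y v" using assms(5,6) crel_lt_trans[OF assms(3,1,2)] by (auto simp: cl_def)
  then show ?thesis using assms(7) lt_crel_trans[OF assms(3,2,4)] by (auto simp: cl_def)
qed

lemma cl_dm: "e \<in> W \<Longrightarrow> y \<in> W \<Longrightarrow> y \<in> cl e \<Longrightarrow> dm W y \<longleftrightarrow> dm W e"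
  using dm_cluster by (auto simp: cl_def)

lemma lt_cl_left: "e \<in> W \<Longrightarrow> y \<in> W \<Longrightarrow> z \<in> W \<Longrightarrow> y \<in> cl e \<Longrightarrow> lt e z \<longleftrightarrow> lt y z"
  using cl_lt[of e z y z] cl_lt[of y z e z] cl_sym by auto

lemma limD_cluster: "e \<in> W \<Longrightarrow> y \<in> W \<Longrightarrow> y \<in> cl e \<Longrightarrow> limD W n y \<longleftrightarrow> limD W n e"
  unfolding limD_def by (intro ball_cong refl) (simp add: lt_cl_left[of e y])

lemma limD_interval:
  assumes e: "e \<in> W" "\<not> dm W e" and v: "v \<in> W" "lt e v"
    and int: "\<And>y. y \<in> W \<Longrightarrow> lt e y \<Longrightarrow> lt y v \<Longrightarrow> deep W n y"
  shows "limD W n e"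
  unfolding limD_def
proof (intro ballI impI)
  fix z assume z: "z \<in> W" "lt e z"
  obtain m where m: "m \<in> W" "lt e m" "m = z \<or> crel m z" "m = v \<or> crel m v"
    using W_linear[OF z(1) v(1)] z v by blast
  obtain y where y: "y \<in> W" "lt e y" "lt y m" using dm_between[OF e m(1,2)] by blast
  have "lt y z" "lt y v" using y m z v lt_crel_trans by blast+
  then show "\<exists>y\<in>W. lt e y \<and> lt y z \<and> deep W n y" using y int by blast
qed

section \<open>Closing a selection under support\<close>

definition pd :: "fm set \<Rightarrow> fm set" where
  "pd v = (SOME u. u \<in> W \<and> adj W u v)"

lemma pd: "v \<in> W \<Longrightarrow> \<not> crel v v \<Longrightarrow> v \<noteq> x \<Longrightarrow> pd v \<in> W \<and> adj W (pd v) v"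
  unfolding pd_def by (rule someI_ex) (erule ex_pred, auto)

text \<open>Descends through immediate predecessors, at most \<open>k\<close> times, stopping at a
  reflexive point or at the root.\<close>

primrec adds :: "nat \<Rightarrow> fm set \<Rightarrow> fm set set" where
  "adds 0 y = {y}"
| "adds (Suc k) y = insert y (if \<not> crel y y \<and> y \<noteq> x then adds k (pd y) else {})"

lemma adds_self: "y \<in> adds k y"
  by (cases k) auto

lemma adds_W: "y \<in> W \<Longrightarrow> adds k y \<subseteq> W"
  using pd by (induction k arbitrary: y) auto

lemma adds_card: "finite (adds k y) \<and> card (adds k y) \<le> Suc k"
proof (induction k arbitrary: y)
  case (Suc k)
  have "finite (adds k (pd y))" "card (adds k (pd y)) \<le> Suc k" using Suc by auto
  then show ?case using card_insert_le_m1[of "Suc (Suc k)" "adds k (pd y)" y] by (auto simp: card_insert_if)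
qed simp

text \<open>If \<open>y\<close> is not deep of degree \<open>k\<close>, the descent meets a
  reflexive point or the root within its allowance; so every irreflexive member other than the root
  has its predecessor in the set.\<close>

lemma adds_adj:
  "y \<in> W \<Longrightarrow> \<not> deep W k y \<Longrightarrow> u \<in> adds k y \<Longrightarrow> \<not> crel u u \<Longrightarrow> u \<noteq> x \<Longrightarrow> \<exists>w\<in>adds k y. adj W w u"
proof (induction k arbitrary: y)
  case (Suc k)
  show ?case
  proof (cases "\<not> crel y y \<and> y \<noteq> x")
    case True
    then have p: "pd y \<in> W" "adj W (pd y) y" using pd Suc.prems by blast+
    then have nd: "\<not> deep W k (pd y)" using Suc.prems True by auto
    have sub: "adds k (pd y) \<subseteq> adds (Suc k) y" using True by auto
    consider "u = y" | "u \<in> adds k (pd y)" using Suc.prems True by auto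
    then show ?thesis
    proof cases
      case 1
      then show ?thesis using p(2) adds_self[of "pd y" k] sub by blast
    next
      case 2
      then show ?thesis using Suc.IH[OF p(1) nd 2] Suc.prems sub by blast
    qed
  qed (use Suc.prems in auto)
qed auto

text \<open>The last point before \<open>v\<close> that is not the end of a long irreflexive chain; it and the irreflexive
  points immediately below it suffice to support \<open>v\<close>.\<close>

definition deepstop :: "nat \<Rightarrow> fm set \<Rightarrow> fm set \<Rightarrow> bool" where
  "deepstop k v u \<longleftrightarrow> u \<in> W \<and> lt u v \<and> \<not> deep W (Suc k) u \<and>
     (\<forall>y\<in>W. lt u y \<longrightarrow> lt y v \<longrightarrow> deep W (Suc k) y) \<and>
     (adj W u v \<or> crel u u \<and> \<not> dm W u \<or> deep W k u)"

definition ystar :: "nat \<Rightarrow> fm set \<Rightarrow> fm set" where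
  "ystar k v = (SOME u. deepstop k v u)"

lemma ystar:
  assumes "v \<in> W" "v \<noteq> x" "\<not> crel v v"
  shows "deepstop k v (ystar k v)"
proof -
  have "\<exists>u. deepstop k v u"
    by (rule last_not_deep[OF assms, of k]) (unfold deepstop_def, blast)
  then show ?thesis unfolding ystar_def by (rule someI_ex)
qed

text \<open>The degrees fit: the stop \<open>ystar k v\<close> is not deep of degree
  \<open>Suc k\<close>, so \<open>adds (Suc k)\<close> completes it, while everything between it and
  \<open>v\<close> is deep of degree \<open>Suc k\<close> and hence of degree \<open>k\<close>, as
  support requires. Each irreflexive member other than the root contributes at most
  \<open>k + 2\<close> points.\<close>

definition close :: "nat \<Rightarrow> fm set set \<Rightarrow> fm set set" where
  "close k A = A \<union> (\<Union>v\<in>{v \<in> A. v \<noteq> x \<and> \<not> crel v v}. adds (Suc k) (ystar k v))"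

lemma close_W: "A \<subseteq> W \<Longrightarrow> close k A \<subseteq> W"
  using ystar adds_W unfolding close_def deepstop_def by blast

lemma close_finite: "finite A \<Longrightarrow> finite (close k A)"
  using adds_card by (auto simp: close_def)

lemma close_card: 
  assumes "finite A"
  shows "card (close k A) \<le> card A * (k + 3)"
proof -
  let ?B = "{v \<in> A. v \<noteq> x \<and> \<not> crel v v}"
  have fB: "finite ?B" "card ?B \<le> card A" using assms by (auto intro: card_mono)
  have "card (\<Union>v\<in>?B. adds (Suc k) (ystar k v)) \<le> (\<Sum>v\<in>?B. card (adds (Suc k) (ystar k v)))"
    by (rule card_UN_le[OF fB(1)])
  also have "\<dots> \<le> (\<Sum>v\<in>?B. k + 2)" using adds_card[of "Suc k"] by (intro sum_mono) auto
  also have "\<dots> \<le> card A * (k + 2)" using mult_le_mono1[OF fB(2), of "k + 2"] by simp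
  finally have "card (close k A) \<le> card A + card A * (k + 2)"
    unfolding close_def using card_Un_le[of A] by (meson add_left_mono le_trans)
  also have "\<dots> = card A * (k + 3)" by (simp add: algebra_simps)
  finally show ?thesis .
qed

text \<open>Members of \<open>A\<close> are supported by their stops, added points directly by their
  immediate predecessors; so one round of closing is enough.\<close>

lemma close_supported:
  assumes A: "A \<subseteq> W" and v: "v \<in> close k A" "\<not> crel v v" "v \<noteq> x"
  shows "supported W k (close k A) v"
proof (cases "v \<in> A")
  case True
  then have d: "deepstop k v (ystar k v)" using ystar A v by blast
  have "ystar k v \<in> close k A" using True v adds_self by (auto simp: close_def)
  moreover have "deep W k y" if "deep W (Suc k) y" for y using deep_SucD that .
  ultimately show ?thesis using d unfolding supported_def deepstop_def by blast
next
  case False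
  then obtain a where a: "a \<in> A" "a \<noteq> x" "\<not> crel a a" "v \<in> adds (Suc k) (ystar k a)"
    using v by (auto simp: close_def)
  then have "deepstop k a (ystar k a)" using ystar A by blast
  then have "\<exists>w\<in>adds (Suc k) (ystar k a). adj W w v"
    using adds_adj[of "ystar k a" "Suc k" v] a v unfolding deepstop_def by blast
  then obtain w where "w \<in> close k A" "adj W w v" using a by (auto simp: close_def)
  then show ?thesis unfolding supported_def by (auto simp: adj_def)
qed

end

text \<open>\<open>T\<close> is the selection made in this model, \<open>Q\<close> contains the
  types over \<open>Y\<close> selected in either of the two models. Apart from \<open>TQ\<close>,
  the assumptions on \<open>Q\<close> concern only the frame over \<open>Y\<close>, which the two
  models share.\<close>

locale build = proj +
  fixes c :: nat and T Q :: "fm set set"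
  assumes finT: "finite T" and TW: "T \<subseteq> W" and xT: "x \<in> T"
    and Tsup: "v \<in> T \<Longrightarrow> \<not> crel v v \<Longrightarrow> v \<noteq> x \<Longrightarrow> supported W c T v"
    and Tfin: "\<exists>y\<in>T. dm W y \<and> (\<forall>z\<in>W. z = y \<or> crel z y)"
    and finQ: "finite Q" and QF: "Q \<subseteq> F.W" and TQ: "pr ` T \<subseteq> Q"
    and Qsup: "s \<in> Q \<Longrightarrow> \<not> crel s s \<Longrightarrow> s \<noteq> pr x \<Longrightarrow> supported F.W c Q s"
begin

section \<open>The list of summands\<close>

definition S :: "fm set set" where
  "S = T \<union> lift ` Q"

lemma finS: "finite S" and SW: "S \<subseteq> W"
  using finT finQ TW QF lift_W by (auto simp: S_def)

lemma lift_inj: "s \<in> Q \<Longrightarrow> t \<in> Q \<Longrightarrow> lift s = lift t \<Longrightarrow> s = t"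
  using pr_lift QF by (metis subsetD)

definition mq :: "fm set \<Rightarrow> fm set set" where
  "mq e = {s \<in> Q. lift s \<in> cl e}"

text \<open>Within a limit cluster, the summand for the lifts of \<open>Q\<close> comes last: it has to be copied in the other
  model, and all other points of the same \<open>Y\<close>-cluster must see it.\<close>

definition blks :: "fm set \<Rightarrow> block list" where
  "blks e = (if \<not> crel e e then [(KP, None, [e])]
     else if dm W e then [(KC, None, enum (S \<inter> cl e))]
     else (if T \<inter> cl e = {} then []
           else [(if \<forall>y\<in>T \<inter> cl e. limD W c y then KD else KO, None, enum (T \<inter> cl e))]) @
          (if mq e = {} then []
           else [(if \<forall>s\<in>mq e. limD F.W c s then KD else KO, Some (mq e), map lift (enum (mq e)))]))"

lemma fin_mq: "finite (mq e)"
  using finQ by (simp add: mq_def)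

lemma blks_cases:
  assumes "b \<in> set (blks e)" "e \<in> S"
  obtains "\<not> crel e e" "b = (KP, None, [e])"
  | "crel e e" "dm W e" "kd b = KC" "tag b = None" "set (ws b) = S \<inter> cl e" "distinct (ws b)" "length (ws b) = card (S \<inter> cl e)"
  | "crel e e" "\<not> dm W e" "T \<inter> cl e \<noteq> {}" "kd b = (if \<forall>y\<in>T \<inter> cl e. limD W c y then KD else KO)"
    "tag b = None" "set (ws b) = T \<inter> cl e" "distinct (ws b)" "length (ws b) = card (T \<inter> cl e)"
  | "crel e e" "\<not> dm W e" "mq e \<noteq> {}" "kd b = (if \<forall>s\<in>mq e. limD F.W c s then KD else KO)"
    "tag b = Some (mq e)" "ws b = map lift (enum (mq e))" "set (ws b) = lift ` mq e" "distinct (ws b)"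
    "length (ws b) = card (mq e)"
proof -
  have en: "set (enum (S \<inter> cl e)) = S \<inter> cl e" "distinct (enum (S \<inter> cl e))" "length (enum (S \<inter> cl e)) = card (S \<inter> cl e)"
    "set (enum (T \<inter> cl e)) = T \<inter> cl e" "distinct (enum (T \<inter> cl e))" "length (enum (T \<inter> cl e)) = card (T \<inter> cl e)"
    "set (enum (mq e)) = mq e" "distinct (enum (mq e))" "length (enum (mq e)) = card (mq e)"
    using enum length_enum finS finT fin_mq by (metis finite_Int)+
  have "inj_on lift (mq e)" using lift_inj by (auto simp: mq_def inj_on_def)
  then have "distinct (map lift (enum (mq e)))" using en by (simp add: distinct_map)
  then show thesis using assms that en unfolding blks_def by (auto split: if_splits)
qed

lemma blks_sub:
  assumes "b \<in> set (blks e)" "e \<in> S" "y \<in> set (ws b)"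
  shows "y \<in> S \<and> y \<in> cl e"
  using assms(1,2)
  by (cases rule: blks_cases) (use assms in \<open>auto simp: S_def mq_def\<close>)

lemma blks_cover:
  assumes "e \<in> S" "y \<in> S" "y \<in> cl e"
  shows "\<exists>b\<in>set (blks e). y \<in> set (ws b)"
proof -
  have en: "set (enum (S \<inter> cl e)) = S \<inter> cl e" "set (enum (T \<inter> cl e)) = T \<inter> cl e" "set (enum (mq e)) = mq e"
    using enum finS finT fin_mq by (metis finite_Int)+
  have "y = e" if "\<not> crel e e" using assms that W_trans[of e y e] SW by (auto simp: cl_def)
  then show ?thesis using assms en by (auto simp: blks_def S_def mq_def)
qed

lemma blks_tagNone: "x' \<in> T \<Longrightarrow> e \<in> S \<Longrightarrow> x' \<in> cl e \<Longrightarrow> \<exists>b\<in>set (blks e). x' \<in> set (ws b) \<and> tag b = None"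
proof -
  assume *: "x' \<in> T" "e \<in> S" "x' \<in> cl e"
  have en: "set (enum (S \<inter> cl e)) = S \<inter> cl e" "set (enum (T \<inter> cl e)) = T \<inter> cl e"
    using enum finS finT by (metis finite_Int)+
  have "x' = e" if "\<not> crel e e" using * that W_trans[of e x' e] SW by (auto simp: cl_def)
  then show ?thesis using * en by (auto simp: blks_def S_def)
qed

text \<open>The choice depends only on the set of selected points in the cluster of
  \<open>y\<close>, so all of these receive the same representative.\<close>

definition rep :: "fm set \<Rightarrow> fm set" where
  "rep y = (SOME z. z \<in> S \<inter> cl y)"

lemma rep: "y \<in> S \<Longrightarrow> rep y \<in> S \<and> rep y \<in> cl y"
  unfolding rep_def using someI[of "\<lambda>z. z \<in> S \<inter> cl y" y] by auto

lemma rep_eq: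
  assumes "y \<in> S" "z \<in> S" "z \<in> cl y"
  shows "rep y = rep z"
proof -
  have "S \<inter> cl y = S \<inter> cl z" using cl_eq[OF SW] assms SW by blast
  then show ?thesis by (simp only: rep_def)
qed

lemma rep_distinct:
  assumes "e \<in> rep ` S" "e' \<in> rep ` S" "e' \<in> cl e"
  shows "e = e'"
proof -
  obtain y z where yz: "y \<in> S" "z \<in> S" "e = rep y" "e' = rep z" using assms by blast
  then have c: "e \<in> cl y" "e' \<in> cl z" "e \<in> S" "e' \<in> S" using rep by auto
  then have "e' \<in> cl y" using cl_trans[of y e e'] assms(3) SW yz by blast
  then have "z \<in> cl y" using cl_trans[of y e' z] cl_sym c SW yz by blast
  then show ?thesis using rep_eq yz by blast
qed

definition es :: "fm set list" where
  "es = (SOME es. set es = rep ` S \<and> distinct es \<and> sorted_wrt lt es)"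

lemma es: "set es = rep ` S" "distinct es" "sorted_wrt lt es"
proof -
  have "\<exists>es. set es = rep ` S \<and> distinct es \<and> sorted_wrt lt es"
  proof (rule sorted_enum)
    fix a b assume ab: "a \<in> rep ` S" "b \<in> rep ` S" "a \<noteq> b"
    then have "a \<in> W" "b \<in> W" using rep SW by auto
    moreover have "b \<notin> cl a" using rep_distinct ab by blast
    ultimately show "lt a b \<or> lt b a" using W_cases[of a b] by (auto simp: cl_def)
  next
    fix a b d assume "a \<in> rep ` S" "b \<in> rep ` S" "d \<in> rep ` S" "lt a b" "lt b d"
    then show "lt a d" using lt_trans[of a b d] rep SW by blast
  qed (use finS in simp)
  then show "set es = rep ` S" "distinct es" "sorted_wrt lt es"
    using someI_ex[of "\<lambda>es. set es = rep ` S \<and> distinct es \<and> sorted_wrt lt es"] unfolding es_def by blast+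
qed

lemma es_S: "e \<in> set es \<Longrightarrow> e \<in> S"
  using es(1) rep by auto

definition Bs :: "block list" where
  "Bs = concat (map blks es)"

lemma Bs_blks: "b \<in> set Bs \<longleftrightarrow> (\<exists>e\<in>set es. b \<in> set (blks e))"
  by (auto simp: Bs_def)

lemma Bs_cover:
  assumes "y \<in> S"
  shows "\<exists>b\<in>set Bs. y \<in> set (ws b)"
  using blks_cover[of "rep y" y] rep[OF assms] cl_sym assms es(1) Bs_blks by blast

lemma Bs_cover_T:
  assumes "y \<in> T"
  shows "\<exists>b\<in>set Bs. y \<in> set (ws b) \<and> tag b = None"
proof -
  have "y \<in> S" using assms by (simp add: S_def)
  then show ?thesis
    using blks_tagNone[of y "rep y"] rep[of y] cl_sym assms es(1) Bs_blks by blast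
qed

text \<open>Strict order with one exception: within a limit cluster the untagged summand precedes
  the tagged one.\<close>

definition before :: "block \<Rightarrow> block \<Rightarrow> bool" where
  "before b b' \<longleftrightarrow> (\<forall>y\<in>set (ws b). \<forall>z\<in>set (ws b').
     crel y z \<and> (crel z y \<longrightarrow> tag b = None \<and> tag b' \<noteq> None))"

lemma Bs_sorted: "sorted_wrt before Bs"
  unfolding Bs_def
proof (rule sorted_wrt_concat_map[OF _ es(3)]; intro ballI impI)
  fix e assume e: "e \<in> set es"
  have "before b b'" if r: "crel e e" and b: "b \<in> set (blks e)" "b' \<in> set (blks e)" "tag b = None" "tag b' \<noteq> None" for b b'
    unfolding before_def
  proof (intro ballI conjI impI)
    fix y z assume "y \<in> set (ws b)" "z \<in> set (ws b')"
    then have yz: "y \<in> S" "y \<in> cl e" "z \<in> S" "z \<in> cl e" using blks_sub b es_S[OF e] by blast+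
    then have "crel y e" "crel e z" using r by (auto simp: cl_def)
    then show "crel y z" using W_trans SW yz by blast
  qed (use b in auto)
  then show "sorted_wrt before (blks e)" unfolding blks_def by auto
next
  fix e e' b b' assume e: "e \<in> set es" "e' \<in> set es" "lt e e'" and b: "b \<in> set (blks e)" "b' \<in> set (blks e')"
  show "before b b'"
    unfolding before_def
  proof (intro ballI)
    fix y z assume "y \<in> set (ws b)" "z \<in> set (ws b')"
    then have "y \<in> S" "y \<in> cl e" "z \<in> S" "z \<in> cl e'" using blks_sub b es_S e by blast+
    then have "lt y z" using cl_lt[of e e' y z] SW es_S e by blast
    then show "crel y z \<and> (crel z y \<longrightarrow> tag b = None \<and> tag b' \<noteq> None)" by (simp add: lt_def)
  qed
qed

lemma Bs_before: "i < j \<Longrightarrow> j < length Bs \<Longrightarrow> before (Bs ! i) (Bs ! j)"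
  using sorted_wrt_nth_less[OF Bs_sorted] .

text \<open>The kind of a limit summand is chosen by a condition on all its points, but each single
  point decides it, since the limit behaviour is the same throughout a cluster.\<close>

lemma Bs_cases:
  assumes "b \<in> set Bs"
  obtains u where "\<not> crel u u" "u \<in> S" "b = (KP, None, [u])"
  | "kd b = KC" "tag b = None" "\<And>y. y \<in> set (ws b) \<Longrightarrow> crel y y \<and> dm W y"
  | "kd b \<in> {KD, KO}" "tag b = None" "\<And>y. y \<in> set (ws b) \<Longrightarrow> crel y y \<and> \<not> dm W y"
    "\<And>y. y \<in> set (ws b) \<Longrightarrow> limD W c y \<longleftrightarrow> kd b = KD" "set (ws b) \<subseteq> T"
  | q where "kd b \<in> {KD, KO}" "tag b = Some q" "\<And>y. y \<in> set (ws b) \<Longrightarrow> crel y y \<and> \<not> dm W y"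
    "\<And>s. s \<in> q \<Longrightarrow> limD F.W c s \<longleftrightarrow> kd b = KD" "q \<noteq> {}" "q \<subseteq> Q" "ws b = map lift (enum q)" "finite q"
    "set (ws b) = lift ` q" "\<And>s. s \<in> q \<Longrightarrow> crel s s \<and> \<not> dm F.W s"
    "\<And>s t. s \<in> q \<Longrightarrow> t \<in> Q \<Longrightarrow> t \<in> q \<longleftrightarrow> t \<in> cl s"
proof -
  obtain e where e: "e \<in> S" "b \<in> set (blks e)" using assms Bs_blks es_S by blast
  have eW: "e \<in> W" using e SW by blast
  have sub: "y \<in> W \<and> y \<in> cl e" if "y \<in> set (ws b)" for y using blks_sub[OF e(2,1) that] SW by blast
  have rf: "crel y y" if "crel e e" "y \<in> W" "y \<in> cl e" for y using that W_trans[of y e y] by (auto simp: cl_def)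
  from e(2,1) show thesis
  proof (cases rule: blks_cases)
    case 1
    then show ?thesis using that(1) e by blast
  next
    case 2
    show ?thesis
      by (rule that(2)) (use 2 sub rf cl_dm[OF eW] in blast)+
  next
    case 3
    have "limD W c y \<longleftrightarrow> kd b = KD" if y: "y \<in> set (ws b)" for y
    proof -
      have "limD W c y \<longleftrightarrow> (\<forall>y\<in>T \<inter> cl e. limD W c y)"
        using limD_cluster[OF eW] sub[OF y] 3(3) TW y 3(6) by blast
      then show ?thesis using 3(4) by simp
    qed
    moreover have "kd b \<in> {KD, KO}" using 3(4) by simp
    ultimately show ?thesis using that(3) 3 sub rf[OF 3(1)] cl_dm[OF eW] by blast
  next
    case 4
    have m: "s \<in> F.W \<and> lift s \<in> W \<and> lift s \<in> cl e" if "s \<in> mq e" for s using that QF lift_W by (auto simp: mq_def)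
    have st: "t \<in> mq e \<longleftrightarrow> t \<in> cl s" if s: "s \<in> mq e" and t: "t \<in> Q" for s t
    proof -
      have tF: "t \<in> F.W" "lift t \<in> W" using t QF lift_W by auto
      have "lift t \<in> cl e \<longleftrightarrow> lift t \<in> cl (lift s)"
        using cl_trans[OF eW _ tF(2), of "lift s"] cl_trans[OF _ eW tF(2), of "lift s"] m[OF s] cl_sym by blast
      also have "\<dots> \<longleftrightarrow> t \<in> cl s"
        using crel_lift m[OF s] tF lift_inj[OF t, of s] s by (auto simp: cl_def mq_def)
      finally show ?thesis using t by (simp add: mq_def)
    qed
    have r: "crel s s \<and> \<not> dm F.W s" if s: "s \<in> mq e" for s
      using m[OF s] rf[OF 4(1), of "lift s"] crel_lift cl_dm[OF eW, of "lift s"] 4(2) dm_lift by blast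
    have l: "limD F.W c s \<longleftrightarrow> kd b = KD" if s: "s \<in> mq e" for s
    proof -
      have "mq e \<subseteq> cl s" "mq e \<subseteq> F.W" using st[OF s] QF by (auto simp: mq_def)
      then have "limD F.W c s \<longleftrightarrow> (\<forall>s\<in>mq e. limD F.W c s)" using F.limD_cluster[of s] m[OF s] s by blast
      then show ?thesis using 4(4) by simp
    qed
    have k: "kd b \<in> {KD, KO}" "mq e \<subseteq> Q" using 4(4) by (auto simp: mq_def)
    have y: "crel y y \<and> \<not> dm W y" if "y \<in> set (ws b)" for y
      using sub[OF that] rf[OF 4(1)] cl_dm[OF eW] 4(2) by blast
    show ?thesis by (rule that(4)[OF k(1) 4(5) y l 4(3) k(2) 4(6) fin_mq 4(7) r st])
  qed
qed

lemma ws_S: "b \<in> set Bs \<Longrightarrow> y \<in> set (ws b) \<Longrightarrow> y \<in> S"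
  using Bs_blks blks_sub es_S by blast

lemma Un_ws: "(\<Union>b\<in>set Bs. set (ws b)) = S"
  using ws_S Bs_cover by blast

lemma S_supported:
  assumes "u \<in> S" "\<not> crel u u" "u \<noteq> x"
  shows "supported W c S u"
proof (cases "u \<in> T")
  case True
  then show ?thesis using Tsup[OF True] assms unfolding supported_def S_def by blast
next
  case False
  then obtain s where s: "s \<in> Q" "u = lift s" using assms(1) by (auto simp: S_def)
  then have "\<not> crel s s" using crel_lift assms QF by blast
  moreover have "s \<noteq> pr x" using irr_lift[of x] s assms calculation by auto
  ultimately have "supported W c (lift ` Q) u"
    using supported_up[OF _ _ QF Qsup] s QF by blast
  then show ?thesis unfolding supported_def S_def by blast
qed

sublocale blocks L X x c Bs
proof
  show "Bs \<noteq> []" using Bs_cover_T[OF xT] by auto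
next
  fix b assume b: "b \<in> set Bs"
  then obtain e where e: "b \<in> set (blks e)" "e \<in> S" using Bs_blks es_S by blast
  show "ws b \<noteq> []" "distinct (ws b)"
    using e by (cases rule: blks_cases; force)+
  fix y assume y: "y \<in> set (ws b)"
  then show "y \<in> W" using ws_S b SW by blast
  show "kd b = KC \<Longrightarrow> dm W y" "\<not> reg b \<Longrightarrow> \<not> dm W y"
    using b by (cases rule: Bs_cases; use y in auto)+
  show "limD W c y" if k: "kd b = KD"
    using b
  proof (cases rule: Bs_cases)
    case (4 q)
    then show ?thesis using limD_up y k QF by auto
  qed (use k y in auto)
  show "limI W y" if k: "kd b = KO"
    using b
  proof (cases rule: Bs_cases)
    case 3
    then show ?thesis using lim_cases[OF \<open>y \<in> W\<close>, of c] y k by auto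
  next
    case (4 q)
    then obtain s where s: "s \<in> q" "y = lift s" using y by auto
    have sF: "s \<in> F.W" using subsetD[OF 4(6) s(1)] QF by blast
    have "\<not> limD F.W c s" using 4(4)[OF s(1)] k by simp
    then have "limI F.W s" using F.lim_cases[OF sF, of c] 4(10)[OF s(1)] by blast
    then show ?thesis using limI_up[OF sF] s(2) by simp
  qed (use k in auto)
next
  fix b assume b: "b \<in> set Bs" "kd b = KP"
  show "\<exists>u. ws b = [u] \<and> \<not> crel u u" using b(1) by (cases rule: Bs_cases) (use b in auto)
next
  fix b y z assume b: "b \<in> set Bs" "kd b \<noteq> KP" and yz: "y \<in> set (ws b)" "z \<in> set (ws b)"
  obtain e where e: "b \<in> set (blks e)" "e \<in> S" using Bs_blks es_S b by blast
  have "y \<in> W" "y \<in> cl e" "z \<in> W" "z \<in> cl e" "e \<in> W" using blks_sub e yz SW by blast+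
  moreover have "crel e e" using e by (cases rule: blks_cases) (use b in auto)
  ultimately show "crel y z" using W_trans unfolding cl_def by blast
next
  fix i j y z assume ij: "i < j" "j < length Bs" and yz: "y \<in> set (ws (Bs ! i))" "z \<in> set (ws (Bs ! j))"
  have "before (Bs ! i) (Bs ! j)" using Bs_before ij .
  then have *: "crel y z \<and> (crel z y \<longrightarrow> tag (Bs ! i) = None \<and> tag (Bs ! j) \<noteq> None)"
    using yz by (simp add: before_def)
  then show "crel y z" by blast
  have b: "Bs ! j \<in> set Bs" using ij by simp
  show "\<not> crel z y" if r: "reg (Bs ! i)" "reg (Bs ! j)"
  proof -
    have "tag (Bs ! j) = None" using b by (cases rule: Bs_cases) (use r in auto)
    then show ?thesis using * by blast
  qed
next
  fix b u assume b: "b \<in> set Bs" "ws b = [u]" "kd b = KP" "u \<noteq> x"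
  have "u \<in> S" using ws_S b by auto
  moreover have "\<not> crel u u" using b(1) by (cases rule: Bs_cases) (use b in auto)
  ultimately show "supported W c (\<Union>b\<in>set Bs. set (ws b)) u" using S_supported b unfolding Un_ws by blast
next
  fix b y b' u
  assume b: "b \<in> set Bs" "y \<in> set (ws b)" "\<not> dm W y" and b': "b' \<in> set Bs" "kd b' = KP" "ws b' = [u]"
    and yu: "lt y u" and int: "\<And>z. z \<in> W \<Longrightarrow> lt y z \<Longrightarrow> lt z u \<Longrightarrow> deep W c z"
  have "u \<in> set (ws b')" using b' by simp
  then have W: "y \<in> W" "u \<in> W" using ws_S b b' SW by blast+
  show "kd b = KD"
    using b(1)
  proof (cases rule: Bs_cases)
    case (1 v)
    then show ?thesis using b irr_dm W by auto
  next
    case 2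
    then show ?thesis using b by blast
  next
    case 3
    then show ?thesis using limD_interval[OF W(1) b(3) W(2) yu int] b by blast
  next
    case (4 q)
    then obtain s where s: "s \<in> q" "y = lift s" using b by auto
    then have sF: "s \<in> F.W" "crel s s" using 4 QF by auto
    \<comment> \<open>The kind of a tagged summand was decided over \<open>Y\<close>, so the depth
      of the gap has to be brought there. The hypothesis on the lift holds because \<open>y\<close>
      is itself a lift.\<close>
    have "limD F.W c (pr y)"
      by (rule limD_down[OF W(1) b(3) _ W(2) yu int]) (use s sF pr_lift crel_lift in auto)
    then show ?thesis using 4 s sF pr_lift by auto
  qed
next
  obtain y where y: "y \<in> T" "dm W y" "\<forall>z\<in>W. z = y \<or> crel z y" using Tfin by blast
  then obtain b where b: "b \<in> set Bs" "y \<in> set (ws b)" using Bs_cover_T by blast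
  have "reg b" using b(1) by (cases rule: Bs_cases) (use b y in auto)
  then show "\<exists>b\<in>set Bs. reg b \<and> (\<exists>y\<in>set (ws b). \<forall>z\<in>W. z = y \<or> crel z y)" using b y by blast
qed

text \<open>The summands of one cluster use at most its points in \<open>T\<close> and the types of
  \<open>Q\<close> lifted into it, and these are disjoint for different clusters.\<close>

lemma size_Bs: "(\<Sum>b\<leftarrow>Bs. length (ws b)) \<le> card T + card Q"
proof -
  have R: "set es \<subseteq> S" using es_S by blast
  have one: "(\<Sum>b\<leftarrow>blks e. length (ws b)) \<le> card (T \<inter> cl e) + card (mq e)" if e: "e \<in> S" for e
  proof -
    have "S \<inter> cl e = (T \<inter> cl e) \<union> lift ` mq e" by (auto simp: S_def mq_def)
    then have le: "card (S \<inter> cl e) \<le> card (T \<inter> cl e) + card (mq e)"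
      using card_Un_le[of "T \<inter> cl e" "lift ` mq e"] card_image_le[OF fin_mq, of lift e] by simp
    have "e \<in> S \<inter> cl e" using e by simp
    then have "1 \<le> card (S \<inter> cl e)" using finS by (metis One_nat_def Suc_leI card_gt_0_iff empty_iff finite_Int)
    then show ?thesis
      using le length_enum[of "S \<inter> cl e"] length_enum[of "T \<inter> cl e"] length_enum[OF fin_mq, of e] finS finT
      by (auto simp: blks_def)
  qed
  have "(\<Sum>b\<leftarrow>Bs. length (ws b)) = (\<Sum>e\<leftarrow>es. \<Sum>b\<leftarrow>blks e. length (ws b))"
  proof -
    have "(\<Sum>b\<leftarrow>concat (map blks xs). length (ws b)) = (\<Sum>e\<leftarrow>xs. \<Sum>b\<leftarrow>blks e. length (ws b))" for xs
      by (induction xs) auto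
    then show ?thesis by (simp add: Bs_def)
  qed
  also have "\<dots> = (\<Sum>e\<in>set es. \<Sum>b\<leftarrow>blks e. length (ws b))"
    using es(2) by (simp add: sum_list_distinct_conv_sum_set)
  also have "\<dots> \<le> (\<Sum>e\<in>set es. card (T \<inter> cl e) + card (mq e))" using one R by (intro sum_mono) auto
  also have "\<dots> = (\<Sum>e\<in>set es. card (T \<inter> cl e)) + (\<Sum>e\<in>set es. card (mq e))" by (rule sum.distrib)
  also have "\<dots> \<le> card T + card Q"
  proof (rule add_mono)
    have disj: "cl e \<inter> cl e' \<inter> W = {}" if "e \<in> set es" "e' \<in> set es" "e \<noteq> e'" for e e'
    proof (rule ccontr)
      assume "cl e \<inter> cl e' \<inter> W \<noteq> {}"
      then obtain y where y: "y \<in> cl e" "y \<in> cl e'" "y \<in> W" by blast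
      have "e \<in> W" "e' \<in> W" using es_S that SW by blast+
      then have "e' \<in> cl e" using cl_trans[of e y e'] cl_sym[OF y(2)] y by blast
      then show False using rep_distinct[of e e'] that unfolding es(1) by blast
    qed
    have "(\<Sum>e\<in>set es. card (T \<inter> cl e)) = card (\<Union>e\<in>set es. T \<inter> cl e)"
      by (subst card_UN_disjoint) (use finT disj TW in \<open>simp_all, blast\<close>)
    also have "\<dots> \<le> card T" using finT by (intro card_mono) auto
    finally show "(\<Sum>e\<in>set es. card (T \<inter> cl e)) \<le> card T" .
    have "mq e \<inter> mq e' = {}" if "e \<in> set es" "e' \<in> set es" "e \<noteq> e'" for e e'
      using disj[OF that] QF lift_W by (auto simp: mq_def)
    then have "(\<Sum>e\<in>set es. card (mq e)) = card (\<Union>e\<in>set es. mq e)"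
      by (subst card_UN_disjoint) (use fin_mq in auto)
    also have "\<dots> \<le> card Q" using finQ by (intro card_mono) (auto simp: mq_def)
    finally show "(\<Sum>e\<in>set es. card (mq e)) \<le> card Q" .
  qed
  finally show ?thesis .
qed

end

section \<open>Bisimilarity and the bound\<close>

type_synonym label = "(fm set set \<times> nat) option"

text \<open>An ordinary point carries no label; the point \<open>PB n\<close> of a tagged block with tag \<open>q\<close> has to be
  matched with the point \<open>PB n\<close> of the block with the same tag and is labelled with \<open>(q, n)\<close>. The
  following predicate describes accessibility of points with given types and labels
  independently of the model.\<close>

fun sees :: "fm set set \<Rightarrow> nat \<Rightarrow> fm set \<Rightarrow> label \<Rightarrow> fm set \<Rightarrow> label \<Rightarrow> bool" where
  "sees W c t m s None \<longleftrightarrow> crel t s \<and> \<not> (\<exists>q n. m = Some (q, n) \<and> s \<in> q)"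
| "sees W c t (Some (q', n')) s (Some (q, n)) \<longleftrightarrow>
     (if q' = q then n < n' \<or> n = n' \<and> \<not> (\<forall>s\<in>q. limD W c s) else crel t s)"
| "sees W c t None s (Some (q, n)) \<longleftrightarrow> crel t s"

text \<open>Constrains the occurring pairs of type and label in terms of \<open>Q\<close> and the
  frame over \<open>Y\<close> only, so that a pair found in one sum can be realised in the
  other.\<close>

definition admissible :: "fm set set \<Rightarrow> fm set set \<Rightarrow> fm set \<Rightarrow> label \<Rightarrow> bool" where
  "admissible W Q s l \<longleftrightarrow> s \<in> Q \<and> (\<forall>q n. l = Some (q, n) \<longrightarrow>
     (\<exists>t\<in>Q. \<not> dm W t \<and> q = {u \<in> Q. u \<in> cl t}) \<and> s = enum q ! (n mod card q))"

context build
begin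

section \<open>Types and labels in one sum\<close>

definition lab :: "nat \<times> point \<Rightarrow> label" where
  "lab p = (case snd p of PA i \<Rightarrow> None | PB n \<Rightarrow> map_option (\<lambda>q. (q, n)) (tag (Bs ! fst p)))"

lemma lab_Some: "lab p = Some (q, n) \<longleftrightarrow> snd p = PB n \<and> tag (Bs ! fst p) = Some q"
  by (auto simp: lab_def split: point.splits)

lemma tagged:
  assumes "b \<in> set Bs" "tag b = Some q"
  shows "\<not> reg b" "\<And>s. s \<in> q \<Longrightarrow> q = {u \<in> Q. u \<in> cl s}" "q \<noteq> {}" "q \<subseteq> Q" "ws b = map lift (enum q)"
    "set (ws b) = lift ` q" "length (ws b) = card q" "kd b = KD \<longleftrightarrow> (\<forall>s\<in>q. limD F.W c s)"
    "\<And>s. s \<in> q \<Longrightarrow> crel s s \<and> \<not> dm F.W s" "\<And>i. i < card q \<Longrightarrow> enum q ! i \<in> q" "0 < card q"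
proof -
  have "\<not> reg b \<and> (\<forall>s\<in>q. q = {u \<in> Q. u \<in> cl s}) \<and> q \<noteq> {} \<and> q \<subseteq> Q \<and> ws b = map lift (enum q) \<and>
    set (ws b) = lift ` q \<and> finite q \<and> (kd b = KD \<longleftrightarrow> (\<forall>s\<in>q. limD F.W c s)) \<and>
    (\<forall>s\<in>q. crel s s \<and> \<not> dm F.W s)"
    using assms(1)
  proof (cases rule: Bs_cases)
    case (4 r)
    then have "r = q" using assms(2) by simp
    note 4 = 4[unfolded this]
    have "q = {u \<in> Q. u \<in> cl s}" if "s \<in> q" for s using 4(11)[OF that] 4(6) by blast
    then show ?thesis using 4(1,4-10) by auto
  qed (use assms(2) in auto)
  note * = this
  show "\<not> reg b" "\<And>s. s \<in> q \<Longrightarrow> q = {u \<in> Q. u \<in> cl s}" "q \<noteq> {}" "q \<subseteq> Q" "ws b = map lift (enum q)"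
    "set (ws b) = lift ` q" "kd b = KD \<longleftrightarrow> (\<forall>s\<in>q. limD F.W c s)"
    "\<And>s. s \<in> q \<Longrightarrow> crel s s \<and> \<not> dm F.W s" using * by blast+
  have f: "finite q" using * by blast
  show "length (ws b) = card q" using * length_enum[OF f] by simp
  show "\<And>i. i < card q \<Longrightarrow> enum q ! i \<in> q" using enum[OF f] length_enum[OF f] by (metis nth_mem)
  show "0 < card q" using * f by (simp add: card_gt_0_iff)
qed

lemma tagged_g:
  assumes p: "p \<in> worlds N" and l: "lab p = Some (q, n)"
  shows "pr (g p) = enum q ! (n mod card q)" "pr (g p) \<in> q" "g p = lift (pr (g p))"
proof -
  have t: "snd p = PB n" "tag (Bs ! fst p) = Some q" using l lab_Some by blast+
  note q = tagged[OF blk[OF p] t(2)]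
  have m: "n mod card q < card q" using q(11) by simp
  then have e: "enum q ! (n mod card q) \<in> q" "enum q ! (n mod card q) \<in> F.W" using q(10,4) QF by blast+
  have "length (enum q) = card q" using q(5,7) by simp
  then have "g p = lift (enum q ! (n mod card q))"
    using t(1) m by (simp add: g_def bpt_def q(5))
  then show "pr (g p) = enum q ! (n mod card q)" "pr (g p) \<in> q" "g p = lift (pr (g p))"
    using e pr_lift by auto
qed

lemma pr_Q: "p \<in> worlds N \<Longrightarrow> pr (g p) \<in> Q"
proof -
  assume p: "p \<in> worlds N"
  have "g p \<in> S" using ws_S[OF blk[OF p] g_ws[OF p]] .
  then show ?thesis using TQ pr_lift QF by (auto simp: S_def)
qed

lemma admissible_N: "p \<in> worlds N \<Longrightarrow> admissible F.W Q (pr (g p)) (lab p)"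
  unfolding admissible_def
proof (intro conjI allI impI)
  assume p: "p \<in> worlds N"
  then show "pr (g p) \<in> Q" by (rule pr_Q)
  fix q n assume l: "lab p = Some (q, n)"
  then have t: "tag (Bs ! fst p) = Some q" using lab_Some by blast
  note q = tagged[OF blk[OF p] t]
  obtain s where "s \<in> q" using q(3) by blast
  then show "\<exists>t\<in>Q. \<not> dm F.W t \<and> q = {u \<in> Q. u \<in> cl t}" using q(2,4,9) by blast
  show "pr (g p) = enum q ! (n mod card q)" using tagged_g(1)[OF p l] .
qed

lemma tag_unique:
  assumes "i < length Bs" "j < length Bs" "tag (Bs ! i) = Some q" "tag (Bs ! j) = Some q"
  shows "i = j"
proof (rule ccontr)
  assume "i \<noteq> j"
  have *: False if ij: "i < j" "j < length Bs" "tag (Bs ! i) = Some q" "tag (Bs ! j) = Some q" for i j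
  proof -
    have b: "Bs ! i \<in> set Bs" "Bs ! j \<in> set Bs" using ij by auto
    obtain s where s: "s \<in> q" using tagged(3)[OF b(1) ij(3)] by blast
    then have m: "lift s \<in> set (ws (Bs ! i))" "lift s \<in> set (ws (Bs ! j))" using tagged(6) b ij by blast+
    have "crel (lift s) (lift s)" using cluster[OF b(1) _ m(1) m(1)] tagged(1)[OF b(1) ij(3)] by blast
    then show False using Bs_before[OF ij(1,2)] m ij(3) unfolding before_def by auto
  qed
  show False using *[of i j] *[of j i] assms \<open>i \<noteq> j\<close> by linarith
qed

text \<open>The point of lifting all of \<open>Q\<close>: every limit cluster of types has its
  tagged summand in either sum, whichever selection it stems from.\<close>

lemma main_block:
  assumes s: "s \<in> Q" "\<not> dm F.W s"
  obtains j where "j < length Bs" "tag (Bs ! j) = Some {u \<in> Q. u \<in> cl s}" "s \<in> {u \<in> Q. u \<in> cl s}"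
proof -
  have sF: "s \<in> F.W" using s QF by blast
  have lS: "lift s \<in> S" "lift s \<in> W" using s lift_W sF by (auto simp: S_def)
  let ?e = "rep (lift s)"
  have e: "?e \<in> S" "?e \<in> cl (lift s)" "?e \<in> W" using rep[OF lS(1)] SW by auto
  have nd: "\<not> dm W ?e" using cl_dm[OF lS(2) e(3,2)] dm_lift[OF sF] s by blast
  have "crel ?e ?e" using not_dm_refl e nd by blast
  moreover have m: "s \<in> mq ?e" using s cl_sym[OF e(2)] by (simp add: mq_def)
  ultimately have "(if \<forall>s\<in>mq ?e. limD F.W c s then KD else KO, Some (mq ?e), map lift (enum (mq ?e))) \<in> set (blks ?e)"
    using nd by (auto simp: blks_def)
  then have "\<exists>b\<in>set (blks ?e). tag b = Some (mq ?e)" by (rule bexI[rotated]) simp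
  then obtain b where b: "b \<in> set (blks ?e)" "tag b = Some (mq ?e)" by blast
  then have bB: "b \<in> set Bs" using Bs_blks es(1) lS(1) by blast
  then obtain j where j: "j < length Bs" "Bs ! j = b" by (auto simp: in_set_conv_nth)
  have "mq ?e = {u \<in> Q. u \<in> cl s}" using tagged(2)[OF bB b(2) m] .
  then show thesis using that[of j] j b s by auto
qed

text \<open>The exclusion built into \<open>sees\<close> is met since a b-point of a tagged summand
  does not see the a-points of that summand, while later summands lie strictly after the lifts,
  which are last preimages of their types.\<close>

lemma acc_sees:
  assumes p: "p \<in> worlds N" "p' \<in> worlds N" and a: "acc N p p'"
  shows "sees F.W c (pr (g p)) (lab p) (pr (g p')) (lab p')"
proof -
  have cr: "crel (pr (g p)) (pr (g p'))" using pr_mono g_mono p a by blast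
  have nth: "fst p < fst p' \<or> fst p = fst p' \<and> bacc (Bs ! fst p) (snd p) (snd p')"
    using a unfolding N_acc[OF p(1)] .
  show ?thesis
  proof (cases "lab p'")
    case None
    have "pr (g p') \<notin> q" if l: "lab p = Some (q, n)" for q n
    proof
      assume s: "pr (g p') \<in> q"
      have t: "snd p = PB n" "tag (Bs ! fst p) = Some q" using l lab_Some by blast+
      note q = tagged[OF blk[OF p(1)] t(2)]
      from nth show False
      proof
        assume "fst p = fst p' \<and> bacc (Bs ! fst p) (snd p) (snd p')"
        then have "fst p = fst p'" "bacc (Bs ! fst p) (PB n) (snd p')" using t by auto
        then show False using None t(2) bacc_simps(4)[OF q(1)] by (cases "snd p'") (auto simp: lab_def)
      next
        assume lt: "fst p < fst p'"
        let ?s = "pr (g p')"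
        have sF: "?s \<in> F.W" using pr_W g_W p by blast
        have m: "lift ?s \<in> set (ws (Bs ! fst p))" using s q(6) by blast
        have bf: "before (Bs ! fst p) (Bs ! fst p')" using Bs_before lt p(2) N_worlds by blast
        then have "crel (lift ?s) (g p')" "\<not> crel (g p') (lift ?s)"
          using m g_ws[OF p(2)] t(2) unfolding before_def by auto
        then show False using lift_max[OF sF g_W[OF p(2)]] by blast
      qed
    qed
    then show ?thesis using None cr by auto
  next
    case (Some l)
    obtain q n where l: "lab p' = Some (q, n)" using Some by (cases l) auto
    show ?thesis
    proof (cases "lab p")
      case None
      then show ?thesis using l cr by simp
    next
      case (Some m)
      obtain q' n' where m: "lab p = Some (q', n')" using Some by (cases m) auto
      show ?thesis
      proof (cases "q' = q")
        case True
        have t: "snd p = PB n'" "tag (Bs ! fst p) = Some q" "snd p' = PB n" "tag (Bs ! fst p') = Some q"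
          using l m True lab_Some by auto
        note q = tagged[OF blk[OF p(1)] t(2)]
        have "fst p = fst p'" using tag_unique t(2,4) p N_worlds by blast
        then have b: "bacc (Bs ! fst p) (PB n') (PB n)" using nth t by auto
        have "n < n' \<or> n = n' \<and> \<not> (\<forall>s\<in>q. limD F.W c s)"
        proof (cases "kd (Bs ! fst p) = KD")
          case True
          then show ?thesis using b bacc_simps(5) by blast
        next
          case False
          then have "kd (Bs ! fst p) = KO" using q(1) by (cases "kd (Bs ! fst p)") auto
          then show ?thesis using b bacc_simps(6) q(8) False by auto
        qed
        then show ?thesis using l m True by simp
      qed (use l m cr in simp)
    qed
  qed
qed

text \<open>A \<open>dm\<close> type is found in a regular summand; any other is found in its tagged
  summand, at an a-point or at the b-point with the given number. When the type of \<open>p\<close>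
  sees \<open>s\<close>, that summand does not precede \<open>p\<close>: otherwise
  \<open>g p\<close> would lie strictly after \<open>lift s\<close>, which it sees.\<close>

lemma sees_acc:
  assumes p: "p \<in> worlds N" and ad: "admissible F.W Q s l" and se: "sees F.W c (pr (g p)) (lab p) s l"
  shows "\<exists>p'\<in>worlds N. pr (g p') = s \<and> lab p' = l \<and> acc N p p'"
proof -
  have sQ: "s \<in> Q" and sF: "s \<in> F.W" using ad QF by (auto simp: admissible_def)
  have gW: "g p \<in> W" using g_W p .
  have later: "\<not> j < fst p"
    if j: "j < length Bs" "tag (Bs ! j) \<noteq> None" "lift s \<in> set (ws (Bs ! j))" and cr: "crel (pr (g p)) s" for j
  proof
    assume "j < fst p"
    then have "before (Bs ! j) (Bs ! fst p)" using Bs_before p N_worlds by blast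
    then have "\<forall>y\<in>set (ws (Bs ! j)). \<forall>z\<in>set (ws (Bs ! fst p)). crel z y \<longrightarrow> tag (Bs ! j) = None"
      unfolding before_def by blast
    then have "crel (g p) (lift s) \<longrightarrow> tag (Bs ! j) = None" using j(3) g_ws[OF p] by blast
    then have "\<not> crel (g p) (lift s)" using j(2) by blast
    then show False using crel_lift_iff[OF gW sF] cr by blast
  qed
  show ?thesis
  proof (cases l)
    case None
    then have cr: "crel (pr (g p)) s" and nq: "\<And>q n. lab p = Some (q, n) \<Longrightarrow> s \<notin> q" using se by auto
    show ?thesis
    proof (cases "dm F.W s")
      case True
      have "lift s \<in> S" using sQ by (simp add: S_def)
      then obtain b where b: "b \<in> set Bs" "lift s \<in> set (ws b)" using Bs_cover by blast
      have "dm W (lift s)" using dm_lift sF True by blast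
      then have r: "reg b" using nreg b by blast
      obtain j i where j: "(j, PA i) \<in> worlds N" "g (j, PA i) = lift s" "Bs ! j = b" using point_of[OF b] by metis
      have "acc N p (j, PA i)" using acc_regI[OF p j(1)] j r crel_lift_iff[OF gW sF] cr by simp
      moreover have "lab (j, PA i) = None" by (simp add: lab_def)
      ultimately show ?thesis using j None pr_lift sF by metis
    next
      case False
      obtain j where j: "j < length Bs" "tag (Bs ! j) = Some {u \<in> Q. u \<in> cl s}" "s \<in> {u \<in> Q. u \<in> cl s}"
        using main_block[OF sQ False] by blast
      have bB: "Bs ! j \<in> set Bs" using j by simp
      note q = tagged[OF bB j(2)]
      have ls: "lift s \<in> set (ws (Bs ! j))" using q(6) j(3) by blast
      then obtain i where i: "i < length (ws (Bs ! j))" "ws (Bs ! j) ! i = lift s" by (auto simp: in_set_conv_nth)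
      let ?p = "(j, PA i)"
      have pN: "?p \<in> worlds N" using i j by (simp add: N_worlds bworlds_def)
      have gp: "g ?p = lift s" using i by (simp add: g_def bpt_def)
      have "acc N p ?p"
      proof (cases "fst p = j")
        case True
        have "\<exists>k. snd p = PA k"
        proof (cases "snd p")
          case (PB n)
          then have "lab p = Some ({u \<in> Q. u \<in> cl s}, n)" using lab_Some True j(2) by blast
          then show ?thesis using nq j(3) by blast
        qed auto
        then show ?thesis using N_acc[OF p] True bacc_simps(3)[OF q(1)] by auto
      next
        case False
        then show ?thesis using later[OF j(1) _ ls cr] j(2) N_acc[OF p] by auto
      qed
      moreover have "lab ?p = None" by (simp add: lab_def)
      ultimately show ?thesis using pN gp None pr_lift sF by metis
    qed
  next
    case (Some ln)
    obtain q n where l: "l = Some (q, n)" using Some by (cases ln) auto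
    obtain t where t: "t \<in> Q" "\<not> dm F.W t" "q = {u \<in> Q. u \<in> cl t}" and sn: "s = enum q ! (n mod card q)"
      using ad l by (auto simp: admissible_def)
    obtain j where j: "j < length Bs" "tag (Bs ! j) = Some q" using main_block[OF t(1,2)] t(3) by metis
    have bB: "Bs ! j \<in> set Bs" using j by simp
    note q = tagged[OF bB j(2)]
    have sq: "s \<in> q" using sn q(10,11) by simp
    have ls: "lift s \<in> set (ws (Bs ! j))" using q(6) sq by blast
    let ?p = "(j, PB n)"
    have pN: "?p \<in> worlds N" using j q(1) by (simp add: N_worlds bworlds_def)
    have lp: "lab ?p = Some (q, n)" using lab_Some j by simp
    have gp: "pr (g ?p) = s" using tagged_g(1)[OF pN lp] sn by simp
    have "acc N p ?p"
    proof (cases "\<exists>n'. lab p = Some (q, n')")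
      case True
      then obtain n' where n': "lab p = Some (q, n')" by blast
      then have tp: "snd p = PB n'" "tag (Bs ! fst p) = Some q" using lab_Some by blast+
      then have e: "fst p = j" using tag_unique[OF _ j(1) _ j(2)] p N_worlds by blast
      have "n < n' \<or> n = n' \<and> \<not> (\<forall>s\<in>q. limD F.W c s)" using se n' l by simp
      then have "bacc (Bs ! j) (PB n') (PB n)"
        using q(1,8) bacc_simps(5,6)[of "Bs ! j" n' n] by (cases "kd (Bs ! j)") auto
      then show ?thesis using N_acc[OF p] tp e by simp
    next
      case False
      then have cr: "crel (pr (g p)) s" using se l by (cases "lab p") auto
      show ?thesis
      proof (cases "fst p = j")
        case True
        have "\<exists>k. snd p = PA k"
        proof (cases "snd p")
          case (PB n')
          then have "lab p = Some (q, n')" using lab_Some True j(2) by blast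
          then show ?thesis using False by blast
        qed auto
        then show ?thesis using N_acc[OF p] True bacc_simps(3)[OF q(1)] by auto
      next
        case False
        then show ?thesis using later[OF j(1) _ ls cr] j(2) N_acc[OF p] by auto
      qed
    qed
    then show ?thesis using pN gp lp l by blast
  qed
qed

text \<open>The copy of \<open>x\<close> in an untagged summand is taken: nothing of its own cluster
  precedes that summand, and without labels the roots of the two sums can be matched.\<close>

lemma root_point:
  obtains p where "p \<in> worlds N" "g p = x" "lab p = None" "is_root N p"
proof -
  obtain b where b: "b \<in> set Bs" "x \<in> set (ws b)" "tag b = None" using Bs_cover_T[OF xT] by blast
  obtain j i where j: "j < length Bs" "Bs ! j = b" "(j, PA i) \<in> worlds N" "g (j, PA i) = x"
    using point_of[OF b(1,2)] by metis
  let ?p = "(j, PA i)"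
  have "acc N ?p q" if q: "q \<in> worlds N" "q \<noteq> ?p" for q
  proof (rule ccontr)
    assume na: "\<not> acc N ?p q"
    then have "acc N q ?p" using N_total[OF j(3) q(1)] q(2) by blast
    then have e: "\<not> j < fst q" and nb: "fst q = j \<Longrightarrow> \<not> bacc (Bs ! j) (PA i) (snd q)"
      using na N_acc[OF j(3)] by auto
    have xq: "g q = x \<or> crel x (g q)" using W_root[OF g_W[OF q(1)]] by blast
    show False
    proof (cases "fst q = j")
      case True
      show False
      proof (cases "kd b = KP")
        case k: True
        then obtain u where "ws b = [u]" using KP b by blast
        then have "q = ?p" using j(3) q(1) True k j(2) by (cases q) (auto simp: N_worlds bworlds_def)
        then show False using q by blast
      next
        case False
        then show False using nb[OF True] bacc_simps(2,3)[of "Bs ! j"] j(2) by (cases "kd b") auto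
      qed
    next
      case False
      then have lt: "fst q < j" using e by linarith
      then have bf: "before (Bs ! fst q) b" using Bs_before j by blast
      then have "crel (g q) x" "\<not> crel x (g q)" using g_ws[OF q(1)] b unfolding before_def by blast+
      then show False using xq by auto
    qed
  qed
  then have "is_root N ?p" using j(3) by (auto simp: is_root_def)
  then show thesis using that[OF j(3,4)] by (simp add: lab_def)
qed

lemma simple_seq: "simple_atomic_seq X (bseq Bs)"
proof -
  have "atomic_for X (atom b)" if b: "b \<in> set Bs" for b
  proof -
    have l: "0 < length (ws b)" using ws_ne b by simp
    have "length (ws b) \<le> 2 ^ card X" if "kd b \<noteq> KP"
    proof -
      have "card (set (ws b)) \<le> 2 ^ card X"
        using cluster_card[of "set (ws b)"] ws_W[OF b] cluster[OF b that] by blast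
      then show ?thesis using distinct_card[OF ws_dist[OF b]] by simp
    qed
    then show ?thesis using l by (cases "kd b") (auto simp: atom_def)
  qed
  moreover have "simple_model X (atomic_frame (atom b), bval b)" if "b \<in> set Bs" for b
    using bseq_simple ws_ne that by blast
  ultimately show ?thesis by (auto simp: simple_atomic_seq_def bseq_def seq_models_def)
qed

end

context canon
begin

section \<open>The initial selection and its size\<close>

definition mx :: "fm \<Rightarrow> fm set" where
  "mx \<psi> = (SOME y. y \<in> W \<and> \<psi> \<in> y \<and> (\<forall>z\<in>W. crel y z \<longrightarrow> \<psi> \<in> z \<longrightarrow> crel z y))"

lemma mx:
  assumes "y \<in> W" "\<psi> \<in> y"
  shows "mx \<psi> \<in> W" "\<psi> \<in> mx \<psi>" "dm W (mx \<psi>)" "y = mx \<psi> \<or> crel y (mx \<psi>)"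
proof -
  have "\<exists>y. y \<in> W \<and> \<psi> \<in> y \<and> (\<forall>z\<in>W. crel y z \<longrightarrow> \<psi> \<in> z \<longrightarrow> crel z y)"
    using ex_max[of y "{\<psi>}"] assms by auto
  then have m: "mx \<psi> \<in> W" "\<psi> \<in> mx \<psi>" "\<And>z. z \<in> W \<Longrightarrow> crel (mx \<psi>) z \<Longrightarrow> \<psi> \<in> z \<Longrightarrow> crel z (mx \<psi>)"
    unfolding mx_def using someI_ex[of "\<lambda>y. y \<in> W \<and> \<psi> \<in> y \<and> (\<forall>z\<in>W. crel y z \<longrightarrow> \<psi> \<in> z \<longrightarrow> crel z y)"]
    by blast+
  show "mx \<psi> \<in> W" "\<psi> \<in> mx \<psi>" using m by auto
  show "dm W (mx \<psi>)" using m by (auto simp: dm_def)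
  show "y = mx \<psi> \<or> crel y (mx \<psi>)" using W_linear[OF assms(1) m(1)] m(3) assms by blast
qed

text \<open>\<open>Top\<close> is included for a last point of the whole model, which puts the final
  cluster into the selection.\<close>

definition base :: "fm set \<Rightarrow> fm set set" where
  "base \<Phi> = insert x (mx ` {\<psi> \<in> insert Top \<Phi>. \<exists>y\<in>W. \<psi> \<in> y})"

lemma base_W: "base \<Phi> \<subseteq> W"
  using mx(1) by (auto simp: base_def)

lemma base_finite: "finite \<Phi> \<Longrightarrow> finite (base \<Phi>)"
  by (simp add: base_def)

lemma base_card:
  assumes "finite \<Phi>"
  shows "card (base \<Phi>) \<le> card \<Phi> + 2"
proof -
  let ?A = "{\<psi> \<in> insert Top \<Phi>. \<exists>y\<in>W. \<psi> \<in> y}"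
  have "card (mx ` ?A) \<le> card ?A" using assms by (intro card_image_le) simp
  also have "\<dots> \<le> card (insert Top \<Phi>)" using assms by (intro card_mono) auto
  also have "\<dots> \<le> card \<Phi> + 1" by (simp add: card_insert_le_m1 assms card_insert_if)
  finally show ?thesis using assms by (simp add: base_def card_insert_if)
qed

lemma base_final: "\<exists>y\<in>base \<Phi>. dm W y \<and> (\<forall>z\<in>W. z = y \<or> crel z y)"
proof -
  have t: "Top \<in> z" if "z \<in> W" for z using mcs_Top W_mcs that by blast
  have "mx Top \<in> base \<Phi>" using t x_in_W unfolding base_def by blast
  then show ?thesis using mx(3)[OF x_in_W t] mx(4)[OF _ t] x_in_W by blast
qed

lemma base_mx: "\<psi> \<in> \<Phi> \<Longrightarrow> y \<in> W \<Longrightarrow> \<psi> \<in> y \<Longrightarrow> mx \<psi> \<in> base \<Phi>"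
  by (auto simp: base_def)

end

lemma finite_subfms: "finite (subfms \<phi>)"
  by (induction \<phi>) auto

lemma subfms_refl: "\<phi> \<in> subfms \<phi>"
  by (cases \<phi>) auto

text \<open>The negation of \<phi> is counted by \<open>fm_size\<close> without being a subformula
  of \<phi>; this unit pays for one of the two extra points in \<open>base\<close>.\<close>

lemma fm_size_ge: "card (subfms \<phi>) + 1 \<le> fm_size \<phi>"
proof -
  have sz: "size \<psi> \<le> size \<phi>" if "\<psi> \<in> subfms \<phi>" for \<psi> using that by (induction \<phi>) auto
  have "Neg \<phi> \<notin> subfms \<phi>" using sz[of "Neg \<phi>"] by auto
  then have "card (insert (Neg \<phi>) (subfms \<phi>)) = card (subfms \<phi>) + 1" using finite_subfms by simp
  moreover have "insert (Neg \<phi>) (subfms \<phi>) \<subseteq> subfms \<phi> \<union> Neg ` subfms \<phi>" using subfms_refl by auto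
  then have "card (insert (Neg \<phi>) (subfms \<phi>)) \<le> fm_size \<phi>"
    unfolding fm_size_def using finite_subfms by (intro card_mono) auto
  ultimately show ?thesis by simp
qed

lemma finite_sig: "finite (sig \<phi>)"
  by (induction \<phi>) auto

text \<open>Without an interpolant, \<open>Neg \<phi>\<^sub>2\<close> is consistent with the
  consequences of \<open>\<phi>\<^sub>1\<close> in the common signature, since a finite conjunction
  of these would interpolate. The common part of the resulting type is consistent with
  \<open>\<phi>\<^sub>1\<close>, because the negation of an inconsistent finite part would itself be
  such a consequence.\<close>

lemma (in k43_logic) separation:
  assumes "\<nexists>\<iota>. craig_interpolant L \<phi>\<^sub>1 \<phi>\<^sub>2 \<iota>"
    and \<delta>: "\<delta> = sig \<phi>\<^sub>1 \<union> sig \<phi>\<^sub>2" and \<sigma>: "\<sigma> = sig \<phi>\<^sub>1 \<inter> sig \<phi>\<^sub>2"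
  obtains x\<^sub>1 x\<^sub>2 where "mcs \<delta> x\<^sub>1" "mcs \<delta> x\<^sub>2" "\<phi>\<^sub>1 \<in> x\<^sub>1" "Neg \<phi>\<^sub>2 \<in> x\<^sub>2" "x\<^sub>1 \<inter> Fm \<sigma> = x\<^sub>2 \<inter> Fm \<sigma>"
proof -
  have F: "\<phi>\<^sub>1 \<in> Fm \<delta>" "\<phi>\<^sub>2 \<in> Fm \<delta>" "Fm \<sigma> \<subseteq> Fm \<delta>" by (auto simp: \<delta> \<sigma> Fm_def)
  define \<Gamma> where "\<Gamma> = {\<chi> \<in> Fm \<sigma>. Imp \<phi>\<^sub>1 \<chi> \<in> L}"
  have conj: "Imp \<phi>\<^sub>1 (Conj ys) \<in> L" if "set ys \<subseteq> \<Gamma>" for ys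
    using that
  proof (induction ys)
    case Nil
    then show ?case by (intro taut) (simp add: tautology_def)
  next
    case (Cons \<chi> ys)
    have "Imp \<phi>\<^sub>1 \<chi> \<in> L" "Imp \<phi>\<^sub>1 (Conj ys) \<in> L" using Cons by (auto simp: \<Gamma>_def)
    then show ?case by (rule taut_mp2) (auto simp: tautology_def)
  qed
  have "cons (insert (Neg \<phi>\<^sub>2) \<Gamma>)"
  proof (rule ccontr)
    assume "\<not> ?thesis"
    then obtain ys where ys: "set ys \<subseteq> \<Gamma>" "Neg (And (Neg \<phi>\<^sub>2) (Conj ys)) \<in> L" by (rule cons_insert)
    have "Imp (Conj ys) \<phi>\<^sub>2 \<in> L" by (rule taut_mp[OF ys(2)]) (auto simp: tautology_def)
    moreover have "Conj ys \<in> Fm \<sigma>" using ys by (auto simp: \<Gamma>_def)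
    ultimately have "craig_interpolant L \<phi>\<^sub>1 \<phi>\<^sub>2 (Conj ys)"
      using conj[OF ys(1)] by (simp add: craig_interpolant_def Fm_def \<sigma>)
    then show False using assms(1) by blast
  qed
  then obtain x\<^sub>2 where x2: "mcs \<delta> x\<^sub>2" "insert (Neg \<phi>\<^sub>2) \<Gamma> \<subseteq> x\<^sub>2"
    using lindenbaum[of "insert (Neg \<phi>\<^sub>2) \<Gamma>" \<delta>] F by (auto simp: \<Gamma>_def)
  have "cons (insert \<phi>\<^sub>1 (x\<^sub>2 \<inter> Fm \<sigma>))"
  proof (rule ccontr)
    assume "\<not> ?thesis"
    then obtain ys where ys: "set ys \<subseteq> x\<^sub>2 \<inter> Fm \<sigma>" "Neg (And \<phi>\<^sub>1 (Conj ys)) \<in> L" by (rule cons_insert)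
    have "Imp \<phi>\<^sub>1 (Neg (Conj ys)) \<in> L" by (rule taut_mp[OF ys(2)]) (auto simp: tautology_def)
    then have "Neg (Conj ys) \<in> \<Gamma>" using ys by (auto simp: \<Gamma>_def)
    then have "Neg (Conj ys) \<in> x\<^sub>2" using x2 by blast
    moreover have sub: "set ys \<subseteq> Fm \<delta>" using ys F by blast
    ultimately show False using mcs_Neg[OF x2(1), of "Conj ys"] mcs_Conj[OF x2(1) sub] ys by simp
  qed
  then obtain x\<^sub>1 where x1: "mcs \<delta> x\<^sub>1" "insert \<phi>\<^sub>1 (x\<^sub>2 \<inter> Fm \<sigma>) \<subseteq> x\<^sub>1"
    using lindenbaum[of "insert \<phi>\<^sub>1 (x\<^sub>2 \<inter> Fm \<sigma>)" \<delta>] F by auto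
  have s: "\<sigma> \<subseteq> \<delta>" by (auto simp: \<delta> \<sigma>)
  have "x\<^sub>2 \<inter> Fm \<sigma> = x\<^sub>1 \<inter> Fm \<sigma>"
    by (rule mcs_subset_eq[OF mcs_restrict[OF x2(1) s] mcs_restrict[OF x1(1) s]]) (use x1 in blast)
  then show thesis using that x1 x2 by auto
qed

lemma (in build) frame_for_N:
  assumes L: "L = oplus K43 {canonical_fm (S' j) (as j) (D j) | j. j \<in> J}"
    and cd: "\<And>j. j \<in> J \<Longrightarrow> canonical_data (V j) (S' j) (as j) (D j)"
    and c: "\<And>j. j \<in> J \<Longrightarrow> card (V j) \<le> c"
  shows "frame_for L N"
proof -
  have gf: "general_frame N" unfolding N_def using bmodel_general Bs_ne ws_ne by blast
  have lin: "linear_frame N" unfolding N_def using total_frame_linear bmodel_total by blast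
  have sub: "subst s (canonical_fm (S' j) (as j) (D j)) \<in> L" if "j \<in> J" for s j
    unfolding L oplus_def using that by (intro nml.sub nml.ax) auto
  have "valid N \<phi>" if "\<phi> \<in> K43 \<union> {canonical_fm (S' j) (as j) (D j) | j. j \<in> J}" for \<phi>
    using that K43_sound[OF gf lin] N_validates[OF cd c sub] by blast
  then have "valid N \<phi>" if "\<phi> \<in> L" for \<phi>
    using nml_sound[OF gf _ that[unfolded L oplus_def]] by blast
  then show ?thesis using gf by (simp add: frame_for_def)
qed

lemma (in proj) base_build:
  assumes fin: "finite \<Phi>" and Q: "finite Q" "Q \<subseteq> F.W" "pr ` close c (base \<Phi>) \<subseteq> Q"
    and Qsup: "\<And>s. s \<in> Q \<Longrightarrow> \<not> crel s s \<Longrightarrow> s \<noteq> pr x \<Longrightarrow> supported F.W c Q s"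
  shows "build L X x Y c (close c (base \<Phi>)) Q"
proof unfold_locales
  show "finite (close c (base \<Phi>))" by (rule close_finite[OF base_finite[OF fin]])
  show "close c (base \<Phi>) \<subseteq> W" by (rule close_W[OF base_W])
  show "x \<in> close c (base \<Phi>)" by (simp add: close_def base_def)
  show "\<exists>y\<in>close c (base \<Phi>). dm W y \<and> (\<forall>z\<in>W. z = y \<or> crel z y)"
    using base_final[of \<Phi>] unfolding close_def by blast
qed (use Q Qsup close_supported[OF base_W] in auto)

lemma (in proj) close_supported_down:
  assumes "s \<in> pr ` close c (base \<Phi>)" "\<not> crel s s" "s \<noteq> pr x"
  shows "supported F.W c (pr ` close c (base \<Phi>)) s"
proof -
  obtain u where u: "u \<in> close c (base \<Phi>)" "s = pr u" using assms by blast
  have uW: "u \<in> W" using u close_W[OF base_W] by blast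
  have "\<not> crel u u" "u \<noteq> x" using assms u pr_mono by auto
  then show ?thesis
    using supported_down[OF close_W[OF base_W] uW] close_supported[OF base_W u(1)] u assms by blast
qed

lemma supported_mono: "supported W c T s \<Longrightarrow> T \<subseteq> T' \<Longrightarrow> supported W c T' s"
  unfolding supported_def by blast

lemma (in build) truth_base:
  assumes T: "T = close c (base (subfms \<phi>))" and "\<phi> \<in> Fm X" "p \<in> worlds N"
  shows "holds N (snd (bmodel Bs)) p \<phi> \<longleftrightarrow> \<phi> \<in> g p"
proof (rule truth[OF _ assms(2,3)])
  fix \<psi> y assume y: "\<psi> \<in> subfms \<phi>" "y \<in> W" "\<psi> \<in> y"
  then have "mx \<psi> \<in> T" using base_mx T by (auto simp: close_def)
  then obtain b where b: "b \<in> set Bs" "mx \<psi> \<in> set (ws b)" using Bs_cover_T by blast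
  then have "reg b" using nreg mx(3)[OF y(2,3)] by blast
  then show "\<exists>b\<in>set Bs. reg b \<and> (\<exists>z\<in>set (ws b). \<psi> \<in> z \<and> (y = z \<or> crel y z))"
    using b mx(2,4)[OF y(2,3)] by blast
qed

text \<open>Points are related if they have the same type over \<open>Y\<close> and the same label.
  As \<open>sees\<close> and \<open>admissible\<close> refer only to the shared frame and to
  \<open>Q\<close>, a move abstracted from one sum by \<open>acc_sees\<close> is carried out in the
  other by \<open>sees_acc\<close>.\<close>

lemma build_bisimulation:
  assumes b1: "build L X x\<^sub>1 Y c T\<^sub>1 Q" and b2: "build L X x\<^sub>2 Y c T\<^sub>2 Q"
    and x: "x\<^sub>1 \<inter> Fm Y = x\<^sub>2 \<inter> Fm Y"
  shows "\<exists>r\<^sub>1 r\<^sub>2. is_root (blocks.N (build.Bs L X x\<^sub>1 Y c T\<^sub>1 Q)) r\<^sub>1 \<and> blocks.g (build.Bs L X x\<^sub>1 Y c T\<^sub>1 Q) r\<^sub>1 = x\<^sub>1 \<and>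
    is_root (blocks.N (build.Bs L X x\<^sub>2 Y c T\<^sub>2 Q)) r\<^sub>2 \<and> blocks.g (build.Bs L X x\<^sub>2 Y c T\<^sub>2 Q) r\<^sub>2 = x\<^sub>2 \<and>
    bisimilar Y (bmodel (build.Bs L X x\<^sub>1 Y c T\<^sub>1 Q)) r\<^sub>1 (bmodel (build.Bs L X x\<^sub>2 Y c T\<^sub>2 Q)) r\<^sub>2"
proof -
  interpret A: build L X x\<^sub>1 Y c T\<^sub>1 Q by fact
  interpret B: build L X x\<^sub>2 Y c T\<^sub>2 Q by fact
  have prx: "A.pr x\<^sub>1 = B.pr x\<^sub>2" using x by (simp add: A.pr_def B.pr_def)
  have FW: "A.F.W = B.F.W" by (simp only: prx)
  define Z where "Z = {(p, q). p \<in> worlds A.N \<and> q \<in> worlds B.N \<and> B.pr (A.g p) = B.pr (B.g q) \<and> A.lab p = B.lab q}"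
  have "bisimulation Y (bmodel A.Bs) (bmodel B.Bs) Z"
    unfolding bisimulation_def A.N_def[symmetric] B.N_def[symmetric]
  proof (intro conjI ballI)
    show "Z \<subseteq> worlds A.N \<times> worlds B.N" by (auto simp: Z_def)
    fix pq assume "pq \<in> Z"
    then obtain p q where pq: "pq = (p, q)" and p: "p \<in> worlds A.N" and q: "q \<in> worlds B.N"
      and e: "B.pr (A.g p) = B.pr (B.g q)" and l: "A.lab p = B.lab q" by (auto simp: Z_def)
    have var: "p \<in> snd (bmodel A.Bs) v \<longleftrightarrow> q \<in> snd (bmodel B.Bs) v" if "v \<in> Y" for v
    proof -
      have "Var v \<in> A.g p \<longleftrightarrow> Var v \<in> B.g q" using arg_cong[OF e, of "\<lambda>s. Var v \<in> s"] that by (simp add: B.pr_def)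
      moreover have "Var v \<in> Fm X" using that A.sub by auto
      moreover have "p \<in> snd (bmodel A.Bs) v \<longleftrightarrow> Var v \<in> A.g p"
        unfolding bmodel_val using p bval_iff[OF _ A.ws_ne[OF A.blk[OF p]]]
        by (cases p) (auto simp: A.N_worlds A.g_def)
      moreover have "q \<in> snd (bmodel B.Bs) v \<longleftrightarrow> Var v \<in> B.g q"
        unfolding bmodel_val using q bval_iff[OF _ B.ws_ne[OF B.blk[OF q]]]
        by (cases q) (auto simp: B.N_worlds B.g_def)
      ultimately show ?thesis by simp
    qed
    have forth: "\<exists>q'\<in>worlds B.N. acc B.N q q' \<and> (p', q') \<in> Z" if p': "p' \<in> worlds A.N" "acc A.N p p'" for p'
    proof -
      have "sees B.F.W c (B.pr (B.g q)) (B.lab q) (B.pr (A.g p')) (A.lab p')"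
        using A.acc_sees[OF p p'] e l unfolding FW by simp
      moreover have "admissible B.F.W Q (B.pr (A.g p')) (A.lab p')"
        using A.admissible_N[OF p'(1)] unfolding FW by simp
      ultimately obtain q' where "q' \<in> worlds B.N" "B.pr (B.g q') = B.pr (A.g p')" "B.lab q' = A.lab p'" "acc B.N q q'"
        using B.sees_acc[OF q] by blast
      then show ?thesis using p' by (auto simp: Z_def)
    qed
    have backward: "\<exists>p'\<in>worlds A.N. acc A.N p p' \<and> (p', q') \<in> Z" if q': "q' \<in> worlds B.N" "acc B.N q q'" for q'
    proof -
      have "sees A.F.W c (A.pr (A.g p)) (A.lab p) (B.pr (B.g q')) (B.lab q')"
        using B.acc_sees[OF q q'] e l unfolding FW by simp
      moreover have "admissible A.F.W Q (B.pr (B.g q')) (B.lab q')"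
        using B.admissible_N[OF q'(1)] unfolding FW .
      ultimately obtain p' where "p' \<in> worlds A.N" "A.pr (A.g p') = B.pr (B.g q')" "A.lab p' = B.lab q'" "acc A.N p p'"
        using A.sees_acc[OF p] by blast
      then show ?thesis using q' by (auto simp: Z_def)
    qed
    show "case pq of (p, q) \<Rightarrow> (\<forall>v\<in>Y. (p \<in> snd (bmodel A.Bs) v) = (q \<in> snd (bmodel B.Bs) v)) \<and>
        (\<forall>p'\<in>worlds A.N. acc A.N p p' \<longrightarrow> (\<exists>q'\<in>worlds B.N. acc B.N q q' \<and> (p', q') \<in> Z)) \<and>
        (\<forall>q'\<in>worlds B.N. acc B.N q q' \<longrightarrow> (\<exists>p'\<in>worlds A.N. acc A.N p p' \<and> (p', q') \<in> Z))"
      unfolding pq using var forth backward by auto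
  qed
  moreover obtain r\<^sub>1 where r1: "r\<^sub>1 \<in> worlds A.N" "A.g r\<^sub>1 = x\<^sub>1" "A.lab r\<^sub>1 = None" "is_root A.N r\<^sub>1"
    using A.root_point by blast
  moreover obtain r\<^sub>2 where r2: "r\<^sub>2 \<in> worlds B.N" "B.g r\<^sub>2 = x\<^sub>2" "B.lab r\<^sub>2 = None" "is_root B.N r\<^sub>2"
    using B.root_point by blast
  moreover have "(r\<^sub>1, r\<^sub>2) \<in> Z" using r1 r2 prx by (auto simp: Z_def)
  ultimately show ?thesis unfolding bisimilar_def by blast
qed

text \<open>\<open>k_bound\<close> is three times \<open>m\<close>. The main summand of
  \<open>p_bound\<close> is at least \<open>c + 2\<close>, and adding \<open>k_bound\<close>, which
  is at least 3, takes it past \<open>c + 3\<close>.\<close>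

lemma bound_le:
  assumes t1: "t \<le> m * (c + 3)" and q: "q \<le> 2 * m * (c + 3)" and m: "m = max (fm_size \<phi>\<^sub>1) (fm_size \<phi>\<^sub>2) + 1"
  shows "t + q \<le> (3 * k_bound \<phi>\<^sub>1 \<phi>\<^sub>2 - 1) * max (c + 2) (p_bound c \<phi>\<^sub>1 \<phi>\<^sub>2)"
proof -
  let ?k = "k_bound \<phi>\<^sub>1 \<phi>\<^sub>2"
  have k: "?k = 3 * m" "3 \<le> ?k" by (auto simp: k_bound_def m)
  have "t + q \<le> 3 * m * (c + 3)" using t1 q by linarith
  also have "\<dots> = ?k * (c + 3)" using k by simp
  also have "\<dots> \<le> (3 * ?k - 1) * max (c + 2) (p_bound c \<phi>\<^sub>1 \<phi>\<^sub>2)"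
  proof (rule mult_le_mono)
    show "?k \<le> 3 * ?k - 1" using k by linarith
    define A where "A = 2 * (?k - 1) * max (c + 2) ?k"
    have "1 * (c + 2) \<le> A" unfolding A_def using k by (intro mult_le_mono) auto
    then have "c + 2 + 1 \<le> A + ?k" using k(2) by (intro add_mono) simp_all
    then have "c + 3 \<le> p_bound c \<phi>\<^sub>1 \<phi>\<^sub>2" unfolding p_bound_def A_def by simp
    then show "c + 3 \<le> max (c + 2) (p_bound c \<phi>\<^sub>1 \<phi>\<^sub>2)" by linarith
  qed
  finally show ?thesis .
qed

theorem theorem4p7:
  fixes L :: "fm set"
    and J :: "'j set"
    and V :: "'j \<Rightarrow> 'v set"
    and S :: "'j \<Rightarrow> 'v \<Rightarrow> 'v \<Rightarrow> bool"
    and as :: "'j \<Rightarrow> 'v list"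
    and D :: "'j \<Rightarrow> 'v set"
    and c :: nat
  assumes "finite J"
    and "\<And>j. j \<in> J \<Longrightarrow> canonical_data (V j) (S j) (as j) (D j)"
    and "L = oplus K43 {canonical_fm (S j) (as j) (D j) | j. j \<in> J}"
    and "c = c_bound J V"
  shows "quasi_polysize_bmp L
           (\<lambda>\<phi>\<^sub>1 \<phi>\<^sub>2. (3 * k_bound \<phi>\<^sub>1 \<phi>\<^sub>2 - 1) * max (c + 2) (p_bound c \<phi>\<^sub>1 \<phi>\<^sub>2))"
proof -
  interpret k43_logic L unfolding assms(3) by (rule k43_logic_oplus)
  have cV: "card (V j) \<le> c" if "j \<in> J" for j
    unfolding assms(4) c_bound_def using assms(1) that by (intro Max_ge) auto
  show ?thesis
    unfolding quasi_polysize_bmp_def Let_def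
  proof (intro allI impI)
    fix \<phi>\<^sub>1 \<phi>\<^sub>2 assume "\<nexists>\<iota>. craig_interpolant L \<phi>\<^sub>1 \<phi>\<^sub>2 \<iota>"
    define \<delta> where "\<delta> = sig \<phi>\<^sub>1 \<union> sig \<phi>\<^sub>2"
    define \<sigma> where "\<sigma> = sig \<phi>\<^sub>1 \<inter> sig \<phi>\<^sub>2"
    obtain x\<^sub>1 x\<^sub>2 where x: "mcs \<delta> x\<^sub>1" "mcs \<delta> x\<^sub>2" "\<phi>\<^sub>1 \<in> x\<^sub>1" "Neg \<phi>\<^sub>2 \<in> x\<^sub>2" "x\<^sub>1 \<inter> Fm \<sigma> = x\<^sub>2 \<inter> Fm \<sigma>"
      using separation[OF \<open>\<nexists>\<iota>. _\<close> \<delta>_def \<sigma>_def] by blast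
    have F: "\<phi>\<^sub>1 \<in> Fm \<delta>" "\<phi>\<^sub>2 \<in> Fm \<delta>" by (auto simp: \<delta>_def Fm_def)
    have fin: "finite \<delta>" "\<sigma> \<subseteq> \<delta>" using finite_sig by (auto simp: \<delta>_def \<sigma>_def)
    interpret P: proj L \<delta> x\<^sub>1 \<sigma> using x fin by unfold_locales auto
    interpret R: proj L \<delta> x\<^sub>2 \<sigma> using x fin by unfold_locales auto
    have prx: "P.pr x\<^sub>1 = R.pr x\<^sub>2" using x by (simp add: P.pr_def R.pr_def)
    have FW: "P.F.W = R.F.W" by (simp only: prx)
    define T\<^sub>1 where "T\<^sub>1 = P.close c (P.base (subfms \<phi>\<^sub>1))"
    define T\<^sub>2 where "T\<^sub>2 = R.close c (R.base (subfms \<phi>\<^sub>2))"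
    \<comment> \<open>Each part is the projection of a supported selection, so irreflexive types in
      \<open>Q\<close> are supported from the side they come from.\<close>
    define Q where "Q = P.pr ` T\<^sub>1 \<union> R.pr ` T\<^sub>2"
    have T: "T\<^sub>1 \<subseteq> P.W" "T\<^sub>2 \<subseteq> R.W" "finite T\<^sub>1" "finite T\<^sub>2"
      unfolding T\<^sub>1_def T\<^sub>2_def
      by (rule P.close_W[OF P.base_W] R.close_W[OF R.base_W] P.close_finite[OF P.base_finite[OF finite_subfms]]
          R.close_finite[OF R.base_finite[OF finite_subfms]])+
    have finQ: "finite Q" using T by (simp add: Q_def)
    have QF: "Q \<subseteq> P.F.W" using T P.pr_W R.pr_W unfolding Q_def FW by blast
    have Qsup: "supported P.F.W c Q s" if "s \<in> Q" "\<not> crel s s" "s \<noteq> P.pr x\<^sub>1" for s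
      using that P.close_supported_down[of s c "subfms \<phi>\<^sub>1"] R.close_supported_down[of s c "subfms \<phi>\<^sub>2"]
        supported_mono[of P.F.W c _ s Q] unfolding T\<^sub>1_def[symmetric] T\<^sub>2_def[symmetric] FW prx Q_def by blast
    have b1: "build L \<delta> x\<^sub>1 \<sigma> c T\<^sub>1 Q"
      unfolding T\<^sub>1_def by (rule P.base_build[OF finite_subfms finQ QF _ Qsup]) (auto simp: Q_def T\<^sub>1_def)
    have b2: "build L \<delta> x\<^sub>2 \<sigma> c T\<^sub>2 Q"
      unfolding T\<^sub>2_def
      by (rule R.base_build[OF finite_subfms finQ QF[unfolded FW] _ Qsup[unfolded FW prx]])
        (auto simp: Q_def T\<^sub>2_def)
    interpret A: build L \<delta> x\<^sub>1 \<sigma> c T\<^sub>1 Q by fact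
    interpret B: build L \<delta> x\<^sub>2 \<sigma> c T\<^sub>2 Q by fact
    obtain r\<^sub>1 r\<^sub>2 where r: "is_root A.N r\<^sub>1" "A.g r\<^sub>1 = x\<^sub>1" "is_root B.N r\<^sub>2" "B.g r\<^sub>2 = x\<^sub>2"
      and bis: "bisimilar \<sigma> (bmodel A.Bs) r\<^sub>1 (bmodel B.Bs) r\<^sub>2"
      using build_bisimulation[OF b1 b2 x(5)] by blast
    have rN: "r\<^sub>1 \<in> worlds A.N" "r\<^sub>2 \<in> worlds B.N" using r by (auto simp: is_root_def)
    have h1: "holds A.N (snd (bmodel A.Bs)) r\<^sub>1 \<phi>\<^sub>1" using A.truth_base[OF T\<^sub>1_def F(1) rN(1)] r x by simp
    have "\<phi>\<^sub>2 \<notin> x\<^sub>2" using mcs_Neg[OF x(2) F(2)] x(4) by blast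
    then have h2: "holds B.N (snd (bmodel B.Bs)) r\<^sub>2 (Neg \<phi>\<^sub>2)" using B.truth_base[OF T\<^sub>2_def F(2) rN(2)] r by simp
    \<comment> \<open>\<open>base\<close> has up to two points more than there are subformulas, the
      root and a last point of \<open>Top\<close>; by \<open>fm_size_ge\<close> this exceeds the
      formula size by at most one.\<close>
    define m where "m = max (fm_size \<phi>\<^sub>1) (fm_size \<phi>\<^sub>2) + 1"
    have c1: "card T\<^sub>1 \<le> m * (c + 3)"
    proof -
      have "card (P.base (subfms \<phi>\<^sub>1)) \<le> m"
        using P.base_card[OF finite_subfms, of \<phi>\<^sub>1] fm_size_ge[of \<phi>\<^sub>1] by (simp add: m_def)
      then have "card (P.base (subfms \<phi>\<^sub>1)) * (c + 3) \<le> m * (c + 3)" by (rule mult_le_mono1)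
      then show ?thesis
        using P.close_card[of "P.base (subfms \<phi>\<^sub>1)" c] P.base_finite[OF finite_subfms, of \<phi>\<^sub>1] unfolding T\<^sub>1_def by linarith
    qed
    have c2: "card T\<^sub>2 \<le> m * (c + 3)"
    proof -
      have "card (R.base (subfms \<phi>\<^sub>2)) \<le> m"
        using R.base_card[OF finite_subfms, of \<phi>\<^sub>2] fm_size_ge[of \<phi>\<^sub>2] by (simp add: m_def)
      then have "card (R.base (subfms \<phi>\<^sub>2)) * (c + 3) \<le> m * (c + 3)" by (rule mult_le_mono1)
      then show ?thesis
        using R.close_card[of "R.base (subfms \<phi>\<^sub>2)" c] R.base_finite[OF finite_subfms, of \<phi>\<^sub>2] unfolding T\<^sub>2_def by linarith
    qed
    have "card Q \<le> card (P.pr ` T\<^sub>1) + card (R.pr ` T\<^sub>2)" unfolding Q_def by (rule card_Un_le)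
    also have "\<dots> \<le> card T\<^sub>1 + card T\<^sub>2" using T by (intro add_mono card_image_le) auto
    finally have cQ: "card Q \<le> 2 * m * (c + 3)" using c1 c2 by linarith
    let ?bound = "(3 * k_bound \<phi>\<^sub>1 \<phi>\<^sub>2 - 1) * max (c + 2) (p_bound c \<phi>\<^sub>1 \<phi>\<^sub>2)"
    have s1: "seq_size (bseq A.Bs) \<le> ?bound"
      using A.size_Bs bound_le[OF c1 cQ m_def] by (simp add: seq_size_bseq)
    have s2: "seq_size (bseq B.Bs) \<le> ?bound"
      using B.size_Bs bound_le[OF c2 cQ m_def] by (simp add: seq_size_bseq)
    have f1: "frame_for L A.N" by (rule A.frame_for_N[OF assms(3,2) cV])
    have f2: "frame_for L B.N" by (rule B.frame_for_N[OF assms(3,2) cV])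
    have m1: "is_model \<delta> (bmodel A.Bs)" using bmodel_is_model A.Bs_ne A.ws_ne by blast
    have m2: "is_model \<delta> (bmodel B.Bs)" using bmodel_is_model B.Bs_ne B.ws_ne by blast
    note N = A.N_def B.N_def
    show "\<exists>As\<^sub>1 As\<^sub>2 N\<^sub>1 N\<^sub>2 r\<^sub>1 r\<^sub>2.
        simple_atomic_seq (sig \<phi>\<^sub>1 \<union> sig \<phi>\<^sub>2) As\<^sub>1 \<and> N\<^sub>1 = osum (seq_models As\<^sub>1) \<and>
        simple_atomic_seq (sig \<phi>\<^sub>1 \<union> sig \<phi>\<^sub>2) As\<^sub>2 \<and> N\<^sub>2 = osum (seq_models As\<^sub>2) \<and>
        is_model (sig \<phi>\<^sub>1 \<union> sig \<phi>\<^sub>2) N\<^sub>1 \<and> is_root (fst N\<^sub>1) r\<^sub>1 \<and>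
        is_model (sig \<phi>\<^sub>1 \<union> sig \<phi>\<^sub>2) N\<^sub>2 \<and> is_root (fst N\<^sub>2) r\<^sub>2 \<and>
        holds (fst N\<^sub>1) (snd N\<^sub>1) r\<^sub>1 \<phi>\<^sub>1 \<and> holds (fst N\<^sub>2) (snd N\<^sub>2) r\<^sub>2 (Neg \<phi>\<^sub>2) \<and>
        frame_for L (fst N\<^sub>1) \<and> frame_for L (fst N\<^sub>2) \<and>
        bisimilar (sig \<phi>\<^sub>1 \<inter> sig \<phi>\<^sub>2) N\<^sub>1 r\<^sub>1 N\<^sub>2 r\<^sub>2 \<and>
        seq_size As\<^sub>1 \<le> ?bound \<and> seq_size As\<^sub>2 \<le> ?bound"
      unfolding \<delta>_def[symmetric] \<sigma>_def[symmetric]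
      using A.simple_seq B.simple_seq m1 m2 r(1,3) h1 h2 f1 f2 bis s1 s2 unfolding N by blast
  qed
qed

end
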